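(* Let $k$ be a field of characteristic $0$ and let $\Theta$ be the variety of all representations of Lie algebras over $k$ over $k$-linear spaces. Let $\mathfrak{A}$ be the group of all automorphisms of the category $\Theta^0$ and $\mathfrak{Y}$ its normal subgroup of all inner automorphisms. Then $\mathfrak{A}/\mathfrak{Y}\cong\mathrm{Aut}\,k$, where $\mathrm{Aut}\,k$ is the group of all automorphisms of the field $k$.
   Context: A representation of a Lie algebra over a $k$-linear space is a two-sorted algebra $H$ with sorts $\Gamma=\{1,2\}$: $H^{(1)}$ is a Lie algebra over $k$, $H^{(2)}$ is a $k$-linear space, and there is a $k$-bilinear operation $\circ$ of type $(1,2;2)$ with $[l_1,l_2]\circ v=l_1\circ(l_2\circ v)-l_2\circ(l_1\circ v)$. The signature consists of zero, negation, addition and, for each $\lambda\in k$, the unary operation of multiplication by the scalar $\lambda$, in each of the two sorts; the Lie bracket $[\,,]$ of type $(1,1;1)$; and $\circ$. A homomorphism is a sort-preserving map commuting with all these operations, i.e. a pair consisting of a homomorphism of Lie algebras over $k$ and a $k$-linear map compatible with the actions. $\Theta$ is the variety of all such algebras. Let $X_0$ be a two-sorted set with countably infinitely many elements of each sort. The objects of $\Theta^0$ are the free algebras $F(X)$ of $\Theta$ with $X\subset X_0$ finite, the morphisms are all homomorphisms. Explicitly, if $X^{(i)}$ is the set of elements of $X$ of sort $i$, then $F(X)^{(1)}=L(X^{(1)})$ is the free Lie algebra over $k$ on $X^{(1)}$ and $F(X)^{(2)}$ is the free left module with basis $X^{(2)}$ over the free associative $k$-algebra with unit $A(X^{(1)})$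 on $X^{(1)}$. An automorphism $\Upsilon$ of a category $\mathfrak{K}$ is inner if it is isomorphic, as a functor, to the identity automorphism of $\mathfrak{K}$; that is, there are isomorphisms $s_A:A\to\Upsilon(A)$ ($A\in\mathrm{Ob}\,\mathfrak{K}$) such that $\Upsilon(\mu)s_A=s_B\mu$ for every morphism $\mu:A\to B$. *)

theory Defs
  imports "HOL-Algebra.Bij" "HOL-Algebra.Coset" "HOL-Library.Countable_Set"
begin

section \<open>The variety of representations of Lie algebras\<close>

text \<open>
  A two-sorted algebra is a record with one carrier set per sort. The operations are functions on
  the whole type; only their values on the carriers matter.
\<close>

record ('k, 'a, 'b) rep_alg =
  lcar :: "'a set"
  lzero :: "'a"
  lneg :: "'a \<Rightarrow> 'a"
  ladd :: "'a \<Rightarrow> 'a \<Rightarrow> 'a"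
  lscale :: "'k \<Rightarrow> 'a \<Rightarrow> 'a"
  lbr :: "'a \<Rightarrow> 'a \<Rightarrow> 'a"
  mcar :: "'b set"
  mzero :: "'b"
  mneg :: "'b \<Rightarrow> 'b"
  madd :: "'b \<Rightarrow> 'b \<Rightarrow> 'b"
  mscale :: "'k \<Rightarrow> 'b \<Rightarrow> 'b"
  act :: "'a \<Rightarrow> 'b \<Rightarrow> 'b"

locale lin_space =
  fixes V :: "'a set" and zero :: "'a" and neg :: "'a \<Rightarrow> 'a" and add :: "'a \<Rightarrow> 'a \<Rightarrow> 'a"
    and scale :: "'k::field \<Rightarrow> 'a \<Rightarrow> 'a"
  assumes zero_closed: "zero \<in> V"
    and neg_closed: "x \<in> V \<Longrightarrow> neg x \<in> V"
    and add_closed: "x \<in> V \<Longrightarrow> y \<in> V \<Longrightarrow> add x y \<in> V"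
    and scale_closed: "x \<in> V \<Longrightarrow> scale c x \<in> V"
    and add_assoc: "x \<in> V \<Longrightarrow> y \<in> V \<Longrightarrow> z \<in> V \<Longrightarrow> add (add x y) z = add x (add y z)"
    and add_commute: "x \<in> V \<Longrightarrow> y \<in> V \<Longrightarrow> add x y = add y x"
    and add_zero: "x \<in> V \<Longrightarrow> add x zero = x"
    and add_neg: "x \<in> V \<Longrightarrow> add x (neg x) = zero"
    and scale_add: "x \<in> V \<Longrightarrow> y \<in> V \<Longrightarrow> scale c (add x y) = add (scale c x) (scale c y)"
    and add_scale: "x \<in> V \<Longrightarrow> scale (c + d) x = add (scale c x) (scale d x)"
    and scale_scale: "x \<in> V \<Longrightarrow> scale c (scale d x) = scale (c * d) x"
    and scale_one: "x \<in> V \<Longrightarrow> scale 1 x = x"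

locale lie_alg = lin_space V zero neg add scale
  for V :: "'a set" and zero neg add and scale :: "'k::field \<Rightarrow> 'a \<Rightarrow> 'a" +
  fixes br :: "'a \<Rightarrow> 'a \<Rightarrow> 'a"
  assumes br_closed: "x \<in> V \<Longrightarrow> y \<in> V \<Longrightarrow> br x y \<in> V"
    and br_add_left: "x \<in> V \<Longrightarrow> y \<in> V \<Longrightarrow> z \<in> V \<Longrightarrow> br (add x y) z = add (br x z) (br y z)"
    and br_add_right: "x \<in> V \<Longrightarrow> y \<in> V \<Longrightarrow> z \<in> V \<Longrightarrow> br x (add y z) = add (br x y) (br x z)"
    and br_scale_left: "x \<in> V \<Longrightarrow> y \<in> V \<Longrightarrow> br (scale c x) y = scale c (br x y)"
    and br_scale_right: "x \<in> V \<Longrightarrow> y \<in> V \<Longrightarrow> br x (scale c y) = scale c (br x y)"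
    and br_self: "x \<in> V \<Longrightarrow> br x x = zero"
    and jacobi: "x \<in> V \<Longrightarrow> y \<in> V \<Longrightarrow> z \<in> V \<Longrightarrow>
      add (add (br x (br y z)) (br y (br z x))) (br z (br x y)) = zero"

locale lie_rep =
  lie: lie_alg "lcar H" "lzero H" "lneg H" "ladd H" "lscale H" "lbr H" +
  md: lin_space "mcar H" "mzero H" "mneg H" "madd H" "mscale H"
  for H :: "('k::field, 'a, 'b) rep_alg" +
  assumes act_closed: "l \<in> lcar H \<Longrightarrow> v \<in> mcar H \<Longrightarrow> act H l v \<in> mcar H"
    and act_add_left: "l \<in> lcar H \<Longrightarrow> l' \<in> lcar H \<Longrightarrow> v \<in> mcar H \<Longrightarrow>
      act H (ladd H l l') v = madd H (act H l v) (act H l' v)"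
    and act_add_right: "l \<in> lcar H \<Longrightarrow> v \<in> mcar H \<Longrightarrow> v' \<in> mcar H \<Longrightarrow>
      act H l (madd H v v') = madd H (act H l v) (act H l v')"
    and act_scale_left: "l \<in> lcar H \<Longrightarrow> v \<in> mcar H \<Longrightarrow>
      act H (lscale H c l) v = mscale H c (act H l v)"
    and act_scale_right: "l \<in> lcar H \<Longrightarrow> v \<in> mcar H \<Longrightarrow>
      act H l (mscale H c v) = mscale H c (act H l v)"
    and act_br: "l \<in> lcar H \<Longrightarrow> l' \<in> lcar H \<Longrightarrow> v \<in> mcar H \<Longrightarrow>
      act H (lbr H l l') v = madd H (act H l (act H l' v)) (mneg H (act H l' (act H l v)))"

text \<open>
  Homomorphisms are pairs of maps; being \<^const>\<open>extensional\<close> makes equality of homomorphisms mean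
  equality on the carriers.
\<close>

definition rep_hom ::
  "('k, 'a, 'b) rep_alg \<Rightarrow> ('k, 'c, 'd) rep_alg \<Rightarrow> (('a \<Rightarrow> 'c) \<times> ('b \<Rightarrow> 'd)) set" where
  "rep_hom H G = {(f, g).
     f \<in> lcar H \<rightarrow>\<^sub>E lcar G \<and> g \<in> mcar H \<rightarrow>\<^sub>E mcar G \<and>
     f (lzero H) = lzero G \<and>
     (\<forall>x\<in>lcar H. f (lneg H x) = lneg G (f x)) \<and>
     (\<forall>x\<in>lcar H. \<forall>y\<in>lcar H. f (ladd H x y) = ladd G (f x) (f y)) \<and>
     (\<forall>c. \<forall>x\<in>lcar H. f (lscale H c x) = lscale G c (f x)) \<and>
     (\<forall>x\<in>lcar H. \<forall>y\<in>lcar H. f (lbr H x y) = lbr G (f x) (f y)) \<and>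
     g (mzero H) = mzero G \<and>
     (\<forall>v\<in>mcar H. g (mneg H v) = mneg G (g v)) \<and>
     (\<forall>v\<in>mcar H. \<forall>w\<in>mcar H. g (madd H v w) = madd G (g v) (g w)) \<and>
     (\<forall>c. \<forall>v\<in>mcar H. g (mscale H c v) = mscale G c (g v)) \<and>
     (\<forall>x\<in>lcar H. \<forall>v\<in>mcar H. g (act H x v) = act G (f x) (g v))}"


section \<open>Free algebras of the variety\<close>

text \<open>
  The free algebra on a two-sorted set is the algebra of terms in its elements, divided by the
  least congruence whose quotient lies in the variety.
\<close>

datatype (dead 'k, lvars: 'x) lterm =
    LVar 'x
  | LZero
  | LNeg "('k, 'x) lterm"
  | LAdd "('k, 'x) lterm" "('k, 'x) lterm"
  | LScale 'k "('k, 'x) lterm"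
  | LBr "('k, 'x) lterm" "('k, 'x) lterm"

datatype (dead 'k, mlvars: 'x, mvars: 'y) mterm =
    MVar 'y
  | MZero
  | MNeg "('k, 'x, 'y) mterm"
  | MAdd "('k, 'x, 'y) mterm" "('k, 'x, 'y) mterm"
  | MScale 'k "('k, 'x, 'y) mterm"
  | MAct "('k, 'x) lterm" "('k, 'x, 'y) mterm"

definition term_alg ::
  "'x set \<Rightarrow> 'y set \<Rightarrow> ('k, ('k, 'x) lterm, ('k, 'x, 'y) mterm) rep_alg" where
  "term_alg X Y = \<lparr>
     lcar = {t. lvars t \<subseteq> X}, lzero = LZero, lneg = LNeg, ladd = LAdd, lscale = LScale, lbr = LBr,
     mcar = {t. mlvars t \<subseteq> X \<and> mvars t \<subseteq> Y},
     mzero = MZero, mneg = MNeg, madd = MAdd, mscale = MScale, act = MAct \<rparr>"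

definition rep_cong :: "('k, 'a, 'b) rep_alg \<Rightarrow> ('a \<times> 'a) set \<Rightarrow> ('b \<times> 'b) set \<Rightarrow> bool" where
  "rep_cong H R S \<longleftrightarrow>
     equiv (lcar H) R \<and> equiv (mcar H) S \<and>
     (\<forall>(x, x') \<in> R. (lneg H x, lneg H x') \<in> R) \<and>
     (\<forall>(x, x') \<in> R. \<forall>(y, y') \<in> R. (ladd H x y, ladd H x' y') \<in> R) \<and>
     (\<forall>c. \<forall>(x, x') \<in> R. (lscale H c x, lscale H c x') \<in> R) \<and>
     (\<forall>(x, x') \<in> R. \<forall>(y, y') \<in> R. (lbr H x y, lbr H x' y') \<in> R) \<and>
     (\<forall>(v, v') \<in> S. (mneg H v, mneg H v') \<in> S) \<and>
     (\<forall>(v, v') \<in> S. \<forall>(w, w') \<in> S. (madd H v w, madd H v' w') \<in> S) \<and>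
     (\<forall>c. \<forall>(v, v') \<in> S. (mscale H c v, mscale H c v') \<in> S) \<and>
     (\<forall>(x, x') \<in> R. \<forall>(v, v') \<in> S. (act H x v, act H x' v') \<in> S)"

text \<open>
  For a congruence the union in the lifted operations below is over copies of one and the same
  class.
\<close>

definition lift1 :: "('b \<times> 'b) set \<Rightarrow> ('a \<Rightarrow> 'b) \<Rightarrow> 'a set \<Rightarrow> 'b set" where
  "lift1 R f C = (\<Union>x\<in>C. R `` {f x})"

definition lift2 :: "('c \<times> 'c) set \<Rightarrow> ('a \<Rightarrow> 'b \<Rightarrow> 'c) \<Rightarrow> 'a set \<Rightarrow> 'b set \<Rightarrow> 'c set" where
  "lift2 R f C D = (\<Union>x\<in>C. \<Union>y\<in>D. R `` {f x y})"

definition rep_quot ::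
  "('k, 'a, 'b) rep_alg \<Rightarrow> ('a \<times> 'a) set \<Rightarrow> ('b \<times> 'b) set \<Rightarrow> ('k, 'a set, 'b set) rep_alg" where
  "rep_quot H R S = \<lparr>
     lcar = lcar H // R, lzero = R `` {lzero H}, lneg = lift1 R (lneg H),
     ladd = lift2 R (ladd H), lscale = (\<lambda>c. lift1 R (lscale H c)), lbr = lift2 R (lbr H),
     mcar = mcar H // S, mzero = S `` {mzero H}, mneg = lift1 S (mneg H),
     madd = lift2 S (madd H), mscale = (\<lambda>c. lift1 S (mscale H c)), act = lift2 S (act H) \<rparr>"

definition free_lcong :: "'x set \<Rightarrow> 'y set \<Rightarrow> (('k::field, 'x) lterm \<times> ('k, 'x) lterm) set" where
  "free_lcong X Y = \<Inter>{R. \<exists>S :: (('k, 'x, 'y) mterm \<times> ('k, 'x, 'y) mterm) set.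
     rep_cong (term_alg X Y) R S \<and> lie_rep (rep_quot (term_alg X Y) R S)}"

definition free_mcong ::
  "'x set \<Rightarrow> 'y set \<Rightarrow> (('k::field, 'x, 'y) mterm \<times> ('k, 'x, 'y) mterm) set" where
  "free_mcong X Y = \<Inter>{S. \<exists>R :: (('k, 'x) lterm \<times> ('k, 'x) lterm) set.
     rep_cong (term_alg X Y) R S \<and> lie_rep (rep_quot (term_alg X Y) R S)}"

type_synonym ('k, 'x, 'y) free_alg = "('k, ('k, 'x) lterm set, ('k, 'x, 'y) mterm set) rep_alg"

definition free_rep :: "'x set \<Rightarrow> 'y set \<Rightarrow> ('k::field, 'x, 'y) free_alg" where
  "free_rep X Y = rep_quot (term_alg X Y) (free_lcong X Y) (free_mcong X Y)"


section \<open>Categories and their automorphisms\<close>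

record ('o, 'm) category =
  Obj :: "'o set"
  Mor :: "'m set"
  Dom :: "'m \<Rightarrow> 'o"
  Cod :: "'m \<Rightarrow> 'o"
  Ident :: "'o \<Rightarrow> 'm"
  Cmp :: "'m \<Rightarrow> 'm \<Rightarrow> 'm"  \<comment> \<open>\<open>Cmp C g f\<close> is \<open>g\<close> after \<open>f\<close>\<close>

text \<open>
  An automorphism consists of the (bijective) object and morphism maps of a functor;
  \<^const>\<open>Bij\<close> makes both undefined outside \<^const>\<open>Obj\<close> and \<^const>\<open>Mor\<close>.
\<close>

definition cat_auts ::
  "('o, 'm) category \<Rightarrow> (('o \<Rightarrow> 'o) \<times> ('m \<Rightarrow> 'm)) set" where
  "cat_auts C = {(P, Q). P \<in> Bij (Obj C) \<and> Q \<in> Bij (Mor C) \<and>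
     (\<forall>f\<in>Mor C. Dom C (Q f) = P (Dom C f) \<and> Cod C (Q f) = P (Cod C f)) \<and>
     (\<forall>A\<in>Obj C. Q (Ident C A) = Ident C (P A)) \<and>
     (\<forall>f\<in>Mor C. \<forall>g\<in>Mor C. Cod C f = Dom C g \<longrightarrow> Q (Cmp C g f) = Cmp C (Q g) (Q f))}"

definition cat_aut_group ::
  "('o, 'm) category \<Rightarrow> (('o \<Rightarrow> 'o) \<times> ('m \<Rightarrow> 'm)) monoid" where
  "cat_aut_group C = (BijGroup (Obj C) \<times>\<times> BijGroup (Mor C)) \<lparr>carrier := cat_auts C\<rparr>"

definition iso_mor :: "('o, 'm) category \<Rightarrow> 'm \<Rightarrow> bool" where
  "iso_mor C f \<longleftrightarrow> f \<in> Mor C \<and> (\<exists>g\<in>Mor C. Dom C g = Cod C f \<and> Cod C g = Dom C f \<and>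
     Cmp C g f = Ident C (Dom C f) \<and> Cmp C f g = Ident C (Cod C f))"

definition inner_auts ::
  "('o, 'm) category \<Rightarrow> (('o \<Rightarrow> 'o) \<times> ('m \<Rightarrow> 'm)) set" where
  "inner_auts C = {(P, Q) \<in> cat_auts C. \<exists>s.
     (\<forall>A\<in>Obj C. iso_mor C (s A) \<and> Dom C (s A) = A \<and> Cod C (s A) = P A) \<and>
     (\<forall>f\<in>Mor C. Cmp C (Q f) (s (Dom C f)) = Cmp C (s (Cod C f)) f)}"


section \<open>The category of finitely generated free algebras and the automorphisms of a field\<close>

text \<open>
  Each morphism carries its source and target: \<open>(H, \<phi>, G)\<close> is the homomorphism \<open>\<phi>\<close> from \<open>H\<close> to \<open>G\<close>.
\<close>

type_synonym ('k, 'x, 'y) free_mor =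
  "('k, 'x, 'y) free_alg \<times>
   ((('k, 'x) lterm set \<Rightarrow> ('k, 'x) lterm set) \<times> (('k, 'x, 'y) mterm set \<Rightarrow> ('k, 'x, 'y) mterm set)) \<times>
   ('k, 'x, 'y) free_alg"

definition theta0 ::
  "'k::field itself \<Rightarrow> 'x set \<Rightarrow> 'y set \<Rightarrow> (('k, 'x, 'y) free_alg, ('k, 'x, 'y) free_mor) category"
  where
  "theta0 K X0 Y0 =
    (let Ob = {free_rep X Y | X Y. finite X \<and> X \<subseteq> X0 \<and> finite Y \<and> Y \<subseteq> Y0} in
     \<lparr> Obj = Ob,
       Mor = {(H, \<phi>, G). H \<in> Ob \<and> G \<in> Ob \<and> \<phi> \<in> rep_hom H G},
       Dom = (\<lambda>(H, \<phi>, G). H),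
       Cod = (\<lambda>(H, \<phi>, G). G),
       Ident = (\<lambda>H. (H, (\<lambda>x\<in>lcar H. x, \<lambda>v\<in>mcar H. v), H)),
       Cmp = (\<lambda>(_, (f', g'), G'). \<lambda>(H, (f, g), _).
         (H, (compose (lcar H) f' f, compose (mcar H) g' g), G')) \<rparr>)"

definition field_aut_group :: "('k::field \<Rightarrow> 'k) monoid" where
  "field_aut_group = (BijGroup UNIV) \<lparr>carrier := {\<sigma> \<in> Bij UNIV.
     (\<forall>a b. \<sigma> (a + b) = \<sigma> a + \<sigma> b) \<and> (\<forall>a b. \<sigma> (a * b) = \<sigma> a * \<sigma> b) \<and> \<sigma> 1 = 1}\<rparr>"

end

theory Submission
  imports Defs
begin

text \<open>
  Evaluation at a free generator identifies the two sorts of an algebra \<open>A\<close> with the sets of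
  morphisms to \<open>A\<close> from the free algebras with one generator of sort 1, respectively 2. These two
  objects are, up to isomorphism, the only ones whose endomorphism monoid is commutative and
  nontrivial, so an automorphism \<open>\<Upsilon>\<close> permutes them, and it cannot exchange them because the bracket
  of two free generators is a nonzero element that vanishes as soon as one of the generators is sent
  to zero, while no element of a free linear space on two generators behaves like this. Hence
  \<open>\<Upsilon>\<close> induces natural bijections \<open>s\<close> from \<open>A\<close> to \<open>\<Upsilon> A\<close> in both sorts, and
  these carry every operation to one given by an element of a free algebra. In characteristic zero
  multiplication by 2 separates degrees, which forces addition to be carried to addition, the
      bracket
  and the action to multiples of themselves by one and the same scalar, and scalar multiplication to
  scalar multiplication twisted by a field automorphism \<open>\<sigma>\<close>. Rescaling \<open>s\<close> on the Lie sort
  turns it into a \<open>\<sigma>\<close>-semilinear isomorphism. The map \<open>\<Upsilon> \<mapsto> \<sigma>\<close> is a homomorphism whose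
  kernel consists of the inner automorphisms, and it is surjective since \<open>\<sigma>\<close> acts on the
      coefficients
  of the free algebras.
\<close>

section \<open>Homomorphisms\<close>

text \<open>An automorphism gives no direct access to elements: \<open>P\<close> may move every
  object, and the image of a free algebra is known only through its morphisms. The way around is to
  take, for a free algebra C, an object D with \<open>P D = C\<close>. Elements of D that
  \<open>s\<close> sends to the generators of C turn an operation on D into a single element w of C,
  and w describes the transported operation everywhere. It remains to find w. Scaling by 2 serves
  for this because it is carried to scaling by 2 once addition is preserved, and before that a
  scalar e with \<sigma> e = 2 does the same work. Its eigenvalue in degree d is 2 ^ d, which in
  characteristic 0 equals 2 only for d = 1. The bracket and the action come out only up to scalars
  \<alpha> and \<beta>: multiplying \<open>s\<close> by c on the Lie sort divides both by c, and
  multiplying it on the module sort changes neither. One rescaling can therefore repair both only if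
  \<alpha> = \<beta>, and this is forced by the identity that links bracket and action.\<close>

definition rep_closed :: "('k, 'a, 'b) rep_alg \<Rightarrow> bool" where
  "rep_closed H \<longleftrightarrow>
     lzero H \<in> lcar H \<and> (\<forall>x\<in>lcar H. lneg H x \<in> lcar H) \<and>
     (\<forall>x\<in>lcar H. \<forall>y\<in>lcar H. ladd H x y \<in> lcar H) \<and> (\<forall>c. \<forall>x\<in>lcar H. lscale H c x \<in> lcar H) \<and>
     (\<forall>x\<in>lcar H. \<forall>y\<in>lcar H. lbr H x y \<in> lcar H) \<and>
     mzero H \<in> mcar H \<and> (\<forall>v\<in>mcar H. mneg H v \<in> mcar H) \<and>
     (\<forall>v\<in>mcar H. \<forall>w\<in>mcar H. madd H v w \<in> mcar H) \<and> (\<forall>c. \<forall>v\<in>mcar H. mscale H c v \<in> mcar H) \<and>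
     (\<forall>x\<in>lcar H. \<forall>v\<in>mcar H. act H x v \<in> mcar H)"

context lie_rep
begin

lemma closed: "rep_closed H"
  by (simp add: rep_closed_def lie.zero_closed lie.neg_closed lie.add_closed lie.scale_closed
      lie.br_closed md.zero_closed md.neg_closed md.add_closed md.scale_closed act_closed)

text \<open>The axioms that are equations. Closure is kept apart in \<open>rep_closed\<close>
  because the term algebra has closure without the equations.\<close>

lemmas identities = lie.add_assoc lie.add_commute lie.add_zero lie.add_neg lie.scale_add
    lie.add_scale
  lie.scale_scale lie.scale_one lie.br_add_left lie.br_add_right lie.br_scale_left
      lie.br_scale_right
  lie.br_self lie.jacobi md.add_assoc md.add_commute md.add_zero md.add_neg md.scale_add
      md.add_scale
  md.scale_scale md.scale_one act_add_left act_add_right act_scale_left act_scale_right act_br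

end

lemma
  assumes "\<phi> \<in> rep_hom H G"
  shows hom_lclosed: "x \<in> lcar H \<Longrightarrow> fst \<phi> x \<in> lcar G"
    and hom_lzero: "fst \<phi> (lzero H) = lzero G"
    and hom_lneg: "x \<in> lcar H \<Longrightarrow> fst \<phi> (lneg H x) = lneg G (fst \<phi> x)"
    and hom_ladd: "x \<in> lcar H \<Longrightarrow> y \<in> lcar H \<Longrightarrow> fst \<phi> (ladd H x y) = ladd G (fst \<phi> x) (fst \<phi> y)"
    and hom_lscale: "x \<in> lcar H \<Longrightarrow> fst \<phi> (lscale H c x) = lscale G c (fst \<phi> x)"
    and hom_lbr: "x \<in> lcar H \<Longrightarrow> y \<in> lcar H \<Longrightarrow> fst \<phi> (lbr H x y) = lbr G (fst \<phi> x) (fst \<phi> y)"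
    and hom_mclosed: "v \<in> mcar H \<Longrightarrow> snd \<phi> v \<in> mcar G"
    and hom_mzero: "snd \<phi> (mzero H) = mzero G"
    and hom_mneg: "v \<in> mcar H \<Longrightarrow> snd \<phi> (mneg H v) = mneg G (snd \<phi> v)"
    and hom_madd: "v \<in> mcar H \<Longrightarrow> w \<in> mcar H \<Longrightarrow> snd \<phi> (madd H v w) = madd G (snd \<phi> v) (snd \<phi> w)"
    and hom_mscale: "v \<in> mcar H \<Longrightarrow> snd \<phi> (mscale H c v) = mscale G c (snd \<phi> v)"
    and hom_act: "x \<in> lcar H \<Longrightarrow> v \<in> mcar H \<Longrightarrow> snd \<phi> (act H x v) = act G (fst \<phi> x) (snd \<phi> v)"
    and hom_ext: "fst \<phi> \<in> extensional (lcar H)" "snd \<phi> \<in> extensional (mcar H)"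
  using assms by (auto simp: rep_hom_def PiE_def)

lemmas hom_simps = hom_lclosed hom_lzero hom_lneg hom_ladd hom_lscale hom_lbr
  hom_mclosed hom_mzero hom_mneg hom_madd hom_mscale hom_act

lemma hom_eqI:
  assumes "\<phi> \<in> rep_hom H G" "\<psi> \<in> rep_hom H G'"
    and "\<And>x. x \<in> lcar H \<Longrightarrow> fst \<phi> x = fst \<psi> x" "\<And>v. v \<in> mcar H \<Longrightarrow> snd \<phi> v = snd \<psi> v"
  shows "\<phi> = \<psi>"
  using assms hom_ext[OF assms(1)] hom_ext[OF assms(2)]
  by (intro prod_eqI extensionalityI[where A="lcar H"] extensionalityI[where A="mcar H"]) auto

text \<open>An algebra whose points are separated by homomorphisms into members of the variety lies in the
  variety, since every axiom is an identity.\<close>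

lemma lie_rep_separated:
  fixes G :: "('k::field, 'a, 'b) rep_alg"
  assumes cl: "rep_closed G"
    and sl: "\<And>x y. x \<in> lcar G \<Longrightarrow> y \<in> lcar G \<Longrightarrow>
      (\<And>(H :: ('k, 'c, 'd) rep_alg) f g. lie_rep H \<Longrightarrow> (f, g) \<in> rep_hom G H \<Longrightarrow> f x = f y) \<Longrightarrow> x = y"
    and sm: "\<And>v w. v \<in> mcar G \<Longrightarrow> w \<in> mcar G \<Longrightarrow>
      (\<And>(H :: ('k, 'c, 'd) rep_alg) f g. lie_rep H \<Longrightarrow> (f, g) \<in> rep_hom G H \<Longrightarrow> g v = g w) \<Longrightarrow> v = w"
  shows "lie_rep G"
proof -
  note cl' = cl[unfolded rep_closed_def]
  show ?thesis
    by (unfold_locales; insert cl'; (simp; fail | (rule sl sm; (simp; fail | (simp add: rep_hom_def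
        PiE_iff lie_rep.identities; fail)))))
qed

section \<open>Quotients\<close>

lemma lift1_class:
  assumes "equiv A R" "equiv B S" "x \<in> A" "\<forall>(x, x') \<in> R. (f x, f x') \<in> S"
  shows "lift1 S f (R `` {x}) = S `` {f x}"
  unfolding lift1_def
  by (rule UN_equiv_class[OF assms(1) _ assms(3)])
    (use assms(2,4) in \<open>auto simp: congruent_def dest: equiv_class_eq\<close>)

lemma lift2_class:
  assumes "equiv A R" "equiv A' R'" "equiv B S" "x \<in> A" "y \<in> A'"
    "\<forall>(x, x') \<in> R. \<forall>(y, y') \<in> R'. (f x y, f x' y') \<in> S"
  shows "lift2 S f (R `` {x}) (R' `` {y}) = S `` {f x y}"
proof -
  have "congruent2 R R' (\<lambda>x y. S `` {f x y})"
    using assms(3,6) by (fastforce simp: congruent2_def dest: equiv_class_eq)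
  then show ?thesis
    unfolding lift2_def by (rule UN_equiv_class2[OF assms(1,2)]) (fact assms(4,5))+
qed

lemma rep_cong_equiv:
  "rep_cong T R S \<Longrightarrow> equiv (lcar T) R" "rep_cong T R S \<Longrightarrow> equiv (mcar T) S"
  by (simp_all add: rep_cong_def)

lemma rep_congD:
  assumes "rep_cong T R S"
  shows "(x, x') \<in> R \<Longrightarrow> (lneg T x, lneg T x') \<in> R"
    and "(x, x') \<in> R \<Longrightarrow> (y, y') \<in> R \<Longrightarrow> (ladd T x y, ladd T x' y') \<in> R"
    and "(x, x') \<in> R \<Longrightarrow> (lscale T c x, lscale T c x') \<in> R"
    and "(x, x') \<in> R \<Longrightarrow> (y, y') \<in> R \<Longrightarrow> (lbr T x y, lbr T x' y') \<in> R"
    and "(v, v') \<in> S \<Longrightarrow> (mneg T v, mneg T v') \<in> S"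
    and "(v, v') \<in> S \<Longrightarrow> (w, w') \<in> S \<Longrightarrow> (madd T v w, madd T v' w') \<in> S"
    and "(v, v') \<in> S \<Longrightarrow> (mscale T c v, mscale T c v') \<in> S"
    and "(x, x') \<in> R \<Longrightarrow> (v, v') \<in> S \<Longrightarrow> (act T x v, act T x' v') \<in> S"
  by (use assms[unfolded rep_cong_def] in \<open>auto; fail\<close>)+

lemma
  assumes "rep_cong T R S"
  shows quot_lneg: "x \<in> lcar T \<Longrightarrow> lneg (rep_quot T R S) (R `` {x}) = R `` {lneg T x}"
    and quot_ladd: "x \<in> lcar T \<Longrightarrow> y \<in> lcar T \<Longrightarrow>
      ladd (rep_quot T R S) (R `` {x}) (R `` {y}) = R `` {ladd T x y}"
    and quot_lscale: "x \<in> lcar T \<Longrightarrow> lscale (rep_quot T R S) c (R `` {x}) = R `` {lscale T c x}"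
    and quot_lbr: "x \<in> lcar T \<Longrightarrow> y \<in> lcar T \<Longrightarrow>
      lbr (rep_quot T R S) (R `` {x}) (R `` {y}) = R `` {lbr T x y}"
    and quot_mneg: "v \<in> mcar T \<Longrightarrow> mneg (rep_quot T R S) (S `` {v}) = S `` {mneg T v}"
    and quot_madd: "v \<in> mcar T \<Longrightarrow> w \<in> mcar T \<Longrightarrow>
      madd (rep_quot T R S) (S `` {v}) (S `` {w}) = S `` {madd T v w}"
    and quot_mscale: "v \<in> mcar T \<Longrightarrow> mscale (rep_quot T R S) c (S `` {v}) = S `` {mscale T c v}"
    and quot_act: "x \<in> lcar T \<Longrightarrow> v \<in> mcar T \<Longrightarrow>
      act (rep_quot T R S) (R `` {x}) (S `` {v}) = S `` {act T x v}"
  using assms[unfolded rep_cong_def] rep_cong_equiv[OF assms]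
  by (simp_all add: rep_quot_def lift1_class lift2_class)

lemma quot_zero: "lzero (rep_quot T R S) = R `` {lzero T}" "mzero (rep_quot T R S) = S `` {mzero T}"
  by (simp_all add: rep_quot_def)

lemma quot_lcar: "lcar (rep_quot T R S) = (\<lambda>x. R `` {x}) ` lcar T"
  and quot_mcar: "mcar (rep_quot T R S) = (\<lambda>v. S `` {v}) ` mcar T"
  by (auto simp: rep_quot_def quotient_def)

lemmas quot_simps = quot_lneg quot_ladd quot_lscale quot_lbr quot_mneg quot_madd quot_mscale
    quot_act
lemmas quot_base = quot_zero quot_lcar quot_mcar

lemma quot_closed:
  assumes "rep_closed T" "rep_cong T R S"
  shows "rep_closed (rep_quot T R S)"
  using assms(1) unfolding rep_closed_def by (auto simp: quot_simps[OF assms(2)] quot_base)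

lemma quot_eq_iff:
  assumes "rep_cong T R S"
  shows "x \<in> lcar T \<Longrightarrow> y \<in> lcar T \<Longrightarrow> R `` {x} = R `` {y} \<longleftrightarrow> (x, y) \<in> R"
    and "v \<in> mcar T \<Longrightarrow> w \<in> mcar T \<Longrightarrow> S `` {v} = S `` {w} \<longleftrightarrow> (v, w) \<in> S"
  by (simp_all add: eq_equiv_class_iff[OF rep_cong_equiv(1)[OF assms]] eq_equiv_class_iff[OF
      rep_cong_equiv(2)[OF assms]])

lemma quot_proj_hom:
  assumes "rep_closed T" "rep_cong T R S"
  shows "(\<lambda>x\<in>lcar T. R `` {x}, \<lambda>v\<in>mcar T. S `` {v}) \<in> rep_hom T (rep_quot T R S)"
  using assms(1) by (auto simp: rep_hom_def quot_simps[OF assms(2)] quot_base rep_closed_def)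

lemma quot_factor:
  assumes T: "rep_closed T" and RS: "rep_cong T R S" and \<phi>: "\<phi> \<in> rep_hom T H"
    and kl: "\<And>x y. (x, y) \<in> R \<Longrightarrow> fst \<phi> x = fst \<phi> y"
    and km: "\<And>v w. (v, w) \<in> S \<Longrightarrow> snd \<phi> v = snd \<phi> w"
  obtains \<psi> where "\<psi> \<in> rep_hom (rep_quot T R S) H" "\<And>x. x \<in> lcar T \<Longrightarrow> fst \<psi> (R `` {x}) = fst \<phi> x"
    "\<And>v. v \<in> mcar T \<Longrightarrow> snd \<psi> (S `` {v}) = snd \<phi> v"
proof -
  let ?Q = "rep_quot T R S"
  \<comment> \<open>A class is evaluated at a chosen representative; \<open>kl\<close> and
    \<open>km\<close> make the choice immaterial.\<close>
  define f where "f = (\<lambda>C\<in>lcar ?Q. fst \<phi> (SOME t. t \<in> C))"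
  define g where "g = (\<lambda>C\<in>mcar ?Q. snd \<phi> (SOME t. t \<in> C))"
  have l: "(x, SOME t. t \<in> R `` {x}) \<in> R" if "x \<in> lcar T" for x
    using RS that someI[of "\<lambda>t. t \<in> R `` {x}" x] unfolding rep_cong_def
    by (auto dest: equiv_class_self)
  have f: "f (R `` {x}) = fst \<phi> x" if "x \<in> lcar T" for x
    using kl[OF l[OF that], symmetric] that by (simp add: f_def quot_lcar)
  have m: "(v, SOME t. t \<in> S `` {v}) \<in> S" if "v \<in> mcar T" for v
    using RS that someI[of "\<lambda>t. t \<in> S `` {v}" v] unfolding rep_cong_def
    by (auto dest: equiv_class_self)
  have g: "g (S `` {v}) = snd \<phi> v" if "v \<in> mcar T" for v
    using km[OF m[OF that], symmetric] that by (simp add: g_def quot_mcar)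
  have "f \<in> lcar ?Q \<rightarrow>\<^sub>E lcar H" "g \<in> mcar ?Q \<rightarrow>\<^sub>E mcar H"
    using f g hom_simps[OF \<phi>] by (auto simp: PiE_iff quot_lcar quot_mcar) (auto simp: f_def g_def
        quot_lcar quot_mcar)
  then have "(f, g) \<in> rep_hom ?Q H"
    using T unfolding rep_hom_def rep_closed_def
    by (auto simp: quot_simps[OF RS] quot_base hom_simps[OF \<phi>] f g)
  then show ?thesis
    using that[of "(f, g)"] f g by simp
qed

section \<open>Free algebras\<close>

text \<open>The quotient by the kernel embeds into \<open>H\<close>, so the single homomorphism
  induced by \<phi> already separates its points and \<open>lie_rep_separated\<close> applies. In
  this way kernels of evaluations enter the family that is intersected in \<open>free_lcong\<close>
  and \<open>free_mcong\<close>.\<close>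

lemma ker_cong:
  fixes H :: "('k::field, 'c, 'd) rep_alg"
  assumes T: "rep_closed T" and \<phi>: "\<phi> \<in> rep_hom T H" and H: "lie_rep H"
  defines "R \<equiv> {(x, y). x \<in> lcar T \<and> y \<in> lcar T \<and> fst \<phi> x = fst \<phi> y}"
    and "S \<equiv> {(x, y). x \<in> mcar T \<and> y \<in> mcar T \<and> snd \<phi> x = snd \<phi> y}"
  shows "rep_cong T R S" "lie_rep (rep_quot T R S)"
proof -
  have "equiv (lcar T) R" "equiv (mcar T) S"
    by (auto simp: R_def S_def equiv_def refl_on_def sym_def trans_def)
  then show c: "rep_cong T R S"
    using T unfolding rep_cong_def
    by (auto simp: R_def S_def rep_closed_def hom_simps[OF \<phi>])
  obtain \<psi> where \<psi>: "\<psi> \<in> rep_hom (rep_quot T R S) H"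
      "\<And>x. x \<in> lcar T \<Longrightarrow> fst \<psi> (R `` {x}) = fst \<phi> x" "\<And>v. v \<in> mcar T \<Longrightarrow> snd \<psi> (S `` {v}) = snd \<phi> v"
    by (rule quot_factor[OF T c \<phi>]) (auto simp: R_def S_def)
  show "lie_rep (rep_quot T R S)"
  proof (rule lie_rep_separated)
    show "rep_closed (rep_quot T R S)"
      by (rule quot_closed[OF T c])
    fix x y assume *: "x \<in> lcar (rep_quot T R S)" "y \<in> lcar (rep_quot T R S)"
      "\<And>(H :: ('k, 'c, 'd) rep_alg) f g. lie_rep H \<Longrightarrow> (f, g) \<in> rep_hom (rep_quot T R S) H \<Longrightarrow> f x = f
          y"
    then have "fst \<psi> x = fst \<psi> y"
      using \<psi>(1) H by (metis prod.collapse)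
    with * obtain s t where "x = R `` {s}" "y = R `` {t}" "s \<in> lcar T" "t \<in> lcar T" "fst \<phi> s = fst \<phi>
        t"
      by (auto simp: quot_lcar \<psi>)
    then show "x = y"
      by (simp add: quot_eq_iff(1)[OF c]) (simp add: R_def)
  next
    fix x y assume *: "x \<in> mcar (rep_quot T R S)" "y \<in> mcar (rep_quot T R S)"
      "\<And>(H :: ('k, 'c, 'd) rep_alg) f g. lie_rep H \<Longrightarrow> (f, g) \<in> rep_hom (rep_quot T R S) H \<Longrightarrow> g x = g
          y"
    then have "snd \<psi> x = snd \<psi> y"
      using \<psi>(1) H by (metis prod.collapse)
    with * obtain s t where "x = S `` {s}" "y = S `` {t}" "s \<in> mcar T" "t \<in> mcar T" "snd \<phi> s = snd \<phi>
        t"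
      by (auto simp: quot_mcar \<psi>)
    then show "x = y"
      by (simp add: quot_eq_iff(2)[OF c]) (simp add: S_def)
  qed
qed

section \<open>Evaluation of terms and the least admissible congruence\<close>

primrec leval :: "('k, 'a, 'b) rep_alg \<Rightarrow> ('x \<Rightarrow> 'a) \<Rightarrow> ('k, 'x) lterm \<Rightarrow> 'a" where
  "leval H a (LVar x) = a x"
| "leval H a LZero = lzero H"
| "leval H a (LNeg s) = lneg H (leval H a s)"
| "leval H a (LAdd s t) = ladd H (leval H a s) (leval H a t)"
| "leval H a (LScale c s) = lscale H c (leval H a s)"
| "leval H a (LBr s t) = lbr H (leval H a s) (leval H a t)"

primrec meval ::
  "('k, 'a, 'b) rep_alg \<Rightarrow> ('x \<Rightarrow> 'a) \<Rightarrow> ('y \<Rightarrow> 'b) \<Rightarrow> ('k, 'x, 'y) mterm \<Rightarrow> 'b" where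
  "meval H a b (MVar y) = b y"
| "meval H a b MZero = mzero H"
| "meval H a b (MNeg s) = mneg H (meval H a b s)"
| "meval H a b (MAdd s t) = madd H (meval H a b s) (meval H a b t)"
| "meval H a b (MScale c s) = mscale H c (meval H a b s)"
| "meval H a b (MAct l t) = act H (leval H a l) (meval H a b t)"

lemma term_alg_closed: "rep_closed (term_alg X Y)"
  by (auto simp: rep_closed_def term_alg_def)

lemma eval_hom:
  assumes "rep_closed H" "a \<in> X \<rightarrow> lcar H" "b \<in> Y \<rightarrow> mcar H"
  shows "(\<lambda>t\<in>lcar (term_alg X Y). leval H a t, \<lambda>t\<in>mcar (term_alg X Y). meval H a b t)
    \<in> rep_hom (term_alg X Y) H"
proof -
  have l: "leval H a t \<in> lcar H" if "lvars t \<subseteq> X" for t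
    using that assms unfolding rep_closed_def by (induction t) auto
  have "meval H a b t \<in> mcar H" if "mlvars t \<subseteq> X" "mvars t \<subseteq> Y" for t
    using that assms unfolding rep_closed_def by (induction t) (auto intro: l)
  with l show ?thesis
    by (auto simp: rep_hom_def term_alg_def)
qed

abbreviation good_cong where
  "good_cong X Y R S \<equiv> rep_cong (term_alg X Y) R S \<and> lie_rep (rep_quot (term_alg X Y) R S)"

text \<open>The kernel of the map to the one-point algebra is a member. An empty family would have
  the full relation as its intersection, which also relates terms with variables outside
  \<open>X\<close> and \<open>Y\<close>.\<close>

lemma ex_good_cong:
  "\<exists>(R :: (('k::field, 'x) lterm \<times> ('k, 'x) lterm) set)
     (S :: (('k, 'x, 'y) mterm \<times> ('k, 'x, 'y) mterm) set). good_cong X Y R S"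
proof -
  let ?U = "\<lparr> lcar = UNIV, lzero = (), lneg = (\<lambda>_. ()), ladd = (\<lambda>_ _. ()), lscale = (\<lambda>_ _. ()),
    lbr = (\<lambda>_ _. ()), mcar = UNIV, mzero = (), mneg = (\<lambda>_. ()), madd = (\<lambda>_ _. ()),
    mscale = (\<lambda>_ _. ()), act = (\<lambda>_ _. ()) \<rparr> :: ('k, unit, unit) rep_alg"
  have U: "lie_rep ?U"
    by unfold_locales auto
  have e: "(\<lambda>t\<in>lcar (term_alg X Y). leval ?U (\<lambda>_. ()) t, \<lambda>t\<in>mcar (term_alg X Y). meval ?U (\<lambda>_. ())
      (\<lambda>_. ()) t)
      \<in> rep_hom (term_alg X Y) ?U"
    by (rule eval_hom[OF lie_rep.closed[OF U]]) simp_all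
  show ?thesis
    by (rule exI, rule exI, rule conjI) (rule ker_cong[OF term_alg_closed e U])+
qed

lemma
  shows free_lcong_iff: "(s, t) \<in> free_lcong X Y \<longleftrightarrow> (\<forall>R S. good_cong X Y R S \<longrightarrow> (s, t) \<in> R)"
    and free_mcong_iff: "(v, w) \<in> free_mcong X Y \<longleftrightarrow> (\<forall>R S. good_cong X Y R S \<longrightarrow> (v, w) \<in> S)"
  unfolding free_lcong_def free_mcong_def by auto

lemma equiv_Inter:
  assumes "\<R> \<noteq> {}" "\<And>R. R \<in> \<R> \<Longrightarrow> equiv A R"
  shows "equiv A (\<Inter>\<R>)"
proof (rule equivI)
  show "\<Inter>\<R> \<subseteq> A \<times> A"
    using assms equiv_type by blast
  show "refl_on A (\<Inter>\<R>)" "sym (\<Inter>\<R>)" "trans (\<Inter>\<R>)"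
    using assms(2) unfolding equiv_def refl_on_def sym_def trans_def by blast+
qed

lemma rep_cong_free:
  "rep_cong (term_alg X Y) (free_lcong X Y :: (('k::field, 'x) lterm \<times> ('k, 'x) lterm) set)
     (free_mcong X Y :: (('k, 'x, 'y) mterm \<times> ('k, 'x, 'y) mterm) set)"
proof -
  obtain R0 :: "(('k, 'x) lterm \<times> ('k, 'x) lterm) set"
    and S0 :: "(('k, 'x, 'y) mterm \<times> ('k, 'x, 'y) mterm) set" where 0: "good_cong X Y R0 S0"
    using ex_good_cong by blast
  have "equiv (lcar (term_alg X Y)) (free_lcong X Y :: (('k, 'x) lterm \<times> ('k, 'x) lterm) set)"
    unfolding free_lcong_def by (rule equiv_Inter) (use 0 in \<open>auto dest: rep_cong_equiv(1)\<close>)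
  moreover have "equiv (mcar (term_alg X Y)) (free_mcong X Y :: (('k, 'x, 'y) mterm \<times> ('k, 'x, 'y)
      mterm) set)"
    unfolding free_mcong_def by (rule equiv_Inter) (use 0 in \<open>auto dest: rep_cong_equiv(2)\<close>)
  ultimately show ?thesis
    unfolding rep_cong_def
    by (auto simp: free_lcong_iff[of _ _ X Y] free_mcong_iff[of _ _ X Y]) ((rule rep_congD; blast) |
        (rule rep_congD(8), assumption, blast, blast))+
qed

text \<open>A subdirect product argument: two classes with equal images in all admissible quotients
  are related by every congruence of the family, hence by their intersection.\<close>

lemma lie_rep_free: "lie_rep (free_rep X Y :: ('k::field, 'x, 'y) free_alg)"
  unfolding free_rep_def
proof (rule lie_rep_separated)
  let ?T = "term_alg X Y :: ('k, ('k, 'x) lterm, ('k, 'x, 'y) mterm) rep_alg"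
  let ?R = "free_lcong X Y :: (('k, 'x) lterm \<times> ('k, 'x) lterm) set"
  let ?S = "free_mcong X Y :: (('k, 'x, 'y) mterm \<times> ('k, 'x, 'y) mterm) set"
  let ?F = "rep_quot ?T ?R ?S"
  show "rep_closed ?F"
    by (intro quot_closed term_alg_closed rep_cong_free)
  \<comment> \<open>Each admissible congruence contains the least one, so its projection factors
    through the free algebra.\<close>
  have hom: "\<exists>f g. (f, g) \<in> rep_hom ?F (rep_quot ?T R S) \<and> (\<forall>t\<in>lcar ?T. f (?R `` {t}) = R `` {t})
      \<and> (\<forall>t\<in>mcar ?T. g (?S `` {t}) = S `` {t})" if g: "good_cong X Y R S" for R S
  proof -
    note eq = quot_eq_iff[OF conjunct1[OF g]]
    have *: "s \<in> lcar ?T \<and> t \<in> lcar ?T \<and> (s, t) \<in> R" if "(s, t) \<in> ?R" for s t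
      using that g equiv_type[OF rep_cong_equiv(1)[OF rep_cong_free]]
        free_lcong_iff[THEN iffD1] by blast
    have **: "s \<in> mcar ?T \<and> t \<in> mcar ?T \<and> (s, t) \<in> S" if "(s, t) \<in> ?S" for s t
      using that g equiv_type[OF rep_cong_equiv(2)[OF rep_cong_free]]
        free_mcong_iff[THEN iffD1] by blast
    obtain \<psi> where "\<psi> \<in> rep_hom ?F (rep_quot ?T R S)" "\<And>x. x \<in> lcar ?T \<Longrightarrow> fst \<psi> (?R `` {x}) = R ``
        {x}"
      "\<And>x. x \<in> mcar ?T \<Longrightarrow> snd \<psi> (?S `` {x}) = S `` {x}"
      by (rule quot_factor[OF term_alg_closed rep_cong_free quot_proj_hom[OF term_alg_closed
          conjunct1[OF g]]])
        (use * ** in \<open>simp_all add: eq\<close>)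
    then show ?thesis
      by (metis prod.collapse)
  qed
  {
    fix x y assume x: "x \<in> lcar ?F" "y \<in> lcar ?F"
      and *: "\<And>(H :: ('k, ('k, 'x) lterm set, ('k, 'x, 'y) mterm set) rep_alg) f g.
        lie_rep H \<Longrightarrow> (f, g) \<in> rep_hom ?F H \<Longrightarrow> f x = f y"
    then obtain s t where st: "s \<in> lcar ?T" "t \<in> lcar ?T" "x = ?R `` {s}" "y = ?R `` {t}"
      by (auto simp: quot_lcar)
    have "(s, t) \<in> R" if "good_cong X Y R S" for R S
      using hom[OF that] *[OF conjunct2[OF that]] st quot_eq_iff(1)[OF conjunct1[OF that]] by metis
    then show "x = y"
      unfolding st(3,4) by (subst quot_eq_iff(1)[OF rep_cong_free[of X Y]]) (use st in \<open>simp_all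
          add: free_lcong_iff\<close>)
  next
    fix x y assume x: "x \<in> mcar ?F" "y \<in> mcar ?F"
      and *: "\<And>(H :: ('k, ('k, 'x) lterm set, ('k, 'x, 'y) mterm set) rep_alg) f g.
        lie_rep H \<Longrightarrow> (f, g) \<in> rep_hom ?F H \<Longrightarrow> g x = g y"
    then obtain s t where st: "s \<in> mcar ?T" "t \<in> mcar ?T" "x = ?S `` {s}" "y = ?S `` {t}"
      by (auto simp: quot_mcar)
    have "(s, t) \<in> S" if "good_cong X Y R S" for R S
      using hom[OF that] *[OF conjunct2[OF that]] st quot_eq_iff(2)[OF conjunct1[OF that]] by metis
    then show "x = y"
      unfolding st(3,4) by (subst quot_eq_iff(2)[OF rep_cong_free[of X Y]]) (use st in \<open>simp_all
          add: free_mcong_iff\<close>)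
  }
qed

section \<open>Free generators and the universal property\<close>

definition lgen :: "'x set \<Rightarrow> 'y set \<Rightarrow> 'x \<Rightarrow> ('k::field, 'x) lterm set" where
  "lgen X Y x = free_lcong X Y `` {LVar x}"

definition mgen :: "'x set \<Rightarrow> 'y set \<Rightarrow> 'y \<Rightarrow> ('k::field, 'x, 'y) mterm set" where
  "mgen X Y y = free_mcong X Y `` {MVar y}"

lemma lgen_closed: "x \<in> X \<Longrightarrow> lgen X Y x \<in> lcar (free_rep X Y)"
  and mgen_closed: "y \<in> Y \<Longrightarrow> mgen X Y y \<in> mcar (free_rep X Y)"
  by (auto simp: lgen_def mgen_def free_rep_def quot_lcar quot_mcar term_alg_def)

text \<open>Evaluation at \<open>a\<close> and \<open>b\<close> has an admissible kernel, which
  contains the least congruence. The element types of \<open>H\<close> are arbitrary, although the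
  definition of the free algebra mentions only quotients of its own term algebra.\<close>

lemma free_rep_hom:
  fixes X :: "'x set" and Y :: "'y set" and H :: "('k::field, 'a, 'b) rep_alg"
  assumes H: "lie_rep H" and ab: "\<And>x. x \<in> X \<Longrightarrow> a x \<in> lcar H" "\<And>y. y \<in> Y \<Longrightarrow> b y \<in> mcar H"
  obtains \<phi> where "\<phi> \<in> rep_hom (free_rep X Y) H" "\<And>x. x \<in> X \<Longrightarrow> fst \<phi> (lgen X Y x) = a x"
    "\<And>y. y \<in> Y \<Longrightarrow> snd \<phi> (mgen X Y y) = b y"
proof -
  let ?T = "term_alg X Y :: ('k, ('k, 'x) lterm, ('k, 'x, 'y) mterm) rep_alg"
  have e: "(\<lambda>t\<in>lcar ?T. leval H a t, \<lambda>t\<in>mcar ?T. meval H a b t) \<in> rep_hom ?T H" (is "?\<phi> \<in> _")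
    using ab by (intro eval_hom lie_rep.closed H) auto
  note ker = ker_cong[OF term_alg_closed e H]
  obtain \<psi> where "\<psi> \<in> rep_hom (rep_quot ?T (free_lcong X Y) (free_mcong X Y)) H"
    "\<And>x. x \<in> lcar ?T \<Longrightarrow> fst \<psi> (free_lcong X Y `` {x}) = fst ?\<phi> x"
    "\<And>x. x \<in> mcar ?T \<Longrightarrow> snd \<psi> (free_mcong X Y `` {x}) = snd ?\<phi> x"
    by (rule quot_factor[OF term_alg_closed rep_cong_free e])
      (simp_all only: free_lcong_iff[THEN iffD1, rule_format, OF _ conjI[OF ker], simplified
          mem_Collect_eq prod.case]
        free_mcong_iff[THEN iffD1, rule_format, OF _ conjI[OF ker], simplified mem_Collect_eq
            prod.case])
  with that[of \<psi>] show ?thesis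
    by (simp add: free_rep_def lgen_def mgen_def term_alg_def)
qed

text \<open>With this rule and \<open>free_rep_minduct\<close> the classes of terms are not opened
  again: later arguments rest on the universal property and these inductions.\<close>

lemma free_rep_linduct [consumes 1, case_names gen zero neg add scale br]:
  fixes X :: "'x set" and Y :: "'y set" and t :: "('k::field, 'x) lterm set"
  assumes "t \<in> lcar (free_rep X Y)"
    and gen: "\<And>x. x \<in> X \<Longrightarrow> P (lgen X Y x)" and zero: "P (lzero (free_rep X Y))"
    and neg: "\<And>s. s \<in> lcar (free_rep X Y) \<Longrightarrow> P s \<Longrightarrow> P (lneg (free_rep X Y) s)"
    and add: "\<And>s t. s \<in> lcar (free_rep X Y) \<Longrightarrow> P s \<Longrightarrow> t \<in> lcar (free_rep X Y) \<Longrightarrow> P t \<Longrightarrow> P (ladd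
        (free_rep X Y) s t)"
    and scale: "\<And>c s. s \<in> lcar (free_rep X Y) \<Longrightarrow> P s \<Longrightarrow> P (lscale (free_rep X Y) c s)"
    and br: "\<And>s t. s \<in> lcar (free_rep X Y) \<Longrightarrow> P s \<Longrightarrow> t \<in> lcar (free_rep X Y) \<Longrightarrow> P t \<Longrightarrow> P (lbr (free_rep
        X Y) s t)"
  shows "P t"
proof -
  let ?F = "free_rep X Y :: ('k, 'x, 'y) free_alg"
  let ?c = "\<lambda>t :: ('k, 'x) lterm. free_lcong X Y `` {t}"
  have *: "lvars s \<subseteq> X \<Longrightarrow> ?c s \<in> lcar ?F" for s
    by (auto simp: free_rep_def quot_lcar term_alg_def)
  note q = quot_simps[OF rep_cong_free[of X Y], folded free_rep_def, unfolded term_alg_def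
      rep_alg.simps, simplified]
    quot_zero[of "term_alg X Y" "free_lcong X Y" "free_mcong X Y", folded free_rep_def, unfolded
        term_alg_def rep_alg.simps]
  have "lvars s \<subseteq> X \<Longrightarrow> P (?c s)" for s
  proof (induction s)
    case (LVar x) then show ?case using gen[of x] by (simp add: lgen_def)
  next
    case LZero then show ?case using zero by (simp add: q)
  next
    case (LNeg s) then show ?case using neg[of "?c s"] * by (simp add: q)
  next
    case (LAdd s t) then show ?case using add[of "?c s" "?c t"] * by (simp add: q)
  next
    case (LScale c s) then show ?case using scale[of "?c s" c] * by (simp add: q)
  next
    case (LBr s t) then show ?case using br[of "?c s" "?c t"] * by (simp add: q)
  qed
  then show ?thesis
    using assms(1) by (auto simp: free_rep_def quot_lcar term_alg_def)
qed

lemma free_rep_minduct [consumes 1, case_names gen zero neg add scale act]: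
  fixes X :: "'x set" and Y :: "'y set" and t :: "('k::field, 'x, 'y) mterm set"
  assumes "t \<in> mcar (free_rep X Y)"
    and gen: "\<And>y. y \<in> Y \<Longrightarrow> P (mgen X Y y)" and zero: "P (mzero (free_rep X Y))"
    and neg: "\<And>s. s \<in> mcar (free_rep X Y) \<Longrightarrow> P s \<Longrightarrow> P (mneg (free_rep X Y) s)"
    and add: "\<And>s t. s \<in> mcar (free_rep X Y) \<Longrightarrow> P s \<Longrightarrow> t \<in> mcar (free_rep X Y) \<Longrightarrow> P t \<Longrightarrow> P (madd
        (free_rep X Y) s t)"
    and scale: "\<And>c s. s \<in> mcar (free_rep X Y) \<Longrightarrow> P s \<Longrightarrow> P (mscale (free_rep X Y) c s)"
    and act: "\<And>l t. l \<in> lcar (free_rep X Y) \<Longrightarrow> t \<in> mcar (free_rep X Y) \<Longrightarrow> P t \<Longrightarrow> P (act (free_rep X Y)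
        l t)"
  shows "P t"
proof -
  let ?F = "free_rep X Y :: ('k, 'x, 'y) free_alg"
  let ?l = "\<lambda>t :: ('k, 'x) lterm. free_lcong X Y `` {t}" and ?c = "\<lambda>t :: ('k, 'x, 'y) mterm.
      free_mcong X Y `` {t}"
  have l: "lvars s \<subseteq> X \<Longrightarrow> ?l s \<in> lcar ?F" for s
    by (auto simp: free_rep_def quot_lcar term_alg_def)
  have *: "mlvars s \<subseteq> X \<Longrightarrow> mvars s \<subseteq> Y \<Longrightarrow> ?c s \<in> mcar ?F" for s
    by (auto simp: free_rep_def quot_mcar term_alg_def)
  note q = quot_simps[OF rep_cong_free[of X Y], folded free_rep_def, unfolded term_alg_def
      rep_alg.simps, simplified]
    quot_zero[of "term_alg X Y" "free_lcong X Y" "free_mcong X Y", folded free_rep_def, unfolded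
        term_alg_def rep_alg.simps]
  have "mlvars s \<subseteq> X \<Longrightarrow> mvars s \<subseteq> Y \<Longrightarrow> P (?c s)" for s
  proof (induction s)
    case (MVar x) then show ?case using gen[of x] by (simp add: mgen_def)
  next
    case MZero then show ?case using zero by (simp add: q)
  next
    case (MNeg s) then show ?case using neg[of "?c s"] * by (simp add: q)
  next
    case (MAdd s t) then show ?case using add[of "?c s" "?c t"] * by (simp add: q)
  next
    case (MScale c s) then show ?case using scale[of "?c s" c] * by (simp add: q)
  next
    case (MAct s t) then show ?case using act[of "?l s" "?c t"] * l by (simp add: q)
  qed
  then show ?thesis
    using assms(1) by (auto simp: free_rep_def quot_mcar term_alg_def)
qed

lemma free_rep_hom_unique:
  assumes \<phi>: "\<phi> \<in> rep_hom (free_rep X Y) H" and \<psi>: "\<psi> \<in> rep_hom (free_rep X Y) H"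
    and x: "\<And>x. x \<in> X \<Longrightarrow> fst \<phi> (lgen X Y x) = fst \<psi> (lgen X Y x)"
    and y: "\<And>y. y \<in> Y \<Longrightarrow> snd \<phi> (mgen X Y y) = snd \<psi> (mgen X Y y)"
  shows "\<phi> = \<psi>"
proof (rule hom_eqI[OF \<phi> \<psi>])
  show l: "fst \<phi> t = fst \<psi> t" if "t \<in> lcar (free_rep X Y)" for t
    using that by (induction rule: free_rep_linduct) (simp_all add: x hom_simps[OF \<phi>] hom_simps[OF
        \<psi>])
  show "snd \<phi> t = snd \<psi> t" if "t \<in> mcar (free_rep X Y)" for t
    using that by (induction rule: free_rep_minduct) (simp_all add: y l hom_simps[OF \<phi>] hom_simps[OF
        \<psi>])
qed

section \<open>Linear spaces and weights\<close>

context lin_space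
begin

lemma zero_add: "x \<in> V \<Longrightarrow> add zero x = x"
  using add_commute[of zero x] add_zero[of x] zero_closed by simp

lemma add_left_cancel:
  assumes "x \<in> V" "y \<in> V" "z \<in> V"
  shows "add x y = add x z \<longleftrightarrow> y = z"
proof -
  have "add (neg x) (add x u) = u" if "u \<in> V" for u
  proof -
    have "add (neg x) (add x u) = add (add (neg x) x) u"
      using assms that by (simp only: add_assoc neg_closed)
    also have "add (neg x) x = zero"
      using assms by (simp only: add_commute[of "neg x" x] neg_closed add_neg)
    finally show ?thesis
      using that by (simp only: zero_add)
  qed
  from this[OF assms(2)] this[OF assms(3)] show ?thesis by metis
qed

lemma add_swap:
  assumes "a \<in> V" "b \<in> V" "c \<in> V" "d \<in> V"
  shows "add (add a b) (add c d) = add (add a c) (add b d)"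
proof -
  have "add b (add c d) = add (add b c) d"
    using assms by (simp only: add_assoc)
  also have "\<dots> = add (add c b) d"
    using assms by (simp only: add_commute[of b c])
  also have "\<dots> = add c (add b d)"
    using assms by (simp only: add_assoc)
  finally show ?thesis
    using assms by (simp only: add_assoc add_closed)
qed

lemma scale_zero_left: "x \<in> V \<Longrightarrow> scale 0 x = zero"
  using add_scale[of x 0 0] add_left_cancel[of "scale 0 x" "scale 0 x" zero]
  by (simp add: add_zero scale_closed zero_closed)

lemma scale_zero_right: "scale c zero = zero"
  using scale_scale[OF zero_closed, of c 0] by (simp add: scale_zero_left zero_closed)

lemma neg_eq_scale: "x \<in> V \<Longrightarrow> neg x = scale (- 1) x"
  using add_scale[of x 1 "- 1"] add_left_cancel[of x "neg x" "scale (- 1) x"]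
  by (simp add: add_neg scale_one scale_zero_left neg_closed scale_closed)

lemma scale_eq_zero:
  assumes "x \<in> V"
  shows "scale c x = zero \<longleftrightarrow> c = 0 \<or> x = zero"
proof
  assume 0: "scale c x = zero"
  show "c = 0 \<or> x = zero"
  proof (cases "c = 0")
    case False
    have "x = scale (inverse c) (scale c x)"
      using assms False by (simp add: scale_scale scale_one)
    then show ?thesis
      by (simp add: 0 scale_zero_right)
  qed simp
qed (use assms in \<open>auto simp: scale_zero_left scale_zero_right\<close>)

lemma scale_right_cancel:
  assumes "x \<in> V" "x \<noteq> zero" "scale c x = scale d x"
  shows "c = d"
proof -
  have "scale (c - d) x = add (scale d x) (scale (- d) x)"
    using add_scale[of x c "- d"] assms by simp
  also have "\<dots> = zero"
    using add_scale[of x d "- d"] assms(1) by (simp add: scale_zero_left)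
  finally show ?thesis
    using assms scale_eq_zero by simp
qed

inductive_set span :: "'a set \<Rightarrow> 'a set" for S where
  span_zero: "zero \<in> span S"
| span_base: "s \<in> S \<Longrightarrow> s \<in> V \<Longrightarrow> s \<in> span S"
| span_add: "s \<in> span S \<Longrightarrow> t \<in> span S \<Longrightarrow> add s t \<in> span S"
| span_scale: "s \<in> span S \<Longrightarrow> scale c s \<in> span S"

lemma span_closed: "s \<in> span S \<Longrightarrow> s \<in> V"
  by (induction rule: span.induct) (auto simp: zero_closed add_closed scale_closed)

lemma span_mono: "s \<in> span S \<Longrightarrow> S \<subseteq> T \<Longrightarrow> s \<in> span T"
  by (induction rule: span.induct) (auto intro: span.intros)

lemma span_pair:
  assumes "s \<in> span {a, b}" "a \<in> V" "b \<in> V"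
  obtains c d where "s = add (scale c a) (scale d b)"
proof -
  have "\<exists>c d. s = add (scale c a) (scale d b)"
    using assms(1)
  proof induction
    case span_zero
    then show ?case
      using assms(2,3) by (intro exI[of _ 0]) (simp add: scale_zero_left add_zero zero_closed)
  next
    case (span_base s)
    then consider "s = a" | "s = b" by blast
    then show ?case
    proof cases
      case 1
      then show ?thesis
        using assms(2,3) by (intro exI[of _ 1] exI[of _ 0]) (simp add: scale_zero_left add_zero
            scale_one)
    next
      case 2
      then show ?thesis
        using assms(2,3) by (intro exI[of _ 0] exI[of _ 1]) (simp add: scale_zero_left zero_add
            scale_one)
    qed
  next
    case (span_add s t)
    then obtain c d c' d' where "s = add (scale c a) (scale d b)" "t = add (scale c' a) (scale d'
        b)"
      by blast
    then have "add s t = add (scale (c + c') a) (scale (d + d') b)"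
      using assms(2,3) by (simp add: add_scale scale_closed add_swap)
    then show ?case by blast
  next
    case (span_scale s e)
    then obtain c d where "s = add (scale c a) (scale d b)" by blast
    then have "scale e s = add (scale (e * c) a) (scale (e * d) b)"
      using assms(2,3) by (simp add: scale_add scale_closed scale_scale)
    then show ?case by blast
  qed
  then show ?thesis using that by blast
qed

lemma span_singleton:
  assumes "s \<in> span {a}" "a \<in> V"
  obtains c where "s = scale c a"
proof -
  obtain c d where "s = add (scale c a) (scale d a)"
    using span_pair[of s a a] assms by auto
  then have "s = scale (c + d) a"
    using assms(2) by (simp add: add_scale)
  then show ?thesis by (rule that)
qed

text \<open>Eigenvectors for the distinct eigenvalues \<open>2 ^ d\<close> are independent: the operators
  \<open>\<delta> - 2 ^ d\<close> with \<open>d \<noteq> 1\<close> commute, and enough of them kill the part of \<open>w\<close> outside \<open>S 1\<close>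
  while acting on eigenvectors for \<open>2\<close> as nonzero scalars.\<close>

lemma span_eigenvectors:
  fixes S :: "nat \<Rightarrow> 'a set"
  assumes \<delta>: "\<And>x. x \<in> V \<Longrightarrow> \<delta> x \<in> V" "\<And>x y. x \<in> V \<Longrightarrow> y \<in> V \<Longrightarrow> \<delta> (add x y) = add (\<delta> x) (\<delta> y)"
      "\<And>x c. x \<in> V \<Longrightarrow> \<delta> (scale c x) = scale c (\<delta> x)"
    and char: "\<And>d. d \<noteq> 1 \<Longrightarrow> (2::'k) ^ d \<noteq> 2"
    and S: "\<And>d s. s \<in> S d \<Longrightarrow> \<delta> s = scale (2 ^ d) s"
    and w: "w \<in> span (\<Union>d. S d)" "\<delta> w = scale 2 w"
  shows "w \<in> span (S 1)"
proof -
  \<comment> \<open>The sequence 2 ^ 0, 2 ^ 2, 2 ^ 3, ... of the eigenvalues 2 ^ d with d \<noteq>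
    1.\<close>
  define c :: "nat \<Rightarrow> 'k" where "c i = 2 ^ (if i = 0 then 0 else Suc i)" for i
  define D where "D a u = add (\<delta> u) (scale (- a) u)" for a u
  \<comment> \<open>\<open>p n\<close> is the product of the commuting operators \<delta> - c i over
    i < n.\<close>
  define p where "p = rec_nat (\<lambda>u. u) (\<lambda>n f u. D (c n) (f u))"
  have p0: "p 0 u = u" and pS: "p (Suc n) u = D (c n) (p n u)" for n u
    by (simp_all add: p_def)
  have D_closed: "D a u \<in> V" if "u \<in> V" for a u
    using that by (simp add: D_def \<delta> add_closed scale_closed)
  have D_add: "D a (add u v) = add (D a u) (D a v)" if "u \<in> V" "v \<in> V" for a u v
    using that by (simp add: D_def \<delta> scale_add add_swap scale_closed)
  have D_scale: "D a (scale b u) = scale b (D a u)" if "u \<in> V" for a b u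
    using that by (simp add: D_def \<delta> scale_add scale_closed scale_scale mult.commute)
  have D_eigen: "D a u = scale (b - a) u" if "u \<in> V" "\<delta> u = scale b u" for a b u
    using that add_scale[of u b "- a"] by (simp add: D_def)
  have p_closed: "p n u \<in> V" if "u \<in> V" for n u
    by (induction n) (simp_all add: p0 pS that D_closed)
  have p_add: "p n (add u v) = add (p n u) (p n v)" if "u \<in> V" "v \<in> V" for n u v
    by (induction n) (simp_all add: p0 pS that D_add p_closed)
  have p_scale: "p n (scale b u) = scale b (p n u)" if "u \<in> V" for n b u
    by (induction n) (simp_all add: p0 pS that D_scale p_closed)
  have p_eigen: "p n u = scale (\<Prod>i<n. b - c i) u" if "u \<in> V" "\<delta> u = scale b u" for n b u
    by (induction n) (simp_all add: p0 pS that scale_one D_scale D_eigen[OF that] scale_scale)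
  have p_mono: "p (n + k) u = zero" if "p n u = zero" for n k u
    using that scale_zero_right[of 0] D_scale[OF zero_closed, of _ 0]
    by (induction k) (simp_all add: pS scale_zero_left zero_closed D_closed)
  \<comment> \<open>The part of weight 1 is split off, and the remainder \<open>u\<close> is
    annihilated by some \<open>p n\<close>. A sum needs a common index, for which
    \<open>p_mono\<close> allows \<open>n + n'\<close>.\<close>
  have "\<exists>a u n. a \<in> span (S 1) \<and> u \<in> V \<and> p n u = zero \<and> w = add a u"
    using w(1)
  proof induction
    case span_zero
    then show ?case
      by (intro exI[of _ zero] exI[of _ 0]) (simp add: p0 span.span_zero zero_closed add_zero)
  next
    case (span_base s)
    then obtain d where d: "s \<in> S d" by blast
    show ?case
    proof (cases "d = 1")
      case True
      with d span_base show ?thesis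
        by (intro exI[of _ s] exI[of _ zero] exI[of _ 0]) (simp add: p0 span.span_base zero_closed
            add_zero)
    next
      case False
      \<comment> \<open>Exponent 0 sits at position 0 and an exponent d \<ge> 2 at position d - 1,
        because exponent 1 is skipped.\<close>
      have "2 ^ d = c (if d = 0 then 0 else d - 1)"
        using False by (cases d) (auto simp: c_def)
      then obtain i where "2 ^ d = c i" ..
      then have "p (Suc i) s = zero"
        using span_base p_eigen[OF _ S[OF d], of "Suc i"] by (simp add: scale_zero_left)
      then show ?thesis
        using span_base by (intro exI[of _ zero] exI[of _ s]) (auto simp: span.span_zero zero_add)
    qed
  next
    case (span_add s t)
    then obtain a u n a' u' n' where *: "a \<in> span (S 1)" "u \<in> V" "p n u = zero" "s = add a u"
      "a' \<in> span (S 1)" "u' \<in> V" "p n' u' = zero" "t = add a' u'"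
      by blast
    have "p (n + n') (add u u') = zero"
      using * p_mono[of n u n'] p_mono[of n' u' n] by (simp add: p_add add.commute add_zero
          zero_closed)
    moreover have "add s t = add (add a a') (add u u')"
      using * by (simp add: add_swap span_closed)
    ultimately show ?case
      using * by (intro exI[of _ "add a a'"] exI[of _ "add u u'"] exI[of _ "n + n'"])
        (simp add: span.span_add add_closed)
  next
    case (span_scale s b)
    then obtain a u n where *: "a \<in> span (S 1)" "u \<in> V" "p n u = zero" "s = add a u"
      by blast
    then have "p n (scale b u) = zero" "scale b s = add (scale b a) (scale b u)"
      by (simp_all add: p_scale scale_zero_right scale_add span_closed)
    then show ?case
      using * by (intro exI[of _ "scale b a"] exI[of _ "scale b u"] exI[of _ n])
        (simp add: span.span_scale scale_closed)
  qed
  then obtain a u n where *: "a \<in> span (S 1)" "u \<in> V" "p n u = zero" "w = add a u"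
    by blast
  have a: "\<delta> a = scale 2 a"
    using *(1)
  proof induction
    case span_zero
    then show ?case
      using \<delta>(3)[OF zero_closed, of 0] by (simp add: scale_zero_left zero_closed \<delta> scale_zero_right)
  next
    case (span_add s t)
    then show ?case by (simp add: \<delta> span_closed scale_add)
  next
    case (span_scale s c)
    then show ?case by (simp add: \<delta> span_closed scale_scale mult.commute)
  qed (use S[of _ 1] in auto)
  \<comment> \<open>Both \<open>w\<close> and \<open>a\<close> have eigenvalue 2, hence so does
    \<open>u\<close>. Then \<open>p n\<close> acts on \<open>u\<close> as a product of the nonzero
    scalars 2 - c i, and since it annihilates \<open>u\<close>, the remainder is zero.\<close>
  have "\<delta> u = scale 2 u"
    using w(2) *(1,2) a add_left_cancel[of "scale 2 a" "\<delta> u" "scale 2 u"]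
    by (simp add: *(4) \<delta> span_closed scale_add scale_closed)
  from p_eigen[OF *(2) this, of n] *(3) have "scale (\<Prod>i<n. 2 - c i) u = zero"
    by simp
  moreover have "2 - c i \<noteq> 0" for i
    using char[of "if i = 0 then 0 else Suc i"] by (auto simp: c_def)
  ultimately have "u = zero"
    using scale_eq_zero[OF *(2)] by simp
  then show ?thesis
    using * by (simp add: add_zero span_closed)
qed

end

text \<open>This is what characteristic 0 is for: in positive characteristic some power 2 ^ d with d
  \<noteq> 1 equals 2, and degrees are no longer separated.\<close>

lemma power_two_neq: "d \<noteq> 1 \<Longrightarrow> (2 :: 'k::field_char_0) ^ d \<noteq> 2"
proof
  assume "d \<noteq> 1" "(2 :: 'k) ^ d = 2"
  then have "of_nat (2 ^ d) = (of_nat (2 ^ 1) :: 'k)" by simp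
  then have "(2::nat) ^ d = 2 ^ 1" by (simp only: of_nat_eq_iff)
  then show False using \<open>d \<noteq> 1\<close> power_inject_exp[of "2::nat" d 1] by simp
qed

section \<open>Elementary consequences of the Lie and action axioms\<close>

context lie_alg
begin

lemma br_zero: "x \<in> V \<Longrightarrow> br zero x = zero" "x \<in> V \<Longrightarrow> br x zero = zero"
  using br_scale_left[OF zero_closed, of x 0] br_scale_right[OF _ zero_closed, of x 0]
  by (simp_all add: scale_zero_left br_closed zero_closed)

lemma br_anti:
  assumes "x \<in> V" "y \<in> V"
  shows "br y x = scale (- 1) (br x y)"
proof -
  have "zero = br (add x y) (add x y)"
    using assms by (simp add: br_self add_closed)
  also have "\<dots> = add (br x (add x y)) (br y (add x y))"
    using assms by (simp only: br_add_left add_closed)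
  also have "\<dots> = add (br x y) (br y x)"
    using assms by (simp add: br_add_right br_self br_closed zero_add add_zero)
  finally have "add (br x y) (br y x) = add (br x y) (neg (br x y))"
    using assms by (simp add: add_neg br_closed)
  then have "br y x = neg (br x y)"
    using assms by (simp only: add_left_cancel br_closed neg_closed)
  then show ?thesis
    using assms by (simp add: br_closed neg_eq_scale)
qed

lemma span_br_closed:
  assumes S: "\<And>s t. s \<in> S \<Longrightarrow> t \<in> S \<Longrightarrow> br s t \<in> S" and "s \<in> span S" "t \<in> span S"
  shows "br s t \<in> span S"
  using assms(2)
proof induction
  case span_zero
  then show ?case using assms(3) by (simp add: br_zero span_closed span.span_zero)
next
  case (span_base s)
  show ?case
    using assms(3)
    by induction (use span_base in \<open>auto simp: br_zero br_add_right br_scale_right span_closed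
        br_closed S intro: span.intros\<close>)
qed (auto simp: br_add_left br_scale_left span_closed span_closed[OF assms(3)] intro: span.intros)

end

context lie_rep
begin

lemma act_zero: "v \<in> mcar H \<Longrightarrow> act H (lzero H) v = mzero H" "x \<in> lcar H \<Longrightarrow> act H x (mzero H) = mzero
    H"
  using act_scale_left[OF lie.zero_closed, of v 0] act_scale_right[OF _ md.zero_closed, of x 0]
  by (simp_all add: lie.scale_zero_left md.scale_zero_left act_closed lie.zero_closed
      md.zero_closed)

end

text \<open>Zero and negation are multiplication by the scalars 0 and -1, which disposes of the four
  clauses of \<open>rep_hom\<close> about them.\<close>

lemma rep_homI:
  assumes "lie_rep H" "lie_rep G" and f: "f \<in> lcar H \<rightarrow>\<^sub>E lcar G" and g: "g \<in> mcar H \<rightarrow>\<^sub>E mcar G"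
    and "\<And>x y. x \<in> lcar H \<Longrightarrow> y \<in> lcar H \<Longrightarrow> f (ladd H x y) = ladd G (f x) (f y)"
    and fs: "\<And>x c. x \<in> lcar H \<Longrightarrow> f (lscale H c x) = lscale G c (f x)"
    and "\<And>x y. x \<in> lcar H \<Longrightarrow> y \<in> lcar H \<Longrightarrow> f (lbr H x y) = lbr G (f x) (f y)"
    and "\<And>v w. v \<in> mcar H \<Longrightarrow> w \<in> mcar H \<Longrightarrow> g (madd H v w) = madd G (g v) (g w)"
    and gs: "\<And>v c. v \<in> mcar H \<Longrightarrow> g (mscale H c v) = mscale G c (g v)"
    and "\<And>x v. x \<in> lcar H \<Longrightarrow> v \<in> mcar H \<Longrightarrow> g (act H x v) = act G (f x) (g v)"
  shows "(f, g) \<in> rep_hom H G"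
proof -
  interpret H: lie_rep H by fact
  interpret G: lie_rep G by fact
  have fc: "x \<in> lcar H \<Longrightarrow> f x \<in> lcar G" and gc: "v \<in> mcar H \<Longrightarrow> g v \<in> mcar G" for x v
    using f g by auto
  have "f (lzero H) = lzero G" "g (mzero H) = mzero G"
    using fs[OF H.lie.zero_closed, of 0] gs[OF H.md.zero_closed, of 0]
    by (simp_all add: H.lie.scale_zero_right H.md.scale_zero_right G.lie.scale_zero_left
        G.md.scale_zero_left fc gc H.lie.zero_closed H.md.zero_closed)
  then show ?thesis
    using assms unfolding rep_hom_def
    by (auto simp: H.lie.neg_eq_scale H.md.neg_eq_scale G.lie.neg_eq_scale G.md.neg_eq_scale fc gc)
qed

section \<open>Linear operators on sequences\<close>

text \<open>A concrete test object: an element of a free algebra is nonzero as soon as one of its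
  values here is nonzero. Sequences are chosen because they admit one-sided shifts, whose commutator
  does not vanish.\<close>

definition gl_seq :: "('k::field, (nat \<Rightarrow> 'k) \<Rightarrow> nat \<Rightarrow> 'k, nat \<Rightarrow> 'k) rep_alg" where
  "gl_seq = \<lparr>
     lcar = {T. \<forall>c u v. T (\<lambda>n. c * u n + v n) = (\<lambda>n. c * T u n + T v n)},
     lzero = (\<lambda>v n. 0), lneg = (\<lambda>T v n. - T v n), ladd = (\<lambda>S T v n. S v n + T v n),
     lscale = (\<lambda>c T v n. c * T v n), lbr = (\<lambda>S T v n. S (T v) n - T (S v) n),
     mcar = UNIV, mzero = (\<lambda>n. 0), mneg = (\<lambda>v n. - v n), madd = (\<lambda>u v n. u n + v n),
     mscale = (\<lambda>c v n. c * v n), act = (\<lambda>T v. T v) \<rparr>"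

lemma lie_rep_gl_seq: "lie_rep (gl_seq :: ('k::field, _, _) rep_alg)"
proof -
  have lin: "T (\<lambda>n. u n + v n) = (\<lambda>n. T u n + T v n)" "T (\<lambda>n. c * u n) = (\<lambda>n. c * T u n)"
    "T (\<lambda>n. u n - v n) = (\<lambda>n. T u n - T v n)"
    if "\<forall>c u v. T (\<lambda>n. c * u n + v n) = (\<lambda>n. c * T u n + T v n)"
    for T :: "(nat \<Rightarrow> 'k) \<Rightarrow> nat \<Rightarrow> 'k" and u v c
  proof -
    show a: "T (\<lambda>n. u n + v n) = (\<lambda>n. T u n + T v n)" for u v
      using that[rule_format, of 1 u v] by simp
    \<comment> \<open>The scalar -1 on zero sequences turns the linearity law into T 0 = - T 0 + T
      0.\<close>
    have "T (\<lambda>n. 0) = (\<lambda>n. 0)"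
      using that[rule_format, of "- 1" "\<lambda>_. 0" "\<lambda>_. 0"] by simp
    then show "T (\<lambda>n. c * u n) = (\<lambda>n. c * T u n)"
      using that[rule_format, of c u "\<lambda>_. 0"] by simp
    show "T (\<lambda>n. u n - v n) = (\<lambda>n. T u n - T v n)"
      using that[rule_format, of "- 1" v u] by simp
  qed
  show ?thesis
    by unfold_locales (auto simp: gl_seq_def lin algebra_simps)
qed

text \<open>Generators are sent to shifts and to the constant sequence 1. The left shift fixes that
  sequence, and the commutator of the left and the right shift sends it to (1, 0, 0, ...), so entry
  0 tells the images apart from zero.\<close>

lemma
  fixes X :: "'x set" and Y :: "'y set"
  defines "F \<equiv> free_rep X Y :: ('k::field, 'x, 'y) free_alg"
  shows lgen_nonzero: "x \<in> X \<Longrightarrow> lgen X Y x \<noteq> lzero F"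
    and mgen_nonzero: "y \<in> Y \<Longrightarrow> mgen X Y y \<noteq> mzero F"
    and lbr_gen_nonzero: "x \<in> X \<Longrightarrow> x' \<in> X \<Longrightarrow> x \<noteq> x' \<Longrightarrow> lbr F (lgen X Y x) (lgen X Y x') \<noteq> lzero F"
    and act_gen_nonzero: "x \<in> X \<Longrightarrow> y \<in> Y \<Longrightarrow> act F (lgen X Y x) (mgen X Y y) \<noteq> mzero F"
    and act_lbr_gen_nonzero: "x \<in> X \<Longrightarrow> x' \<in> X \<Longrightarrow> x \<noteq> x' \<Longrightarrow> y \<in> Y \<Longrightarrow>
      act F (lbr F (lgen X Y x) (lgen X Y x')) (mgen X Y y) \<noteq> mzero F"
proof -
  let ?L = "\<lambda>v n. v (Suc n) :: 'k" and ?R = "\<lambda>v n. if n = 0 then 0 else v (n - 1) :: 'k"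
  have LR: "?L \<in> lcar gl_seq" "?R \<in> lcar gl_seq"
    by (auto simp: gl_seq_def fun_eq_iff)
  have bracket: "lbr gl_seq ?L ?R (\<lambda>_. 1) 0 = 1"
    by (simp add: gl_seq_def)
  have F: "lie_rep F"
    by (simp add: F_def lie_rep_free)
  have cl: "x \<in> X \<Longrightarrow> lgen X Y x \<in> lcar F" "y \<in> Y \<Longrightarrow> mgen X Y y \<in> mcar F" for x y
    by (simp_all add: F_def lgen_closed mgen_closed)
  obtain \<phi> where \<phi>: "\<phi> \<in> rep_hom F gl_seq" "\<And>x. x \<in> X \<Longrightarrow> fst \<phi> (lgen X Y x) = ?L"
    "\<And>y. y \<in> Y \<Longrightarrow> snd \<phi> (mgen X Y y) = (\<lambda>_. 1)"
    unfolding F_def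
    by (rule free_rep_hom[OF lie_rep_gl_seq, of X "\<lambda>_. ?L" Y "\<lambda>_ _. 1"])
      (auto simp: LR, simp add: gl_seq_def)
  note h = hom_simps[OF \<phi>(1)]
  show "lgen X Y x \<noteq> lzero F" if "x \<in> X"
  proof
    assume "lgen X Y x = lzero F"
    then have "?L = lzero gl_seq"
      using \<phi>(2)[OF that] h(2) by simp
    from fun_cong[OF fun_cong[OF this], of "\<lambda>_. 1" 0] show False
      by (simp add: gl_seq_def)
  qed
  show "y \<in> Y \<Longrightarrow> mgen X Y y \<noteq> mzero F"
    using \<phi>(3)[of y] h(8) by (auto simp: gl_seq_def fun_eq_iff)
  show "x \<in> X \<Longrightarrow> y \<in> Y \<Longrightarrow> act F (lgen X Y x) (mgen X Y y) \<noteq> mzero F"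
    using h(12)[of "lgen X Y x" "mgen X Y y"] h(8) by (auto simp: cl \<phi> gl_seq_def fun_eq_iff)
  {
    assume x: "x \<in> X" "x' \<in> X" "x \<noteq> x'"
    obtain \<psi> where \<psi>: "\<psi> \<in> rep_hom F gl_seq"
      "\<And>z. z \<in> X \<Longrightarrow> fst \<psi> (lgen X Y z) = (if z = x then ?L else ?R)"
      "\<And>y. y \<in> Y \<Longrightarrow> snd \<psi> (mgen X Y y) = (\<lambda>_. 1)"
      unfolding F_def
      by (rule free_rep_hom[OF lie_rep_gl_seq, of X "\<lambda>z. if z = x then ?L else ?R" Y "\<lambda>_ _. 1"])
        (auto simp: LR, simp add: gl_seq_def)
    note h = hom_simps[OF \<psi>(1)]
    have br: "fst \<psi> (lbr F (lgen X Y x) (lgen X Y x')) = lbr gl_seq ?L ?R"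
      using x by (simp add: h cl \<psi>(2))
    show "lbr F (lgen X Y x) (lgen X Y x') \<noteq> lzero F"
    proof
      assume "lbr F (lgen X Y x) (lgen X Y x') = lzero F"
      then have "lbr gl_seq ?L ?R = lzero gl_seq"
        using br h(2) by simp
      from fun_cong[OF fun_cong[OF this], of "\<lambda>_. 1" 0] show False
        unfolding bracket by (simp add: gl_seq_def)
    qed
    assume y: "y \<in> Y"
    have "snd \<psi> (act F (lbr F (lgen X Y x) (lgen X Y x')) (mgen X Y y)) = lbr gl_seq ?L ?R (\<lambda>_. 1)"
      using x y lie_rep.closed[OF F] by (simp add: h cl br \<psi>(3) rep_closed_def) (simp add:
          gl_seq_def)
    then have "snd \<psi> (act F (lbr F (lgen X Y x) (lgen X Y x')) (mgen X Y y)) 0 = 1"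
      by (simp only: bracket)
    then show "act F (lbr F (lgen X Y x) (lgen X Y x')) (mgen X Y y) \<noteq> mzero F"
      using h(8) by (auto simp: gl_seq_def)
  }
qed

section \<open>Free algebras of small rank\<close>

lemma free_no_lgen:
  assumes "t \<in> lcar (free_rep {} Y)"
  shows "t = lzero (free_rep {} Y)"
proof -
  interpret F: lie_rep "free_rep {} Y" by (rule lie_rep_free)
  show ?thesis
    using assms
    by (induction rule: free_rep_linduct)
      (simp_all add: F.lie.neg_eq_scale F.lie.scale_zero_right F.lie.add_zero F.lie.br_self
          F.lie.zero_closed)
qed

text \<open>All brackets vanish on a line, so nothing beyond the multiples of the generator arises,
  whatever \<open>Y\<close> is.\<close>

lemma free_one_lgen:
  assumes "t \<in> lcar (free_rep {x} Y)"
  obtains c where "t = lscale (free_rep {x} Y) c (lgen {x} Y x)"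
proof -
  interpret F: lie_rep "free_rep {x} Y" by (rule lie_rep_free)
  let ?F = "free_rep {x} Y" and ?x = "lgen {x} Y x"
  have x: "?x \<in> lcar ?F" by (simp add: lgen_closed)
  have "\<exists>c. t = lscale ?F c ?x"
    using assms
  proof (induction rule: free_rep_linduct)
    case (gen z) then show ?case using F.lie.scale_one[OF x] by (metis singletonD)
  next
    case zero then show ?case using F.lie.scale_zero_left[OF x] by metis
  next
    case (neg s) then show ?case using F.lie.neg_eq_scale F.lie.scale_scale[OF x] by metis
  next
    case (add s t) then show ?case using F.lie.add_scale[OF x] by metis
  next
    case (scale c s) then show ?case using F.lie.scale_scale[OF x] by metis
  next
    case (br s t)
    then obtain c d where "s = lscale ?F c ?x" "t = lscale ?F d ?x" by blast
    then have "lbr ?F s t = lzero ?F"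
      by (simp add: x F.lie.br_scale_left F.lie.br_scale_right F.lie.scale_closed F.lie.br_self
          F.lie.scale_zero_right)
    then show ?case using F.lie.scale_zero_left[OF x] by metis
  qed
  then show ?thesis using that by blast
qed

text \<open>By \<open>free_no_lgen\<close> only zero acts, so the action contributes nothing beyond
  linear combinations of the generators.\<close>

lemma free_no_lgen_mspan:
  fixes Y :: "'y set" and t :: "('k::field, 'x, 'y) mterm set"
  defines "F \<equiv> free_rep {} Y :: ('k::field, 'x, 'y) free_alg"
  assumes "t \<in> mcar F"
  shows "t \<in> lin_space.span (mcar F) (mzero F) (madd F) (mscale F) (mgen {} Y ` Y)"
proof -
  interpret F: lie_rep F unfolding F_def by (rule lie_rep_free)
  show ?thesis
    using assms(2) unfolding F_def
  proof (induction rule: free_rep_minduct)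
    case (gen y)
    then show ?case
      unfolding F_def[symmetric] by (intro F.md.span_base) (auto simp: F_def mgen_closed)
  next
    case (act l t)
    then show ?case
      using free_no_lgen F.act_zero(1)[of t] F.md.span_zero unfolding F_def by metis
  qed (auto simp flip: F_def simp: F.md.neg_eq_scale intro: F.md.span.intros)
qed

text \<open>Bracket monomials with their bidegree in the two letters. A relation is used because an
  element has no degree of its own: in a Lie algebra \<open>lbr H x x\<close> and
  \<open>lbr H y y\<close> are built with different bidegrees and are both zero.\<close>

inductive lmono :: "('k, 'a, 'b) rep_alg \<Rightarrow> 'a \<Rightarrow> 'a \<Rightarrow> nat \<Rightarrow> nat \<Rightarrow> 'a \<Rightarrow> bool" for H x y where
  lmono_left: "lmono H x y 1 0 x"
| lmono_right: "lmono H x y 0 1 y"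
| lmono_br: "lmono H x y i j s \<Longrightarrow> lmono H x y i' j' t \<Longrightarrow> lmono H x y (i + i') (j + j') (lbr H s t)"

lemma lmono_pos: "lmono H x y i j t \<Longrightarrow> i + j > 0"
  by (induction rule: lmono.induct) auto

lemma lmono_one: "lmono H x y i j t \<Longrightarrow> i + j = 1 \<Longrightarrow> t = (if i = 1 then x else y)"
proof (induction rule: lmono.induct)
  case (lmono_br i j s i' j' t)
  then show ?case using lmono_pos[of H x y i j s] lmono_pos[of H x y i' j' t] by linarith
qed auto

lemma lmono_one_one: "lmono H x y 1 1 t \<Longrightarrow> t = lbr H x y \<or> t = lbr H y x"
proof (erule lmono.cases)
  fix i j s i' j' t'
  assume *: "1 = i + i'" "1 = j + j'" "t = lbr H s t'" "lmono H x y i j s" "lmono H x y i' j' t'"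
  then have "i + j = 1 \<and> i' + j' = 1"
    using lmono_pos[of H x y i j s] lmono_pos[of H x y i' j' t'] by linarith
  with * show ?thesis
    using lmono_one[of H x y i j s] lmono_one[of H x y i' j' t'] by (cases "i = 1") auto
qed auto

locale free_two_lgen =
  fixes x y :: 'x and F :: "('k::field_char_0, 'x, 'y) free_alg" and a b :: "('k, 'x) lterm set"
  assumes xy: "x \<noteq> y"
  defines F_def: "F \<equiv> free_rep {x, y} {}"
    and a_def: "a \<equiv> lgen {x, y} ({} :: 'y set) x" and b_def: "b \<equiv> lgen {x, y} ({} :: 'y set) y"
begin

sublocale F: lie_rep F
  unfolding F_def by (rule lie_rep_free)

lemma ab: "a \<in> lcar F" "b \<in> lcar F"
  by (simp_all add: a_def b_def F_def lgen_closed)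

lemma lmono_closed: "lmono F a b i j t \<Longrightarrow> t \<in> lcar F"
  by (induction rule: lmono.induct) (simp_all add: ab F.lie.br_closed)

lemma lmono_span:
  assumes "w \<in> lcar F"
  shows "w \<in> F.lie.span {t. \<exists>i j. lmono F a b i j t}"
  using assms unfolding F_def
proof (induction rule: free_rep_linduct)
  case (gen z)
  then have "z = x \<or> z = y" by simp
  then have "lgen {x, y} ({} :: 'y set) z = a \<or> lgen {x, y} ({} :: 'y set) z = b"
    by (elim disjE) (simp_all add: a_def b_def)
  then have "lgen {x, y} ({} :: 'y set) z \<in> {t. \<exists>i j. lmono F a b i j t}"
    "lgen {x, y} ({} :: 'y set) z \<in> lcar F"
    using lmono_left[of F a b] lmono_right[of F a b] ab by auto
  then show ?case
    unfolding F_def[symmetric] by (rule F.lie.span_base)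
next
  case (br s t)
  then show ?case
    unfolding F_def[symmetric] by (intro F.lie.span_br_closed) (auto intro: lmono_br)
qed (auto simp flip: F_def simp: F.lie.neg_eq_scale intro: F.lie.span.intros)

text \<open>Free exponents let one lemma serve three gradings: \<open>m = n = 1\<close> reads off
  the total degree, \<open>m = 1\<close> and \<open>n = 0\<close> the degree in \<open>a\<close>,
  \<open>m = 0\<close> and \<open>n = 1\<close> the degree in \<open>b\<close>.\<close>

lemma hom_lmono:
  assumes "\<phi> \<in> rep_hom F F" "fst \<phi> a = lscale F (2 ^ m) a" "fst \<phi> b = lscale F (2 ^ n) b"
    and "lmono F a b i j t"
  shows "fst \<phi> t = lscale F (2 ^ (m * i + n * j)) t"
  using assms(4)
proof induction
  case (lmono_br i j s i' j' t)
  then show ?case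
    by (simp add: hom_lbr[OF assms(1)] lmono_closed F.lie.br_scale_left F.lie.br_scale_right
        F.lie.br_closed
        F.lie.scale_closed F.lie.scale_scale power_add algebra_simps)
qed (simp_all add: assms)

text \<open>Monomials of total degree n are eigenvectors for 2 ^ n, so eigenvalue 2 leaves degree 1,
  where only the generators live. The element in question will be the one that describes the
  transported addition.\<close>

lemma linear_element:
  assumes "\<phi> \<in> rep_hom F F" "fst \<phi> a = lscale F 2 a" "fst \<phi> b = lscale F 2 b"
    and "w \<in> lcar F" "fst \<phi> w = lscale F 2 w"
  obtains c d where "w = ladd F (lscale F c a) (lscale F d b)"
proof -
  let ?S = "\<lambda>n. {t. \<exists>i j. lmono F a b i j t \<and> i + j = n}"
  have "w \<in> F.lie.span (?S 1)"
  proof (rule F.lie.span_eigenvectors[of "fst \<phi>"])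
    show "w \<in> F.lie.span (\<Union>n. ?S n)"
      by (rule F.lie.span_mono[OF lmono_span[OF assms(4)]]) blast
    show "fst \<phi> s = lscale F (2 ^ n) s" if "s \<in> ?S n" for n s
    proof -
      from that obtain i j where "lmono F a b i j s" "i + j = n" by blast
      then show ?thesis
        using hom_lmono[OF assms(1), of 1 1 i j s] assms(2,3) by simp
    qed
  qed (simp_all add: hom_simps[OF assms(1)] power_two_neq assms(4,5))
  moreover have "?S 1 \<subseteq> {a, b}"
  proof
    fix t assume "t \<in> ?S 1"
    then obtain i j where "lmono F a b i j t" "i + j = 1" by blast
    from lmono_one[OF this] show "t \<in> {a, b}" by (simp split: if_splits)
  qed
  ultimately have "w \<in> F.lie.span {a, b}"
    by (rule F.lie.span_mono)
  then show ?thesis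
    by (rule F.lie.span_pair[OF _ ab]) (rule that)
qed

text \<open>Two gradings are used in turn: \<phi> isolates degree 1 in \<open>a\<close>, and within
  that part \<psi> isolates degree 1 in \<open>b\<close>. Treating one letter at a time keeps the
  eigenvalue at 2, as \<open>span_eigenvectors\<close> requires. The two brackets that are left are
  proportional.\<close>

lemma bilinear_element:
  assumes \<phi>: "\<phi> \<in> rep_hom F F" "fst \<phi> a = lscale F 2 a" "fst \<phi> b = b"
    and \<psi>: "\<psi> \<in> rep_hom F F" "fst \<psi> a = a" "fst \<psi> b = lscale F 2 b"
    and w: "w \<in> lcar F" "fst \<phi> w = lscale F 2 w" "fst \<psi> w = lscale F 2 w"
  obtains c where "w = lscale F c (lbr F a b)"
proof -
  let ?S = "\<lambda>n. {t. \<exists>j. lmono F a b n j t}" and ?T = "\<lambda>n. {t. lmono F a b 1 n t}"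
  have "w \<in> F.lie.span (?S 1)"
  proof (rule F.lie.span_eigenvectors[of "fst \<phi>"])
    show "w \<in> F.lie.span (\<Union>n. ?S n)"
      by (rule F.lie.span_mono[OF lmono_span[OF w(1)]]) blast
    show "fst \<phi> s = lscale F (2 ^ n) s" if "s \<in> ?S n" for n s
      using that hom_lmono[OF \<phi>(1), of 1 0] \<phi>(2,3) ab by (auto simp: F.lie.scale_one)
  qed (simp_all add: hom_simps[OF \<phi>(1)] power_two_neq w)
  moreover have "?S 1 \<subseteq> (\<Union>n. ?T n)" by blast
  ultimately have "w \<in> F.lie.span (\<Union>n. ?T n)"
    by (rule F.lie.span_mono)
  then have "w \<in> F.lie.span (?T 1)"
  proof (rule F.lie.span_eigenvectors[of "fst \<psi>", rotated 5])
    show "fst \<psi> s = lscale F (2 ^ n) s" if "s \<in> ?T n" for n s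
      using that hom_lmono[OF \<psi>(1), of 0 1] \<psi>(2,3) ab by (auto simp: F.lie.scale_one)
  qed (simp_all add: hom_simps[OF \<psi>(1)] power_two_neq w)
  moreover have "?T 1 \<subseteq> {lbr F a b, lbr F b a}"
    using lmono_one_one[of F a b] by blast
  ultimately have "w \<in> F.lie.span {lbr F a b, lbr F b a}"
    by (rule F.lie.span_mono)
  then obtain c d where "w = ladd F (lscale F c (lbr F a b)) (lscale F d (lbr F b a))"
    using F.lie.span_pair F.lie.br_closed ab by blast
  then have "w = lscale F (c + d * (- 1)) (lbr F a b)"
    using F.lie.br_anti[OF ab] by (simp only: F.lie.add_scale F.lie.scale_scale F.lie.br_closed ab)
  then show ?thesis using that by blast
qed

end

text \<open>The acting Lie algebra is the line through \<open>a\<close>, so the module is spanned by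
  the vectors obtained from \<open>v\<close> by n-fold action of \<open>a\<close>, and \<phi>
  multiplies the n-th of them by 2 ^ n.\<close>

lemma free_one_one_linear:
  fixes x :: 'x and y :: 'y and F :: "('k::field_char_0, 'x, 'y) free_alg"
  defines "F \<equiv> free_rep {x} {y}" and "a \<equiv> lgen {x} {y} x" and "v \<equiv> mgen {x} {y} y"
  assumes \<phi>: "\<phi> \<in> rep_hom F F" "fst \<phi> a = lscale F 2 a" "snd \<phi> v = v"
    and w: "w \<in> mcar F" "snd \<phi> w = mscale F 2 w"
  obtains c where "w = mscale F c (act F a v)"
proof -
  interpret F: lie_rep F unfolding F_def by (rule lie_rep_free)
  let ?t = "\<lambda>n. (act F a ^^ n) v"
  have a: "a \<in> lcar F" and v: "v \<in> mcar F"
    by (simp_all add: a_def v_def F_def lgen_closed mgen_closed)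
  have t: "?t n \<in> mcar F" for n
    by (induction n) (simp_all add: v a F.act_closed)
  have base: "?t n \<in> F.md.span (range ?t)" for n
    by (rule F.md.span_base) (auto simp: t)
  have *: "act F a s \<in> F.md.span (range ?t)" if "s \<in> F.md.span (range ?t)" for s
    using that
  proof induction
    case (span_base s)
    then obtain n where "s = ?t n" by blast
    then have "act F a s = ?t (Suc n)" by simp
    then show ?case using base[of "Suc n"] by simp
  qed (simp_all add: a F.act_zero F.act_add_right F.act_scale_right F.md.span_closed F.md.span_zero
      F.md.span_add F.md.span_scale)
  have span: "w \<in> F.md.span (range ?t)"
    using w(1) unfolding F_def
  proof (induction rule: free_rep_minduct)
    case (gen z)
    then show ?case
      unfolding F_def[symmetric] using base[of 0] by (simp add: v_def)
  next
    case (act l s)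
    from act(1) obtain c where "l = lscale F c a"
      unfolding F_def a_def by (rule free_one_lgen)
    with act have "act F l s = mscale F c (act F a s)" "act F a s \<in> F.md.span (range ?t)"
      using * by (simp_all add: F.act_scale_left a flip: F_def)
    then show ?case
      unfolding F_def[symmetric] by (simp add: F.md.span_scale)
  qed (auto simp flip: F_def simp: F.md.neg_eq_scale intro: F.md.span.intros)
  have "w \<in> F.md.span {?t 1}"
  proof (rule F.md.span_eigenvectors[of "snd \<phi>" "\<lambda>n. {?t n}"])
    show "w \<in> F.md.span (\<Union>n. {?t n})"
      using span by (simp add: UNION_singleton_eq_range)
    have "snd \<phi> (?t n) = mscale F (2 ^ n) (?t n)" for n
      by (induction n) (simp_all add: \<phi> v F.md.scale_one hom_act[OF \<phi>(1)] a t F.act_scale_left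
          F.act_closed
          F.act_scale_right F.md.scale_scale F.md.scale_closed)
    then show "snd \<phi> s = mscale F (2 ^ n) s" if "s \<in> {?t n}" for n s
      using that by simp
  qed (simp_all add: hom_simps[OF \<phi>(1)] power_two_neq w)
  then obtain c where "w = mscale F c (?t 1)"
    by (rule F.md.span_singleton) (rule t)
  then show ?thesis
    using that by simp
qed

section \<open>Automorphisms of the category on points\<close>

text \<open>Composition in \<open>theta0\<close> without the record of source and target. The source
  is an argument because the composite maps have to be made extensional on its carriers.\<close>

definition hcomp ::
  "('k, 'a, 'b) rep_alg \<Rightarrow> ('c \<Rightarrow> 'e) \<times> ('d \<Rightarrow> 'f) \<Rightarrow> ('a \<Rightarrow> 'c) \<times> ('b \<Rightarrow> 'd) \<Rightarrow> ('a \<Rightarrow> 'e) \<times> ('b \<Rightarrow> 'f)"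
      where
  "hcomp H \<psi> \<phi> = (compose (lcar H) (fst \<psi>) (fst \<phi>), compose (mcar H) (snd \<psi>) (snd \<phi>))"

definition hid :: "('k, 'a, 'b) rep_alg \<Rightarrow> ('a \<Rightarrow> 'a) \<times> ('b \<Rightarrow> 'b)" where
  "hid H = (\<lambda>x\<in>lcar H. x, \<lambda>v\<in>mcar H. v)"

lemma hcomp_apply:
  "x \<in> lcar H \<Longrightarrow> fst (hcomp H \<psi> \<phi>) x = fst \<psi> (fst \<phi> x)"
  "v \<in> mcar H \<Longrightarrow> snd (hcomp H \<psi> \<phi>) v = snd \<psi> (snd \<phi> v)"
  by (simp_all add: hcomp_def compose_eq)

lemma hid_apply: "x \<in> lcar H \<Longrightarrow> fst (hid H) x = x" "v \<in> mcar H \<Longrightarrow> snd (hid H) v = v"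
  by (simp_all add: hid_def)

lemma hcomp_hom:
  assumes "rep_closed H" "\<phi> \<in> rep_hom H G" "\<psi> \<in> rep_hom G K"
  shows "hcomp H \<psi> \<phi> \<in> rep_hom H K"
proof -
  have "fst (hcomp H \<psi> \<phi>) \<in> lcar H \<rightarrow>\<^sub>E lcar K" "snd (hcomp H \<psi> \<phi>) \<in> mcar H \<rightarrow>\<^sub>E mcar K"
    by (auto simp: hcomp_def compose_def hom_simps[OF assms(2)] hom_simps[OF assms(3)])
  then show ?thesis
    using assms(1) unfolding rep_hom_def rep_closed_def
    by (simp add: split_beta hcomp_apply hom_simps[OF assms(2)] hom_simps[OF assms(3)])
qed

lemma hid_hom: "rep_closed H \<Longrightarrow> hid H \<in> rep_hom H H"
  by (simp add: rep_hom_def hid_def rep_closed_def)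

section \<open>Objects of the category and morphisms out of free algebras with at most two
  generators\<close>

definition objs :: "'x set \<Rightarrow> 'y set \<Rightarrow> ('k::field, 'x, 'y) free_alg set" where
  "objs X0 Y0 = {free_rep X Y | X Y. finite X \<and> X \<subseteq> X0 \<and> finite Y \<and> Y \<subseteq> Y0}"

lemma objsI: "finite X \<Longrightarrow> X \<subseteq> X0 \<Longrightarrow> finite Y \<Longrightarrow> Y \<subseteq> Y0 \<Longrightarrow> free_rep X Y \<in> objs X0 Y0"
  by (auto simp: objs_def)

lemma objsE:
  assumes "A \<in> objs X0 Y0"
  obtains X Y where "A = free_rep X Y" "finite X" "X \<subseteq> X0" "finite Y" "Y \<subseteq> Y0"
  using assms by (auto simp: objs_def)

lemma objs_lie_rep: "A \<in> objs X0 Y0 \<Longrightarrow> lie_rep A"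
  by (auto simp: objs_def lie_rep_free)

lemma objs_closed: "A \<in> objs X0 Y0 \<Longrightarrow> rep_closed A"
  by (simp add: objs_lie_rep lie_rep.closed)

lemma free_hom_two_l:
  fixes x y :: 'x and H :: "('k::field, 'a, 'b) rep_alg"
  assumes "lie_rep H" "a \<in> lcar H" "b \<in> lcar H" "x \<noteq> y"
  obtains \<phi> where "\<phi> \<in> rep_hom (free_rep {x, y} ({} :: 'y set)) H" "fst \<phi> (lgen {x, y} ({} :: 'y
      set) x) = a"
    "fst \<phi> (lgen {x, y} ({} :: 'y set) y) = b"
proof (rule free_rep_hom[OF assms(1), of "{x, y}" "\<lambda>z. if z = x then a else b" "{}" "\<lambda>_. mzero H"])
  fix \<phi> assume "\<phi> \<in> rep_hom (free_rep {x, y} ({} :: 'y set)) H"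
    "\<And>z. z \<in> {x, y} \<Longrightarrow> fst \<phi> (lgen {x, y} ({} :: 'y set) z) = (if z = x then a else b)"
  with that[of \<phi>] assms(4) show thesis by simp
qed (use assms in auto)

lemma free_hom_two_m:
  fixes x y :: 'y and H :: "('k::field, 'a, 'b) rep_alg"
  assumes "lie_rep H" "a \<in> mcar H" "b \<in> mcar H" "x \<noteq> y"
  obtains \<phi> where "\<phi> \<in> rep_hom (free_rep ({} :: 'x set) {x, y}) H" "snd \<phi> (mgen ({} :: 'x set) {x,
      y} x) = a"
    "snd \<phi> (mgen ({} :: 'x set) {x, y} y) = b"
proof (rule free_rep_hom[OF assms(1), of "{}" "\<lambda>_. lzero H" "{x, y}" "\<lambda>z. if z = x then a else b"])
  fix \<phi> assume "\<phi> \<in> rep_hom (free_rep ({} :: 'x set) {x, y}) H"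
    "\<And>z. z \<in> {x, y} \<Longrightarrow> snd \<phi> (mgen ({} :: 'x set) {x, y} z) = (if z = x then a else b)"
  with that[of \<phi>] assms(4) show thesis by simp
qed (use assms in auto)

lemma free_hom_lm:
  assumes "lie_rep H" "a \<in> lcar H" "v \<in> mcar H"
  obtains \<phi> where "\<phi> \<in> rep_hom (free_rep {x} {y}) H" "fst \<phi> (lgen {x} {y} x) = a"
    "snd \<phi> (mgen {x} {y} y) = v"
  by (rule free_rep_hom[OF assms(1), of "{x}" "\<lambda>_. a" "{y}" "\<lambda>_. v"]) (use assms in auto)

lemma free_one_l_bij:
  fixes x :: 'x and H :: "('k::field, 'a, 'b) rep_alg"
  assumes "lie_rep H"
  shows "bij_betw (\<lambda>\<phi>. fst \<phi> (lgen {x} ({} :: 'y set) x)) (rep_hom (free_rep {x} ({} :: 'y set)) H)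
      (lcar H)"
proof (rule bij_betwI')
  let ?x = "lgen {x} ({} :: 'y set) x :: ('k, 'x) lterm set"
  fix \<phi> \<psi> assume *: "\<phi> \<in> rep_hom (free_rep {x} ({} :: 'y set)) H" "\<psi> \<in> rep_hom (free_rep {x} ({} ::
      'y set)) H"
  then show "fst \<phi> ?x = fst \<psi> ?x \<longleftrightarrow> \<phi> = \<psi>"
    using free_rep_hom_unique[OF *] by auto
  show "fst \<phi> ?x \<in> lcar H"
    using * by (auto intro: hom_lclosed lgen_closed)
next
  fix a assume a: "a \<in> lcar H"
  show "\<exists>\<phi>\<in>rep_hom (free_rep {x} ({} :: 'y set)) H. a = fst \<phi> (lgen {x} ({} :: 'y set) x)"
    by (rule free_rep_hom[OF assms, of "{x}" "\<lambda>_. a" "{}" "\<lambda>_. mzero H"]) (use a in auto)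
qed

lemma free_one_m_bij:
  fixes y :: 'y and H :: "('k::field, 'a, 'b) rep_alg"
  assumes "lie_rep H"
  shows "bij_betw (\<lambda>\<phi>. snd \<phi> (mgen ({} :: 'x set) {y} y)) (rep_hom (free_rep ({} :: 'x set) {y}) H)
      (mcar H)"
proof (rule bij_betwI')
  let ?y = "mgen ({} :: 'x set) {y} y :: ('k, 'x, 'y) mterm set"
  fix \<phi> \<psi> assume *: "\<phi> \<in> rep_hom (free_rep ({} :: 'x set) {y}) H" "\<psi> \<in> rep_hom (free_rep ({} :: 'x
      set) {y}) H"
  then show "snd \<phi> ?y = snd \<psi> ?y \<longleftrightarrow> \<phi> = \<psi>"
    using free_rep_hom_unique[OF *] by auto
  show "snd \<phi> ?y \<in> mcar H"
    using * by (auto intro: hom_mclosed mgen_closed)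
next
  fix a assume a: "a \<in> mcar H"
  show "\<exists>\<phi>\<in>rep_hom (free_rep ({} :: 'x set) {y}) H. a = snd \<phi> (mgen ({} :: 'x set) {y} y)"
    by (rule free_rep_hom[OF assms, of "{}" "\<lambda>_. lzero H" "{y}" "\<lambda>_. a"]) (use a in auto)
qed

type_synonym ('k, 'x, 'y) hom_pair =
  "(('k, 'x) lterm set \<Rightarrow> ('k, 'x) lterm set) \<times> (('k, 'x, 'y) mterm set \<Rightarrow> ('k, 'x, 'y) mterm set)"

text \<open>An automorphism of the category as an object map \<open>P\<close> and a family
  \<open>q\<close> of bijections between hom-sets. Source and target are arguments of
  \<open>q\<close> because a bare pair of maps does not determine them.\<close>

locale free_functor =
  fixes X0 :: "'x set" and Y0 :: "'y set"
    and P :: "('k::field_char_0, 'x, 'y) free_alg \<Rightarrow> ('k, 'x, 'y) free_alg"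
    and q :: "('k, 'x, 'y) free_alg \<Rightarrow>
      ('k, 'x, 'y) hom_pair \<Rightarrow>
      ('k, 'x, 'y) free_alg \<Rightarrow>
      ('k, 'x, 'y) hom_pair"
  assumes inf: "infinite X0" "infinite Y0"
    and P_bij: "bij_betw P (objs X0 Y0) (objs X0 Y0)"
    and q_bij: "A \<in> objs X0 Y0 \<Longrightarrow> B \<in> objs X0 Y0 \<Longrightarrow>
      bij_betw (\<lambda>\<phi>. q A \<phi> B) (rep_hom A B) (rep_hom (P A) (P B))"
    and q_id: "A \<in> objs X0 Y0 \<Longrightarrow> q A (hid A) A = hid (P A)"
    and q_comp: "A \<in> objs X0 Y0 \<Longrightarrow> B \<in> objs X0 Y0 \<Longrightarrow> C \<in> objs X0 Y0 \<Longrightarrow>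
      \<phi> \<in> rep_hom A B \<Longrightarrow> \<psi> \<in> rep_hom B C \<Longrightarrow> q A (hcomp A \<psi> \<phi>) C = hcomp (P A) (q B \<psi> C) (q A \<phi> B)"
begin

abbreviation "Ob \<equiv> (objs X0 Y0 :: ('k, 'x, 'y) free_alg set)"

lemma P_closed: "A \<in> Ob \<Longrightarrow> P A \<in> Ob"
  using P_bij by (simp add: bij_betwE)

lemma P_surj:
  assumes "B \<in> Ob" obtains A where "A \<in> Ob" "P A = B"
proof -
  have "B \<in> P ` Ob"
    using P_bij assms by (simp add: bij_betw_def)
  then show ?thesis by (elim imageE) (rule that, simp_all)
qed

lemma q_closed: "A \<in> Ob \<Longrightarrow> B \<in> Ob \<Longrightarrow> \<phi> \<in> rep_hom A B \<Longrightarrow> q A \<phi> B \<in> rep_hom (P A) (P B)"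
  using bij_betwE[OF q_bij] by simp

lemma q_surj:
  assumes "A \<in> Ob" "B \<in> Ob" "\<psi> \<in> rep_hom (P A) (P B)"
  obtains \<phi> where "\<phi> \<in> rep_hom A B" "q A \<phi> B = \<psi>"
proof -
  have "\<psi> \<in> (\<lambda>\<phi>. q A \<phi> B) ` rep_hom A B"
    using q_bij[OF assms(1,2)] assms(3) by (simp add: bij_betw_def)
  then show ?thesis by (elim imageE) (rule that, simp_all)
qed

lemma q_inj: "A \<in> Ob \<Longrightarrow> B \<in> Ob \<Longrightarrow> \<phi> \<in> rep_hom A B \<Longrightarrow> \<psi> \<in> rep_hom A B \<Longrightarrow> q A \<phi> B = q A \<psi> B \<Longrightarrow> \<phi> = \<psi>"
  using q_bij[of A B] by (auto simp: bij_betw_def inj_on_def)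

text \<open>Here \<open>u\<close> and \<open>u'\<close> stand for the projections to one of the two sorts; the elements of that
  sort are the morphisms from a free algebra with one generator \<open>g\<close>.\<close>

lemma natural_bij:
  fixes U :: "('k, 'x, 'y) free_alg \<Rightarrow> 'c set" and U' :: "('k, 'x, 'y) free_alg \<Rightarrow> 'd set"
  assumes G: "G \<in> Ob"
    and e: "\<And>A. A \<in> Ob \<Longrightarrow> bij_betw (\<lambda>\<phi>. u \<phi> g) (rep_hom G A) (U A)"
    and e': "\<And>A. A \<in> Ob \<Longrightarrow> bij_betw (\<lambda>\<phi>. u' \<phi> g') (rep_hom (P G) A) (U' A)"
    and u: "\<And>\<phi> \<psi>. u (hcomp G \<psi> \<phi>) g = u \<psi> (u \<phi> g)"
    and u': "\<And>\<phi> \<psi>. u' (hcomp (P G) \<psi> \<phi>) g' = u' \<psi> (u' \<phi> g')"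
  obtains s where "\<And>A. A \<in> Ob \<Longrightarrow> bij_betw (s A) (U A) (U' (P A))"
    "\<And>A B \<phi> a. A \<in> Ob \<Longrightarrow> B \<in> Ob \<Longrightarrow> \<phi> \<in> rep_hom A B \<Longrightarrow> a \<in> U A \<Longrightarrow>
      s B (u \<phi> a) = u' (q A \<phi> B) (s A a)"
proof -
  \<comment> \<open>\<open>i A a\<close> is the morphism from \<open>G\<close> with value
    \<open>a\<close> at the generator; \<open>s\<close> applies the functor to it and evaluates the
    result at the generator \<open>g'\<close> of \<open>P G\<close>.\<close>
  define i where "i A = inv_into (rep_hom G A) (\<lambda>\<phi>. u \<phi> g)" for A
  define s where "s A = (\<lambda>a. u' (q G (i A a) A) g')" for A
  have i: "i A a \<in> rep_hom G A" "u (i A a) g = a" if "A \<in> Ob" "a \<in> U A" for A a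
    using e[OF that(1)] that(2) bij_betw_inv_into_right[OF e[OF that(1)]] bij_betwE[OF
        bij_betw_inv_into[OF e[OF that(1)]]]
    by (simp_all add: i_def)
  have bij: "bij_betw (s A) (U A) (U' (P A))" if A: "A \<in> Ob" for A
  proof -
    have "bij_betw (i A) (U A) (rep_hom G A)"
      unfolding i_def by (rule bij_betw_inv_into[OF e[OF A]])
    from bij_betw_trans[OF bij_betw_trans[OF this q_bij[OF G A]] e'[OF P_closed[OF A]]]
    show ?thesis
      by (simp add: s_def comp_def)
  qed
  have "s B (u \<phi> a) = u' (q A \<phi> B) (s A a)"
    if AB: "A \<in> Ob" "B \<in> Ob" and \<phi>: "\<phi> \<in> rep_hom A B" and a: "a \<in> U A" for A B \<phi> a
  proof -
    note ia = i[OF AB(1) a]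
    have h: "hcomp G \<phi> (i A a) \<in> rep_hom G B"
      by (rule hcomp_hom[OF objs_closed[OF G] ia(1) \<phi>])
    have v: "u (hcomp G \<phi> (i A a)) g = u \<phi> a"
      by (simp add: u ia)
    have uB: "u \<phi> a \<in> U B"
      using bij_betwE[OF e[OF AB(2)]] h v by force
    \<comment> \<open>Both morphisms from \<open>G\<close> have the value \<open>u \<phi> a\<close>
      at the generator, so they coincide. Functoriality turns this equation into naturality.\<close>
    have "i B (u \<phi> a) = hcomp G \<phi> (i A a)"
      by (rule inj_onD[OF bij_betw_imp_inj_on[OF e[OF AB(2)]]]) (simp_all add: i[OF AB(2) uB] h v)
    then show ?thesis
      by (simp add: s_def q_comp[OF G AB ia(1) \<phi>] u')
  qed
  with bij that show ?thesis by auto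
qed

end

lemma hcomp_free_apply:
  "fst (hcomp (free_rep {x} Y) \<psi> \<phi>) (lgen {x} Y x) = fst \<psi> (fst \<phi> (lgen {x} Y x))"
  "snd (hcomp (free_rep X {y}) \<psi> \<phi>) (mgen X {y} y) = snd \<psi> (snd \<phi> (mgen X {y} y))"
  by (simp_all add: hcomp_apply lgen_closed mgen_closed)

section \<open>Recognizing the free algebras with one generator\<close>

definition comm_end :: "('k, 'a, 'b) rep_alg \<Rightarrow> bool" where
  "comm_end A \<longleftrightarrow> (\<forall>\<phi>\<in>rep_hom A A. \<forall>\<psi>\<in>rep_hom A A. hcomp A \<phi> \<psi> = hcomp A \<psi> \<phi>) \<and>
     (\<exists>\<phi>\<in>rep_hom A A. \<phi> \<noteq> hid A)"

lemma comm_endD: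
  assumes "comm_end A" "\<phi> \<in> rep_hom A A" "\<psi> \<in> rep_hom A A"
  shows "x \<in> lcar A \<Longrightarrow> fst \<phi> (fst \<psi> x) = fst \<psi> (fst \<phi> x)"
    and "v \<in> mcar A \<Longrightarrow> snd \<phi> (snd \<psi> v) = snd \<psi> (snd \<phi> v)"
proof -
  have *: "hcomp A \<phi> \<psi> = hcomp A \<psi> \<phi>"
    using assms by (simp add: comm_end_def)
  show "x \<in> lcar A \<Longrightarrow> fst \<phi> (fst \<psi> x) = fst \<psi> (fst \<phi> x)"
    using hcomp_apply(1)[of x A \<phi> \<psi>] hcomp_apply(1)[of x A \<psi> \<phi>] * by simp
  show "v \<in> mcar A \<Longrightarrow> snd \<phi> (snd \<psi> v) = snd \<psi> (snd \<phi> v)"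
    using hcomp_apply(2)[of v A \<phi> \<psi>] hcomp_apply(2)[of v A \<psi> \<phi>] * by simp
qed

lemma comm_end_free_one_l: "comm_end (free_rep {x} {} :: ('k::field, 'x, 'y) free_alg)"
proof -
  let ?F = "free_rep {x} {} :: ('k, 'x, 'y) free_alg" and ?x = "lgen {x} ({} :: 'y set) x :: ('k,
      'x) lterm set"
  interpret F: lie_rep ?F by (rule lie_rep_free)
  have x: "?x \<in> lcar ?F" by (simp add: lgen_closed)
  have "hcomp ?F \<phi> \<psi> = hcomp ?F \<psi> \<phi>" if \<phi>: "\<phi> \<in> rep_hom ?F ?F" and \<psi>: "\<psi> \<in> rep_hom ?F ?F" for \<phi> \<psi>
  proof (rule free_rep_hom_unique)
    show "hcomp ?F \<phi> \<psi> \<in> rep_hom ?F ?F" "hcomp ?F \<psi> \<phi> \<in> rep_hom ?F ?F"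
      by (rule hcomp_hom[OF F.closed \<psi> \<phi>], rule hcomp_hom[OF F.closed \<phi> \<psi>])
    fix z assume "z \<in> {x}"
    moreover obtain c where "fst \<phi> ?x = lscale ?F c ?x"
      by (rule free_one_lgen[OF hom_lclosed[OF \<phi> x]])
    moreover obtain d where "fst \<psi> ?x = lscale ?F d ?x"
      by (rule free_one_lgen[OF hom_lclosed[OF \<psi> x]])
    ultimately show "fst (hcomp ?F \<phi> \<psi>) (lgen {x} ({} :: 'y set) z) = fst (hcomp ?F \<psi> \<phi>) (lgen {x}
        ({} :: 'y set) z)"
      by (simp add: hcomp_apply x hom_lscale[OF \<phi>] hom_lscale[OF \<psi>] F.lie.scale_scale mult.commute)
  qed simp
  moreover have "\<exists>\<phi>\<in>rep_hom ?F ?F. \<phi> \<noteq> hid ?F"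
  proof (rule free_rep_hom[OF F.lie_rep_axioms, of "{x}" "\<lambda>_. lzero ?F" "{}" "\<lambda>_. mzero ?F"])
    fix \<phi> assume \<phi>: "\<phi> \<in> rep_hom ?F ?F" "\<And>z. z \<in> {x} \<Longrightarrow> fst \<phi> (lgen {x} ({} :: 'y set) z) = lzero ?F"
    have "fst (hid ?F) ?x \<noteq> lzero ?F"
      unfolding hid_apply(1)[OF x] by (rule lgen_nonzero) simp
    then have "\<phi> \<noteq> hid ?F"
      using \<phi>(2)[of x] by (intro notI) simp
    with \<phi>(1) show ?thesis by (rule bexI[rotated])
  qed (simp_all add: F.lie.zero_closed)
  ultimately show ?thesis
    by (simp add: comm_end_def)
qed

lemma free_one_mgen:
  assumes "t \<in> mcar (free_rep {} {y})"
  obtains c where "t = mscale (free_rep {} {y}) c (mgen {} {y} y)"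
proof -
  interpret F: lie_rep "free_rep {} {y}" by (rule lie_rep_free)
  have "t \<in> F.md.span {mgen {} {y} y}"
    using free_no_lgen_mspan[OF assms] by simp
  then show ?thesis
    by (rule F.md.span_singleton) (simp add: mgen_closed, rule that)
qed

lemma comm_end_free_one_m: "comm_end (free_rep {} {y} :: ('k::field, 'x, 'y) free_alg)"
proof -
  let ?F = "free_rep {} {y} :: ('k, 'x, 'y) free_alg" and ?y = "mgen ({} :: 'x set) {y} y :: ('k,
      'x, 'y) mterm set"
  interpret F: lie_rep ?F by (rule lie_rep_free)
  have y: "?y \<in> mcar ?F" by (simp add: mgen_closed)
  have "hcomp ?F \<phi> \<psi> = hcomp ?F \<psi> \<phi>" if \<phi>: "\<phi> \<in> rep_hom ?F ?F" and \<psi>: "\<psi> \<in> rep_hom ?F ?F" for \<phi> \<psi>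
  proof (rule free_rep_hom_unique)
    show "hcomp ?F \<phi> \<psi> \<in> rep_hom ?F ?F" "hcomp ?F \<psi> \<phi> \<in> rep_hom ?F ?F"
      by (rule hcomp_hom[OF F.closed \<psi> \<phi>], rule hcomp_hom[OF F.closed \<phi> \<psi>])
    fix z assume "z \<in> {y}"
    moreover obtain c where "snd \<phi> ?y = mscale ?F c ?y"
      by (rule free_one_mgen[OF hom_mclosed[OF \<phi> y]])
    moreover obtain d where "snd \<psi> ?y = mscale ?F d ?y"
      by (rule free_one_mgen[OF hom_mclosed[OF \<psi> y]])
    ultimately show "snd (hcomp ?F \<phi> \<psi>) (mgen ({} :: 'x set) {y} z) = snd (hcomp ?F \<psi> \<phi>) (mgen ({}
        :: 'x set) {y} z)"
      by (simp add: hcomp_apply y hom_mscale[OF \<phi>] hom_mscale[OF \<psi>] F.md.scale_scale mult.commute)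
  qed simp
  moreover have "\<exists>\<phi>\<in>rep_hom ?F ?F. \<phi> \<noteq> hid ?F"
  proof (rule free_rep_hom[OF F.lie_rep_axioms, of "{}" "\<lambda>_. lzero ?F" "{y}" "\<lambda>_. mzero ?F"])
    fix \<phi> assume \<phi>: "\<phi> \<in> rep_hom ?F ?F" "\<And>z. z \<in> {y} \<Longrightarrow> snd \<phi> (mgen ({} :: 'x set) {y} z) = mzero ?F"
    have "snd (hid ?F) ?y \<noteq> mzero ?F"
      unfolding hid_apply(2)[OF y] by (rule mgen_nonzero) simp
    then have "\<phi> \<noteq> hid ?F"
      using \<phi>(2)[of y] by (intro notI) simp
    with \<phi>(1) show ?thesis by (rule bexI[rotated])
  qed (simp_all add: F.md.zero_closed)
  ultimately show ?thesis
    by (simp add: comm_end_def)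
qed

text \<open>Every other configuration has two endomorphisms that do not commute, or none but the
  identity. For two generators of one sort, let each map send one of the two to the other and all
  remaining generators to zero. For \<open>x\<close> and \<open>y\<close> of different sorts,
  compare the map that fixes the module generators and kills \<open>X\<close> with one sending
  \<open>y\<close> to its image under the action of \<open>x\<close>.\<close>

lemma comm_end_free:
  fixes X :: "'x set" and Y :: "'y set"
  assumes c: "comm_end (free_rep X Y :: ('k::field, 'x, 'y) free_alg)"
  shows "(\<exists>x. X = {x} \<and> Y = {}) \<or> (\<exists>y. X = {} \<and> Y = {y})"
proof -
  let ?F = "free_rep X Y :: ('k, 'x, 'y) free_alg"
  interpret F: lie_rep ?F by (rule lie_rep_free)
  let ?l = "lgen X Y :: 'x \<Rightarrow> ('k, 'x) lterm set" and ?m = "mgen X Y :: 'y \<Rightarrow> ('k, 'x, 'y) mterm set"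
  have ext: "\<exists>\<phi>\<in>rep_hom ?F ?F. (\<forall>x\<in>X. fst \<phi> (?l x) = a x) \<and> (\<forall>y\<in>Y. snd \<phi> (?m y) = b y)"
    if "\<And>x. x \<in> X \<Longrightarrow> a x \<in> lcar ?F" "\<And>y. y \<in> Y \<Longrightarrow> b y \<in> mcar ?F" for a b
  proof (rule free_rep_hom[OF F.lie_rep_axioms, of X a Y b])
    fix \<phi> assume "\<phi> \<in> rep_hom ?F ?F" "\<And>x. x \<in> X \<Longrightarrow> fst \<phi> (?l x) = a x"
      "\<And>y. y \<in> Y \<Longrightarrow> snd \<phi> (?m y) = b y"
    then show ?thesis by (intro bexI[of _ \<phi>]) simp_all
  qed (fact that)+
  have l: "x = x'" if x: "x \<in> X" "x' \<in> X" for x x'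
  proof (rule ccontr)
    assume "x \<noteq> x'"
    have "\<exists>\<phi>\<in>rep_hom ?F ?F. (\<forall>p\<in>X. fst \<phi> (?l p) = (\<lambda>z. if z = x then ?l x' else lzero ?F) p) \<and>
        (\<forall>p\<in>Y. snd \<phi> (?m p) = (\<lambda>_. mzero ?F) p)"
      by (rule ext) (use x in \<open>auto simp: lgen_closed mgen_closed F.lie.zero_closed F.md.zero_closed
          F.act_closed\<close>)
    then obtain \<phi> where \<phi>: "\<phi> \<in> rep_hom ?F ?F" "\<forall>z\<in>X. fst \<phi> (?l z) = (if z = x then ?l x' else lzero
        ?F)"
      by (elim bexE conjE) (rule that, simp_all)
    have "\<exists>\<phi>\<in>rep_hom ?F ?F. (\<forall>p\<in>X. fst \<phi> (?l p) = (\<lambda>z. if z = x' then ?l x else lzero ?F) p) \<and>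
        (\<forall>p\<in>Y. snd \<phi> (?m p) = (\<lambda>_. mzero ?F) p)"
      by (rule ext) (use x in \<open>auto simp: lgen_closed mgen_closed F.lie.zero_closed F.md.zero_closed
          F.act_closed\<close>)
    then obtain \<psi> where \<psi>: "\<psi> \<in> rep_hom ?F ?F" "\<forall>z\<in>X. fst \<psi> (?l z) = (if z = x' then ?l x else lzero
        ?F)"
      by (elim bexE conjE) (rule that, simp_all)
    have "fst \<phi> (fst \<psi> (?l x')) = fst \<psi> (fst \<phi> (?l x'))"
      by (rule comm_endD[OF c \<phi>(1) \<psi>(1)]) (simp add: x lgen_closed)
    then have "?l x' = lzero ?F"
      using x \<open>x \<noteq> x'\<close> by (simp add: \<phi>(2) \<psi>(2) hom_lzero[OF \<psi>(1)])
    then show False by (simp add: lgen_nonzero[OF x(2), of Y])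
  qed
  have m: "y = y'" if y: "y \<in> Y" "y' \<in> Y" for y y'
  proof (rule ccontr)
    assume "y \<noteq> y'"
    have "\<exists>\<phi>\<in>rep_hom ?F ?F. (\<forall>p\<in>X. fst \<phi> (?l p) = (\<lambda>_. lzero ?F) p) \<and> (\<forall>p\<in>Y. snd \<phi> (?m p) = (\<lambda>z. if
        z = y then ?m y' else mzero ?F) p)"
      by (rule ext) (use y in \<open>auto simp: lgen_closed mgen_closed F.lie.zero_closed F.md.zero_closed
          F.act_closed\<close>)
    then obtain \<phi> where \<phi>: "\<phi> \<in> rep_hom ?F ?F" "\<forall>z\<in>Y. snd \<phi> (?m z) = (if z = y then ?m y' else mzero
        ?F)"
      by (elim bexE conjE) (rule that, simp_all)
    have "\<exists>\<phi>\<in>rep_hom ?F ?F. (\<forall>p\<in>X. fst \<phi> (?l p) = (\<lambda>_. lzero ?F) p) \<and> (\<forall>p\<in>Y. snd \<phi> (?m p) = (\<lambda>z. if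
        z = y' then ?m y else mzero ?F) p)"
      by (rule ext) (use y in \<open>auto simp: lgen_closed mgen_closed F.lie.zero_closed F.md.zero_closed
          F.act_closed\<close>)
    then obtain \<psi> where \<psi>: "\<psi> \<in> rep_hom ?F ?F" "\<forall>z\<in>Y. snd \<psi> (?m z) = (if z = y' then ?m y else mzero
        ?F)"
      by (elim bexE conjE) (rule that, simp_all)
    have "snd \<phi> (snd \<psi> (?m y')) = snd \<psi> (snd \<phi> (?m y'))"
      by (rule comm_endD[OF c \<phi>(1) \<psi>(1)]) (simp add: y mgen_closed)
    then have "?m y' = mzero ?F"
      using y \<open>y \<noteq> y'\<close> by (simp add: \<phi>(2) \<psi>(2) hom_mzero[OF \<psi>(1)])
    then show False by (simp add: mgen_nonzero[OF y(2), of X])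
  qed
  have lm: False if xy: "x \<in> X" "y \<in> Y" for x y
  proof -
    have "\<exists>\<phi>\<in>rep_hom ?F ?F. (\<forall>p\<in>X. fst \<phi> (?l p) = (\<lambda>_. lzero ?F) p) \<and> (\<forall>p\<in>Y. snd \<phi> (?m p) = (?m) p)"
      by (rule ext) (use TrueI in \<open>auto simp: lgen_closed mgen_closed F.lie.zero_closed
          F.md.zero_closed F.act_closed\<close>)
    then obtain \<phi> where \<phi>: "\<phi> \<in> rep_hom ?F ?F" "\<forall>z\<in>X. fst \<phi> (?l z) = lzero ?F" "\<forall>z\<in>Y. snd \<phi> (?m z) =
        ?m z"
      by (elim bexE conjE) (rule that, simp_all)
    have "\<exists>\<phi>\<in>rep_hom ?F ?F. (\<forall>p\<in>X. fst \<phi> (?l p) = (\<lambda>_. lzero ?F) p) \<and> (\<forall>p\<in>Y. snd \<phi> (?m p) = (\<lambda>z. act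
        ?F (?l x) (?m z)) p)"
      by (rule ext) (use xy in \<open>auto simp: lgen_closed mgen_closed F.lie.zero_closed
          F.md.zero_closed F.act_closed\<close>)
    then obtain \<psi> where \<psi>: "\<psi> \<in> rep_hom ?F ?F" "\<forall>z\<in>Y. snd \<psi> (?m z) = act ?F (?l x) (?m z)"
      by (elim bexE conjE) (rule that, simp_all)
    have "snd \<phi> (snd \<psi> (?m y)) = snd \<psi> (snd \<phi> (?m y))"
      by (rule comm_endD[OF c \<phi>(1) \<psi>(1)]) (simp add: xy mgen_closed)
    then have "act ?F (?l x) (?m y) = mzero ?F"
      using xy by (simp add: \<phi> \<psi>(2) hom_act[OF \<phi>(1)] lgen_closed mgen_closed F.act_zero)
    then show False by (simp add: act_gen_nonzero[OF xy])
  qed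
  have "X \<noteq> {} \<or> Y \<noteq> {}"
  proof (rule ccontr)
    assume "\<not> ?thesis"
    then have "\<phi> = hid ?F" if "\<phi> \<in> rep_hom ?F ?F" for \<phi>
      using free_rep_hom_unique[OF that hid_hom[OF F.closed]] by simp
    then show False using c by (auto simp: comm_end_def)
  qed
  then show ?thesis
  proof
    assume "X \<noteq> {}"
    then obtain x where "x \<in> X" by auto
    then have "X = {x}" "Y = {}" using l lm by auto
    then show ?thesis by simp
  next
    assume "Y \<noteq> {}"
    then obtain y where "y \<in> Y" by auto
    then have "X = {}" "Y = {y}" using m lm by auto
    then show ?thesis by simp
  qed
qed

lemma zero_hom:
  assumes "rep_closed H" "lie_rep G"
  shows "(\<lambda>x\<in>lcar H. lzero G, \<lambda>v\<in>mcar H. mzero G) \<in> rep_hom H G"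
proof -
  interpret G: lie_rep G by fact
  show ?thesis
    using assms(1) unfolding rep_closed_def rep_hom_def
    by (simp add: G.lie.zero_closed G.md.zero_closed G.lie.neg_eq_scale G.md.neg_eq_scale
        G.lie.scale_zero_right G.md.scale_zero_right G.lie.add_zero G.md.add_zero G.lie.br_zero
            G.act_zero)
qed

lemma infinite_two:
  assumes "infinite S" obtains a b where "a \<in> S" "b \<in> S" "a \<noteq> b"
proof -
  obtain a where a: "a \<in> S" using infinite_imp_nonempty[OF assms] by auto
  obtain b where "b \<in> S - {a}" using infinite_imp_nonempty[of "S - {a}"] assms by auto
  with a show ?thesis by (intro that[of a b]) auto
qed

context free_functor
begin

lemma comm_end_P:
  assumes A: "A \<in> Ob" and c: "comm_end A"
  shows "comm_end (P A)"
proof -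
  have "hcomp (P A) \<phi>' \<psi>' = hcomp (P A) \<psi>' \<phi>'"
    if *: "\<phi>' \<in> rep_hom (P A) (P A)" "\<psi>' \<in> rep_hom (P A) (P A)" for \<phi>' \<psi>'
  proof -
    obtain \<phi> where \<phi>: "\<phi> \<in> rep_hom A A" "q A \<phi> A = \<phi>'" by (rule q_surj[OF A A *(1)])
    obtain \<psi> where \<psi>: "\<psi> \<in> rep_hom A A" "q A \<psi> A = \<psi>'" by (rule q_surj[OF A A *(2)])
    have "hcomp A \<phi> \<psi> = hcomp A \<psi> \<phi>"
      using c \<phi> \<psi> by (simp add: comm_end_def)
    then show ?thesis
      using q_comp[OF A A A \<phi>(1) \<psi>(1)] q_comp[OF A A A \<psi>(1) \<phi>(1)] by (simp add: \<phi>(2) \<psi>(2))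
  qed
  moreover obtain \<phi> where \<phi>: "\<phi> \<in> rep_hom A A" "\<phi> \<noteq> hid A"
    using c unfolding comm_end_def by (elim conjE bexE)
  have "q A \<phi> A \<noteq> hid (P A)"
    using q_inj[OF A A \<phi>(1) hid_hom[OF objs_closed[OF A]]] \<phi>(2) q_id[OF A] by metis
  then have "\<exists>\<phi>\<in>rep_hom (P A) (P A). \<phi> \<noteq> hid (P A)"
    using q_closed[OF A A \<phi>(1)] by (rule bexI)
  ultimately show ?thesis
    by (simp add: comm_end_def)
qed

text \<open>If \<open>P\<close> exchanged the sorts of the free generators, the bracket of two free generators
  would become a linear combination of two free module generators that vanishes whenever one of
  them is sent to zero.\<close>

lemma not_exchanged:
  assumes x: "x \<in> X0" and y: "y \<in> Y0"
  shows "P (free_rep {x} {}) \<noteq> free_rep {} {y}"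
proof
  assume P: "P (free_rep {x} {}) = free_rep {} {y}"
  have G: "free_rep {x} {} \<in> Ob" using x by (intro objsI) auto
  have e: "bij_betw (\<lambda>\<phi>. fst \<phi> (lgen {x} ({} :: 'y set) x)) (rep_hom (free_rep {x} ({} :: 'y set))
      A) (lcar A)"
    if "A \<in> Ob" for A
    by (rule free_one_l_bij[OF objs_lie_rep[OF that]])
  have e': "bij_betw (\<lambda>\<phi>. snd \<phi> (mgen ({} :: 'x set) {y} y)) (rep_hom (P (free_rep {x} {})) A) (mcar
      A)"
    if "A \<in> Ob" for A
    unfolding P by (rule free_one_m_bij[OF objs_lie_rep[OF that]])
  have u': "snd (hcomp (P (free_rep {x} {})) \<psi> \<phi>) (mgen ({} :: 'x set) {y} y) = snd \<psi> (snd \<phi> (mgen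
      ({} :: 'x set) {y} y))"
    for \<phi> \<psi> :: "('k, 'x, 'y) hom_pair"
    unfolding P by (rule hcomp_free_apply)
  \<comment> \<open>Under the supposed exchange \<open>natural_bij\<close> links different sorts:
    the Lie points of \<open>A\<close> with the module points of \<open>P A\<close>.\<close>
  obtain t where t_bij: "\<And>A. A \<in> Ob \<Longrightarrow> bij_betw (t A) (lcar A) (mcar (P A))"
    and t_nat: "\<And>A B \<phi> a. A \<in> Ob \<Longrightarrow> B \<in> Ob \<Longrightarrow> \<phi> \<in> rep_hom A B \<Longrightarrow> a \<in> lcar A \<Longrightarrow>
      t B (fst \<phi> a) = snd (q A \<phi> B) (t A a)"
    by (rule natural_bij[OF G e e' hcomp_free_apply(1) u']) (assumption | rule that)+
  obtain x1 x2 where X: "x1 \<in> X0" "x2 \<in> X0" "x1 \<noteq> x2" by (rule infinite_two[OF inf(1)])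
  obtain y1 y2 where Y: "y1 \<in> Y0" "y2 \<in> Y0" "y1 \<noteq> y2" by (rule infinite_two[OF inf(2)])
  define C where "C = (free_rep {x1, x2} {} :: ('k, 'x, 'y) free_alg)"
  define E where "E = (free_rep {} {y1, y2} :: ('k, 'x, 'y) free_alg)"
  define a where "a = (lgen {x1, x2} ({} :: 'y set) x1 :: ('k, 'x) lterm set)"
  define b where "b = (lgen {x1, x2} ({} :: 'y set) x2 :: ('k, 'x) lterm set)"
  define v where "v = (mgen ({} :: 'x set) {y1, y2} y1 :: ('k, 'x, 'y) mterm set)"
  define w where "w = (mgen ({} :: 'x set) {y1, y2} y2 :: ('k, 'x, 'y) mterm set)"
  have C: "C \<in> Ob" and E: "E \<in> Ob"
    unfolding C_def E_def using X Y by (auto intro!: objsI)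
  interpret C: lie_rep C by (rule objs_lie_rep[OF C])
  interpret PC: lie_rep "P C" by (rule objs_lie_rep[OF P_closed[OF C]])
  interpret E: lie_rep E by (rule objs_lie_rep[OF E])
  have ab: "a \<in> lcar C" "b \<in> lcar C"
    by (simp_all add: a_def b_def C_def lgen_closed)
  have vw: "v \<in> mcar E" "w \<in> mcar E"
    by (simp_all add: v_def w_def E_def mgen_closed)
  have ta: "t C a \<in> mcar (P C)" and tb: "t C b \<in> mcar (P C)"
    using bij_betwE[OF t_bij[OF C]] ab by auto
  have t_inj: "c = d" if "t C c = t C d" "c \<in> lcar C" "d \<in> lcar C" for c d
    using bij_betw_imp_inj_on[OF t_bij[OF C]] that by (rule inj_onD)
  \<comment> \<open>The aim is that \<open>P C\<close> is a retract of \<open>E\<close>. The functor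
    carries \<mu> to a map from \<open>P C\<close> to \<open>E\<close> that takes the images of
    \<open>a\<close> and \<open>b\<close> to \<open>v\<close> and \<open>w\<close>, and \<kappa>
    takes these back. The composite comes from an endomorphism of \<open>C\<close> fixing both
    generators, so it is the identity.\<close>
  obtain D where D: "D \<in> Ob" "P D = E" by (rule P_surj[OF E])
  have "v \<in> t D ` lcar D" "w \<in> t D ` lcar D"
    using t_bij[OF D(1)] vw by (simp_all add: D(2) bij_betw_def)
  then obtain a' b' where a': "a' \<in> lcar D" "t D a' = v" and b': "b' \<in> lcar D" "t D b' = w"
    by auto
  obtain \<mu> where \<mu>: "\<mu> \<in> rep_hom C D" "fst \<mu> a = a'" "fst \<mu> b = b'"
    unfolding C_def a_def b_def by (rule free_hom_two_l[OF objs_lie_rep[OF D(1)] a'(1) b'(1) X(3)])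
  obtain \<kappa> where \<kappa>: "\<kappa> \<in> rep_hom E (P C)" "snd \<kappa> v = t C a" "snd \<kappa> w = t C b"
    unfolding E_def v_def w_def by (rule free_hom_two_m[OF PC.lie_rep_axioms ta tb Y(3)])
  have q\<mu>: "q C \<mu> D \<in> rep_hom (P C) E"
    using q_closed[OF C D(1) \<mu>(1)] by (simp add: D(2))
  have "hcomp (P C) \<kappa> (q C \<mu> D) \<in> rep_hom (P C) (P C)"
    by (rule hcomp_hom[OF PC.closed q\<mu> \<kappa>(1)])
  then obtain \<nu> where \<nu>: "\<nu> \<in> rep_hom C C" "q C \<nu> C = hcomp (P C) \<kappa> (q C \<mu> D)"
    by (rule q_surj[OF C C])
  have "snd (q C \<mu> D) (t C a) = v" "snd (q C \<mu> D) (t C b) = w"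
    by (simp_all add: t_nat[OF C D(1) \<mu>(1), symmetric] ab \<mu> a' b')
  then have "t C (fst \<nu> a) = t C a" "t C (fst \<nu> b) = t C b"
    by (simp_all add: t_nat[OF C C \<nu>(1)] ab \<nu>(2) hcomp_apply ta tb \<kappa>)
  then have "fst \<nu> a = a" "fst \<nu> b = b"
    using t_inj[of "fst \<nu> a" a] t_inj[of "fst \<nu> b" b] ab hom_lclosed[OF \<nu>(1)] by simp_all
  then have "\<nu> = hid C"
    using \<nu>(1) ab hid_hom[OF C.closed] unfolding C_def a_def b_def
    by (intro free_rep_hom_unique[of \<nu>]) (auto simp: hid_apply)
  then have \<kappa>\<mu>: "snd \<kappa> (snd (q C \<mu> D) z) = z" if "z \<in> mcar (P C)" for z
    using hcomp_apply(2)[OF that, of \<kappa> "q C \<mu> D"] unfolding \<nu>(2)[symmetric] \<open>\<nu> = hid C\<close> q_id[OF C]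
    by (simp add: hid_apply that)
  define z where "z = t C (lbr C a b)"
  have br: "lbr C a b \<in> lcar C" by (simp add: ab C.lie.br_closed)
  have z: "z \<in> mcar (P C)"
    using bij_betwE[OF t_bij[OF C]] br by (simp add: z_def)
  have "snd (q C \<mu> D) z \<in> E.md.span {v, w}"
    using free_no_lgen_mspan[of "snd (q C \<mu> D) z" "{y1, y2}"] hom_mclosed[OF q\<mu> z]
    by (simp add: E_def v_def w_def)
  then obtain c d where "snd (q C \<mu> D) z = madd E (mscale E c v) (mscale E d w)"
    by (rule E.md.span_pair[OF _ vw])
  then have zcd: "z = madd (P C) (mscale (P C) c (t C a)) (mscale (P C) d (t C b))"
    using \<kappa>\<mu>[OF z] by (simp add: hom_simps[OF \<kappa>(1)] vw E.md.scale_closed \<kappa>(2,3))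
  \<comment> \<open>The constant zero endomorphism of \<open>P C\<close> is the image of some
    \<zeta>. Since \<zeta> fixes zero, naturality shows that the image of zero is fixed by the
    constant zero map.\<close>
  have t0: "t C (lzero C) = mzero (P C)"
  proof -
    have t0c: "t C (lzero C) \<in> mcar (P C)"
      using bij_betwE[OF t_bij[OF C]] C.lie.zero_closed by simp
    obtain \<zeta> where \<zeta>: "\<zeta> \<in> rep_hom C C"
      "q C \<zeta> C = (\<lambda>x\<in>lcar (P C). lzero (P C), \<lambda>v\<in>mcar (P C). mzero (P C))"
      by (rule q_surj[OF C C zero_hom[OF PC.closed PC.lie_rep_axioms]])
    show ?thesis
      using t_nat[OF C C \<zeta>(1) C.lie.zero_closed] unfolding \<zeta>(2) hom_lzero[OF \<zeta>(1)] by (simp add: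
          t0c)
  qed
  \<comment> \<open>Each of the two projections kills the bracket and so annihilates
    \<open>z\<close>, while it keeps exactly one summand of the linear combination. Both summands
    therefore vanish, although \<open>z\<close> is the image of a nonzero bracket.\<close>
  obtain \<pi> where \<pi>: "\<pi> \<in> rep_hom C C" "fst \<pi> a = a" "fst \<pi> b = lzero C"
    unfolding C_def a_def b_def
    by (rule free_hom_two_l[OF C.lie_rep_axioms[unfolded C_def] ab(1)[unfolded C_def a_def]
        C.lie.zero_closed[unfolded C_def] X(3)])
  obtain \<rho> where \<rho>: "\<rho> \<in> rep_hom C C" "fst \<rho> a = lzero C" "fst \<rho> b = b"
    unfolding C_def a_def b_def
    by (rule free_hom_two_l[OF C.lie_rep_axioms[unfolded C_def] C.lie.zero_closed[unfolded C_def]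
        ab(2)[unfolded C_def b_def] X(3)])
  note q\<pi> = q_closed[OF C C \<pi>(1)] and q\<rho> = q_closed[OF C C \<rho>(1)]
  have "mzero (P C) = snd (q C \<pi> C) z"
    by (simp add: z_def t_nat[OF C C \<pi>(1) br, symmetric] hom_lbr[OF \<pi>(1)] ab \<pi>(2,3) C.lie.br_zero
        t0)
  also have "\<dots> = mscale (P C) c (t C a)"
    by (simp add: t_nat[OF C C \<pi>(1), symmetric] ab zcd hom_simps[OF q\<pi>] ta tb PC.md.scale_closed
        \<pi>(2,3) t0 PC.md.scale_zero_right PC.md.add_zero)
  finally have 1: "mscale (P C) c (t C a) = mzero (P C)" by simp
  have "mzero (P C) = snd (q C \<rho> C) z"
    by (simp add: z_def t_nat[OF C C \<rho>(1) br, symmetric] hom_lbr[OF \<rho>(1)] ab \<rho>(2,3) C.lie.br_zero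
        t0)
  also have "\<dots> = mscale (P C) d (t C b)"
    by (simp add: t_nat[OF C C \<rho>(1), symmetric] ab zcd hom_simps[OF q\<rho>] ta tb PC.md.scale_closed
        \<rho>(2,3) t0 PC.md.scale_zero_right PC.md.zero_add)
  finally have 2: "mscale (P C) d (t C b) = mzero (P C)" by simp
  have "z = t C (lzero C)"
    by (simp add: zcd 1 2 t0 PC.md.add_zero PC.md.zero_closed)
  then have "lbr C a b = lzero C"
    unfolding z_def by (rule t_inj) (simp_all add: br C.lie.zero_closed)
  moreover have "lbr C a b \<noteq> lzero C"
    unfolding C_def a_def b_def using X by (intro lbr_gen_nonzero) auto
  ultimately show False by simp
qed

lemma P_free_l:
  assumes x: "x \<in> X0"
  obtains x' where "x' \<in> X0" "P (free_rep {x} {}) = free_rep {x'} {}"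
proof -
  have G: "free_rep {x} {} \<in> Ob" using x by (intro objsI) auto
  obtain X Y where XY: "P (free_rep {x} {}) = free_rep X Y" "X \<subseteq> X0" "Y \<subseteq> Y0"
    by (rule objsE[OF P_closed[OF G]])
  have "comm_end (free_rep X Y :: ('k, 'x, 'y) free_alg)"
    using comm_end_P[OF G comm_end_free_one_l] XY(1) by simp
  from comm_end_free[OF this] consider x' where "X = {x'}" "Y = {}" | y' where "X = {}" "Y = {y'}"
    by auto
  then show ?thesis
  proof cases
    case 1
    then show ?thesis using XY by (intro that[of x']) auto
  next
    case 2
    then show ?thesis using XY not_exchanged[OF x, of y'] by simp
  qed
qed

text \<open>Here an exchange is refuted by counting morphisms. From a free algebra with one Lie
  generator there is only one morphism to the algebra with the single module generator
  \<open>y\<close>, whose Lie sort is zero. Were the latter carried to an algebra with one Lie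
  generator, its image would receive at least two, one hitting zero and one hitting the
  generator.\<close>

lemma P_free_m:
  assumes y: "y \<in> Y0"
  obtains y' where "y' \<in> Y0" "P (free_rep {} {y}) = free_rep {} {y'}"
proof -
  have G: "free_rep {} {y} \<in> Ob" using y by (intro objsI) auto
  obtain X Y where XY: "P (free_rep {} {y}) = free_rep X Y" "X \<subseteq> X0" "Y \<subseteq> Y0"
    by (rule objsE[OF P_closed[OF G]])
  have "comm_end (free_rep X Y :: ('k, 'x, 'y) free_alg)"
    using comm_end_P[OF G comm_end_free_one_m] XY(1) by simp
  from comm_end_free[OF this] consider x' where "X = {x'}" "Y = {}" | y' where "X = {}" "Y = {y'}"
    by auto
  then show ?thesis
  proof cases
    case 1
    obtain x where x: "x \<in> X0" using infinite_imp_nonempty[OF inf(1)] by auto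
    let ?A = "free_rep {x} {} :: ('k, 'x, 'y) free_alg" and ?B = "free_rep {} {y} :: ('k, 'x, 'y)
        free_alg"
    have A: "?A \<in> Ob" using x by (intro objsI) auto
    obtain x'' where x'': "x'' \<in> X0" "P ?A = free_rep {x''} {}" by (rule P_free_l[OF x])
    let ?A' = "free_rep {x''} {} :: ('k, 'x, 'y) free_alg" and ?B' = "free_rep {x'} {} :: ('k, 'x,
        'y) free_alg"
    have B': "P ?B = ?B'" using XY 1 by simp
    interpret B': lie_rep ?B' by (rule lie_rep_free)
    have eq: "\<psi>1 = \<psi>2" if \<psi>: "\<psi>1 \<in> rep_hom ?A' ?B'" "\<psi>2 \<in> rep_hom ?A' ?B'" for \<psi>1 \<psi>2
    proof -
      obtain \<phi>1 where 1: "\<phi>1 \<in> rep_hom ?A ?B" "q ?A \<phi>1 ?B = \<psi>1"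
        by (rule q_surj[OF A G]) (use \<psi> x'' B' in simp)
      obtain \<phi>2 where 2: "\<phi>2 \<in> rep_hom ?A ?B" "q ?A \<phi>2 ?B = \<psi>2"
        by (rule q_surj[OF A G]) (use \<psi> x'' B' in simp)
      have "fst \<phi> (lgen {x} ({} :: 'y set) x) = lzero ?B" if "\<phi> \<in> rep_hom ?A ?B" for \<phi>
        by (rule free_no_lgen[OF hom_lclosed[OF that]]) (simp add: lgen_closed)
      then have "\<phi>1 = \<phi>2"
        using 1 2 by (intro free_rep_hom_unique[OF 1(1) 2(1)]) auto
      then show ?thesis using 1 2 by simp
    qed
    have bij: "bij_betw (\<lambda>\<phi>. fst \<phi> (lgen {x''} ({} :: 'y set) x'')) (rep_hom ?A' ?B') (lcar ?B')"
      by (rule free_one_l_bij[OF lie_rep_free])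
    have "lgen {x'} ({} :: 'y set) x' \<in> lcar ?B'" "lzero ?B' \<in> lcar ?B'"
      by (simp_all add: lgen_closed B'.lie.zero_closed)
    then have "lgen {x'} ({} :: 'y set) x' = lzero ?B'"
      using eq unfolding bij_betw_imp_surj_on[OF bij, symmetric] by (elim imageE) metis
    moreover have "lgen {x'} ({} :: 'y set) x' \<noteq> lzero ?B'"
      by (rule lgen_nonzero) simp
    ultimately show ?thesis by simp
  next
    case 2
    then show ?thesis using XY by (intro that[of y']) auto
  qed
qed

lemma natural_bij_l:
  obtains s where "\<And>A. A \<in> Ob \<Longrightarrow> bij_betw (s A) (lcar A) (lcar (P A))"
    "\<And>A B \<phi> a. A \<in> Ob \<Longrightarrow> B \<in> Ob \<Longrightarrow> \<phi> \<in> rep_hom A B \<Longrightarrow> a \<in> lcar A \<Longrightarrow>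
      s B (fst \<phi> a) = fst (q A \<phi> B) (s A a)"
proof -
  obtain x where x: "x \<in> X0" using infinite_imp_nonempty[OF inf(1)] by auto
  obtain x' where x': "x' \<in> X0" "P (free_rep {x} {}) = free_rep {x'} {}" by (rule P_free_l[OF x])
  have G: "free_rep {x} {} \<in> Ob" using x by (intro objsI) auto
  have e: "bij_betw (\<lambda>\<phi>. fst \<phi> (lgen {x} ({} :: 'y set) x)) (rep_hom (free_rep {x} ({} :: 'y set))
      A) (lcar A)"
    if "A \<in> Ob" for A
    by (rule free_one_l_bij[OF objs_lie_rep[OF that]])
  have e': "bij_betw (\<lambda>\<phi>. fst \<phi> (lgen {x'} ({} :: 'y set) x')) (rep_hom (P (free_rep {x} {})) A)
      (lcar A)"
    if "A \<in> Ob" for A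
    unfolding x' by (rule free_one_l_bij[OF objs_lie_rep[OF that]])
  have u': "fst (hcomp (P (free_rep {x} {})) \<psi> \<phi>) (lgen {x'} ({} :: 'y set) x') = fst \<psi> (fst \<phi> (lgen
      {x'} ({} :: 'y set) x'))"
    for \<phi> \<psi> :: "('k, 'x, 'y) hom_pair"
    unfolding x' by (rule hcomp_free_apply)
  show ?thesis
    by (rule natural_bij[OF G e e' hcomp_free_apply(1) u']) (assumption | rule that)+
qed

lemma natural_bij_m:
  obtains s where "\<And>A. A \<in> Ob \<Longrightarrow> bij_betw (s A) (mcar A) (mcar (P A))"
    "\<And>A B \<phi> a. A \<in> Ob \<Longrightarrow> B \<in> Ob \<Longrightarrow> \<phi> \<in> rep_hom A B \<Longrightarrow> a \<in> mcar A \<Longrightarrow>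
      s B (snd \<phi> a) = snd (q A \<phi> B) (s A a)"
proof -
  obtain y where y: "y \<in> Y0" using infinite_imp_nonempty[OF inf(2)] by auto
  obtain y' where y': "y' \<in> Y0" "P (free_rep {} {y}) = free_rep {} {y'}" by (rule P_free_m[OF y])
  have G: "free_rep {} {y} \<in> Ob" using y by (intro objsI) auto
  have e: "bij_betw (\<lambda>\<phi>. snd \<phi> (mgen ({} :: 'x set) {y} y)) (rep_hom (free_rep ({} :: 'x set) {y})
      A) (mcar A)"
    if "A \<in> Ob" for A
    by (rule free_one_m_bij[OF objs_lie_rep[OF that]])
  have e': "bij_betw (\<lambda>\<phi>. snd \<phi> (mgen ({} :: 'x set) {y'} y')) (rep_hom (P (free_rep {} {y})) A)
      (mcar A)"
    if "A \<in> Ob" for A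
    unfolding y' by (rule free_one_m_bij[OF objs_lie_rep[OF that]])
  have u': "snd (hcomp (P (free_rep {} {y})) \<psi> \<phi>) (mgen ({} :: 'x set) {y'} y') = snd \<psi> (snd \<phi> (mgen
      ({} :: 'x set) {y'} y'))"
    for \<phi> \<psi> :: "('k, 'x, 'y) hom_pair"
    unfolding y' by (rule hcomp_free_apply)
  show ?thesis
    by (rule natural_bij[OF G e e' hcomp_free_apply(2) u']) (assumption | rule that)+
qed

end

section \<open>Transported operations\<close>

locale natural_points = free_functor X0 Y0 P q
  for X0 :: "'x set" and Y0 :: "'y set"
    and P :: "('k::field_char_0, 'x, 'y) free_alg \<Rightarrow> ('k, 'x, 'y) free_alg" and q +
  fixes sl :: "('k, 'x, 'y) free_alg \<Rightarrow> ('k, 'x) lterm set \<Rightarrow> ('k, 'x) lterm set"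
    and sm :: "('k, 'x, 'y) free_alg \<Rightarrow> ('k, 'x, 'y) mterm set \<Rightarrow> ('k, 'x, 'y) mterm set"
  assumes sl_bij: "A \<in> Ob \<Longrightarrow> bij_betw (sl A) (lcar A) (lcar (P A))"
    and sm_bij: "A \<in> Ob \<Longrightarrow> bij_betw (sm A) (mcar A) (mcar (P A))"
    and sl_nat: "A \<in> Ob \<Longrightarrow> B \<in> Ob \<Longrightarrow> \<phi> \<in> rep_hom A B \<Longrightarrow> a \<in> lcar A \<Longrightarrow>
      sl B (fst \<phi> a) = fst (q A \<phi> B) (sl A a)"
    and sm_nat: "A \<in> Ob \<Longrightarrow> B \<in> Ob \<Longrightarrow> \<phi> \<in> rep_hom A B \<Longrightarrow> v \<in> mcar A \<Longrightarrow>
      sm B (snd \<phi> v) = snd (q A \<phi> B) (sm A v)"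
begin

lemma sl_closed: "A \<in> Ob \<Longrightarrow> a \<in> lcar A \<Longrightarrow> sl A a \<in> lcar (P A)"
  and sm_closed: "A \<in> Ob \<Longrightarrow> v \<in> mcar A \<Longrightarrow> sm A v \<in> mcar (P A)"
  using bij_betwE[OF sl_bij] bij_betwE[OF sm_bij] by simp_all

lemma sl_inj: "A \<in> Ob \<Longrightarrow> sl A a = sl A b \<Longrightarrow> a \<in> lcar A \<Longrightarrow> b \<in> lcar A \<Longrightarrow> a = b"
  and sm_inj: "A \<in> Ob \<Longrightarrow> sm A v = sm A w \<Longrightarrow> v \<in> mcar A \<Longrightarrow> w \<in> mcar A \<Longrightarrow> v = w"
  by (rule inj_onD[OF bij_betw_imp_inj_on[OF sl_bij]], assumption+)
    (rule inj_onD[OF bij_betw_imp_inj_on[OF sm_bij]], assumption+)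

lemma sl_surj:
  assumes "A \<in> Ob" "c \<in> lcar (P A)" obtains a where "a \<in> lcar A" "sl A a = c"
proof -
  have "c \<in> sl A ` lcar A"
    using sl_bij[OF assms(1)] assms(2) by (simp add: bij_betw_def)
  then show ?thesis by (elim imageE) (rule that, simp_all)
qed

lemma sm_surj:
  assumes "A \<in> Ob" "c \<in> mcar (P A)" obtains a where "a \<in> mcar A" "sm A a = c"
proof -
  have "c \<in> sm A ` mcar A"
    using sm_bij[OF assms(1)] assms(2) by (simp add: bij_betw_def)
  then show ?thesis by (elim imageE) (rule that, simp_all)
qed

text \<open>The images of free generators are free generators of the image, so every operation given by
  an element of a free algebra is carried to an operation given by another such element.\<close>

lemma transport:
  assumes X: "finite X" "X \<subseteq> X0" and Y: "finite Y" "Y \<subseteq> Y0"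
  obtains \<theta> where "\<theta> \<in> rep_hom (P (free_rep X Y)) (free_rep X Y)"
    "\<And>A \<phi> \<psi> t. A \<in> Ob \<Longrightarrow> \<phi> \<in> rep_hom (free_rep X Y) A \<Longrightarrow> \<psi> \<in> rep_hom (free_rep X Y) (P A) \<Longrightarrow>
      \<forall>x\<in>X. fst \<psi> (lgen X Y x) = sl A (fst \<phi> (lgen X Y x)) \<Longrightarrow>
      \<forall>y\<in>Y. snd \<psi> (mgen X Y y) = sm A (snd \<phi> (mgen X Y y)) \<Longrightarrow>
      t \<in> lcar (free_rep X Y) \<Longrightarrow> sl A (fst \<phi> t) = fst \<psi> (fst \<theta> (sl (free_rep X Y) t))"
    "\<And>A \<phi> \<psi> t. A \<in> Ob \<Longrightarrow> \<phi> \<in> rep_hom (free_rep X Y) A \<Longrightarrow> \<psi> \<in> rep_hom (free_rep X Y) (P A) \<Longrightarrow>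
      \<forall>x\<in>X. fst \<psi> (lgen X Y x) = sl A (fst \<phi> (lgen X Y x)) \<Longrightarrow>
      \<forall>y\<in>Y. snd \<psi> (mgen X Y y) = sm A (snd \<phi> (mgen X Y y)) \<Longrightarrow>
      t \<in> mcar (free_rep X Y) \<Longrightarrow> sm A (snd \<phi> t) = snd \<psi> (snd \<theta> (sm (free_rep X Y) t))"
proof -
  define C where "C = (free_rep X Y :: ('k, 'x, 'y) free_alg)"
  let ?l = "lgen X Y :: 'x \<Rightarrow> ('k, 'x) lterm set" and ?m = "mgen X Y :: 'y \<Rightarrow> ('k, 'x, 'y) mterm set"
  have C: "C \<in> Ob" unfolding C_def by (intro objsI X Y)
  interpret C: lie_rep C by (rule objs_lie_rep[OF C])
  interpret PC: lie_rep "P C" by (rule objs_lie_rep[OF P_closed[OF C]])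
  have l: "?l x \<in> lcar C" if "x \<in> X" for x using that by (simp add: C_def lgen_closed)
  have m: "?m y \<in> mcar C" if "y \<in> Y" for y using that by (simp add: C_def mgen_closed)
  \<comment> \<open>Points of \<open>D\<close> that \<open>sl\<close> and \<open>sm\<close> send to
    the generators of \<open>C\<close> define a morphism \<mu> from \<open>C\<close> to
    \<open>D\<close>. Its image \<theta> takes the images of the generators of \<open>C\<close> back
    to the generators.\<close>
  obtain D where D: "D \<in> Ob" "P D = C" by (rule P_surj[OF C])
  have "\<forall>x\<in>X. \<exists>a. a \<in> lcar D \<and> sl D a = ?l x"
  proof
    fix x assume x: "x \<in> X"
    obtain a where "a \<in> lcar D" "sl D a = ?l x"
      by (rule sl_surj[OF D(1), of "?l x"]) (simp add: l x D(2))
    then show "\<exists>a. a \<in> lcar D \<and> sl D a = ?l x" by (intro exI conjI)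
  qed
  then obtain a where a: "\<forall>x\<in>X. a x \<in> lcar D \<and> sl D (a x) = ?l x"
    by (rule bchoice[THEN exE])
  have "\<forall>y\<in>Y. \<exists>b. b \<in> mcar D \<and> sm D b = ?m y"
  proof
    fix y assume y: "y \<in> Y"
    obtain b where "b \<in> mcar D" "sm D b = ?m y"
      by (rule sm_surj[OF D(1), of "?m y"]) (simp add: m y D(2))
    then show "\<exists>b. b \<in> mcar D \<and> sm D b = ?m y" by (intro exI conjI)
  qed
  then obtain b where b: "\<forall>y\<in>Y. b y \<in> mcar D \<and> sm D (b y) = ?m y"
    by (rule bchoice[THEN exE])
  obtain \<mu> where \<mu>: "\<mu> \<in> rep_hom C D" "\<And>x. x \<in> X \<Longrightarrow> fst \<mu> (?l x) = a x" "\<And>y. y \<in> Y \<Longrightarrow> snd \<mu> (?m y) = b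
      y"
    by (rule free_rep_hom[OF objs_lie_rep[OF D(1)], of X a Y b, folded C_def], simp add: a, simp
        add: b, rule that, assumption+)
  define \<theta> where "\<theta> = q C \<mu> D"
  have \<theta>: "\<theta> \<in> rep_hom (P C) C"
    unfolding \<theta>_def using q_closed[OF C D(1) \<mu>(1)] by (simp add: D(2))
  \<comment> \<open>\<kappa> goes the opposite way. Following \<theta> by \<kappa> gives the image
    of an endomorphism of \<open>C\<close> that fixes the generators, hence the identity of
    \<open>P C\<close>.\<close>
  obtain \<kappa> where \<kappa>: "\<kappa> \<in> rep_hom C (P C)" "\<And>x. x \<in> X \<Longrightarrow> fst \<kappa> (?l x) = sl C (?l x)"
    "\<And>y. y \<in> Y \<Longrightarrow> snd \<kappa> (?m y) = sm C (?m y)"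
    by (rule free_rep_hom[OF PC.lie_rep_axioms, of X "\<lambda>x. sl C (?l x)" Y "\<lambda>y. sm C (?m y)", folded
        C_def],
        simp add: sl_closed[OF C] l, simp add: sm_closed[OF C] m, rule that, assumption+)
  obtain \<nu> where \<nu>: "\<nu> \<in> rep_hom C C" "q C \<nu> C = hcomp (P C) \<kappa> \<theta>"
    by (rule q_surj[OF C C hcomp_hom[OF PC.closed \<theta> \<kappa>(1)]])
  have "fst \<theta> (sl C (?l x)) = ?l x" if "x \<in> X" for x
    using that a by (simp add: \<theta>_def sl_nat[OF C D(1) \<mu>(1), symmetric] l \<mu>)
  then have "sl C (fst \<nu> (?l x)) = sl C (?l x)" if "x \<in> X" for x
    using that by (simp add: sl_nat[OF C C \<nu>(1)] l \<nu>(2) hcomp_apply sl_closed[OF C] \<kappa>)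
  then have \<nu>l: "fst \<nu> (?l x) = ?l x" if "x \<in> X" for x
    using that by - (rule sl_inj[OF C], simp_all add: hom_lclosed[OF \<nu>(1)] l)
  have "snd \<theta> (sm C (?m y)) = ?m y" if "y \<in> Y" for y
    using that b by (simp add: \<theta>_def sm_nat[OF C D(1) \<mu>(1), symmetric] m \<mu>)
  then have "sm C (snd \<nu> (?m y)) = sm C (?m y)" if "y \<in> Y" for y
    using that by (simp add: sm_nat[OF C C \<nu>(1)] m \<nu>(2) hcomp_apply sm_closed[OF C] \<kappa>)
  then have \<nu>m: "snd \<nu> (?m y) = ?m y" if "y \<in> Y" for y
    using that by - (rule sm_inj[OF C], simp_all add: hom_mclosed[OF \<nu>(1)] m)
  have "\<nu> = hid C"
    by (rule free_rep_hom_unique[OF \<nu>(1)[unfolded C_def] hid_hom[OF C.closed, unfolded C_def],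
        folded C_def])
      (simp_all add: hid_apply \<nu>l \<nu>m l m)
  then have \<kappa>\<theta>: "hcomp (P C) \<kappa> \<theta> = hid (P C)"
    using \<nu>(2) q_id[OF C] by simp
  have \<kappa>\<theta>l: "fst \<kappa> (fst \<theta> z) = z" if "z \<in> lcar (P C)" for z
    using hcomp_apply(1)[OF that, of \<kappa> \<theta>] unfolding \<kappa>\<theta> by (simp add: hid_apply that)
  have \<kappa>\<theta>m: "snd \<kappa> (snd \<theta> z) = z" if "z \<in> mcar (P C)" for z
    using hcomp_apply(2)[OF that, of \<kappa> \<theta>] unfolding \<kappa>\<theta> by (simp add: hid_apply that)
  \<comment> \<open>A morphism that matches \<phi> on generators factors through \<kappa>. Evaluated
    at the image of an element under \<theta>, it lets \<kappa> and \<theta> cancel and leaves the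
    naturality square of \<phi>.\<close>
  have \<psi>: "\<psi> = hcomp C (q C \<phi> A) \<kappa>"
    if "A \<in> Ob" "\<phi> \<in> rep_hom C A" "\<psi> \<in> rep_hom C (P A)"
      "\<forall>x\<in>X. fst \<psi> (?l x) = sl A (fst \<phi> (?l x))" "\<forall>y\<in>Y. snd \<psi> (?m y) = sm A (snd \<phi> (?m y))" for A \<phi>
          \<psi>
  proof -
    have h: "hcomp C (q C \<phi> A) \<kappa> \<in> rep_hom C (P A)"
      by (rule hcomp_hom[OF C.closed \<kappa>(1) q_closed[OF C that(1,2)]])
    show ?thesis
    proof (rule free_rep_hom_unique[OF that(3)[unfolded C_def] h[unfolded C_def], folded C_def])
      fix x assume x: "x \<in> X"
      have "fst \<psi> (?l x) = sl A (fst \<phi> (?l x))" using that(4) x by simp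
      also have "\<dots> = fst (hcomp C (q C \<phi> A) \<kappa>) (?l x)"
        using x by (simp add: hcomp_apply l \<kappa> sl_nat[OF C that(1,2)])
      finally show "fst \<psi> (?l x) = fst (hcomp C (q C \<phi> A) \<kappa>) (?l x)" .
    next
      fix y assume y: "y \<in> Y"
      have "snd \<psi> (?m y) = sm A (snd \<phi> (?m y))" using that(5) y by simp
      also have "\<dots> = snd (hcomp C (q C \<phi> A) \<kappa>) (?m y)"
        using y by (simp add: hcomp_apply m \<kappa> sm_nat[OF C that(1,2)])
      finally show "snd \<psi> (?m y) = snd (hcomp C (q C \<phi> A) \<kappa>) (?m y)" .
    qed
  qed
  show ?thesis
  proof (rule that[of \<theta>, folded C_def])
    show "\<theta> \<in> rep_hom (P C) C" by (rule \<theta>)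
    fix A \<phi> \<psi>
    assume *: "A \<in> Ob" "\<phi> \<in> rep_hom C A" "\<psi> \<in> rep_hom C (P A)"
      "\<forall>x\<in>X. fst \<psi> (?l x) = sl A (fst \<phi> (?l x))" "\<forall>y\<in>Y. snd \<psi> (?m y) = sm A (snd \<phi> (?m y))"
    show "sl A (fst \<phi> t) = fst \<psi> (fst \<theta> (sl C t))" if "t \<in> lcar C" for t
      using that by (simp add: \<psi>[OF *] hcomp_apply hom_lclosed[OF \<theta>] sl_closed[OF C] \<kappa>\<theta>l sl_nat[OF C
          *(1,2)])
    show "sm A (snd \<phi> t) = snd \<psi> (snd \<theta> (sm C t))" if "t \<in> mcar C" for t
      using that by (simp add: \<psi>[OF *] hcomp_apply hom_mclosed[OF \<theta>] sm_closed[OF C] \<kappa>\<theta>m sm_nat[OF C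
          *(1,2)])
  qed
qed

text \<open>The operation is given by the element c x of the algebra with one Lie generator x. Its
  transport is again a multiple of x, and the coefficient serves as \<sigma> c for all algebras and
  points at once. So far \<sigma> is a mere function.\<close>

lemma sl_scale:
  obtains \<sigma> where "\<And>A a c. A \<in> Ob \<Longrightarrow> a \<in> lcar A \<Longrightarrow> sl A (lscale A c a) = lscale (P A) (\<sigma> c) (sl A a)"
proof -
  obtain x where x: "x \<in> X0" using infinite_imp_nonempty[OF inf(1)] by auto
  let ?C = "free_rep {x} {} :: ('k, 'x, 'y) free_alg" and ?x = "lgen {x} ({} :: 'y set) x :: ('k,
      'x) lterm set"
  have C: "?C \<in> Ob" using x by (intro objsI) auto
  interpret C: lie_rep ?C by (rule lie_rep_free)
  have xC: "?x \<in> lcar ?C" by (simp add: lgen_closed)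
  obtain \<theta> where \<theta>: "\<theta> \<in> rep_hom (P ?C) ?C"
    "\<And>A \<phi> \<psi> t. A \<in> Ob \<Longrightarrow> \<phi> \<in> rep_hom ?C A \<Longrightarrow> \<psi> \<in> rep_hom ?C (P A) \<Longrightarrow>
      \<forall>z\<in>{x}. fst \<psi> (lgen {x} ({} :: 'y set) z) = sl A (fst \<phi> (lgen {x} ({} :: 'y set) z)) \<Longrightarrow>
      \<forall>y\<in>{}. snd \<psi> (mgen {x} {} y) = sm A (snd \<phi> (mgen {x} {} y)) \<Longrightarrow>
      t \<in> lcar ?C \<Longrightarrow> sl A (fst \<phi> t) = fst \<psi> (fst \<theta> (sl ?C t))"
    by (rule transport[of "{x}" "{}", OF _ _ finite.emptyI empty_subsetI], simp, simp add: x, rule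
        that, assumption+)
  have "\<exists>d. \<forall>A\<in>Ob. \<forall>a\<in>lcar A. sl A (lscale A c a) = lscale (P A) d (sl A a)" for c
  proof -
    have "fst \<theta> (sl ?C (lscale ?C c ?x)) \<in> lcar ?C"
      using hom_lclosed[OF \<theta>(1)] sl_closed[OF C] xC C.lie.scale_closed by simp
    then obtain d where d: "fst \<theta> (sl ?C (lscale ?C c ?x)) = lscale ?C d ?x"
      by (rule free_one_lgen)
    have "sl A (lscale A c a) = lscale (P A) d (sl A a)" if A: "A \<in> Ob" and a: "a \<in> lcar A" for A a
    proof -
      have "a \<in> (\<lambda>\<phi>. fst \<phi> ?x) ` rep_hom ?C A"
        by (simp only: bij_betw_imp_surj_on[OF free_one_l_bij[OF objs_lie_rep[OF A]]] a)
      then obtain \<phi> where \<phi>: "\<phi> \<in> rep_hom ?C A" "fst \<phi> ?x = a" by auto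
      have "sl A a \<in> (\<lambda>\<phi>. fst \<phi> ?x) ` rep_hom ?C (P A)"
        by (simp only: bij_betw_imp_surj_on[OF free_one_l_bij[OF objs_lie_rep[OF P_closed[OF A]]]]
            sl_closed[OF A a])
      then obtain \<psi> where \<psi>: "\<psi> \<in> rep_hom ?C (P A)" "fst \<psi> ?x = sl A a" by auto
      show ?thesis
        using \<theta>(2)[OF A \<phi>(1) \<psi>(1), of "lscale ?C c ?x"] xC
        by (simp add: \<phi>(2) \<psi>(2) C.lie.scale_closed hom_lscale[OF \<phi>(1)] hom_lscale[OF \<psi>(1)] d)
    qed
    then show ?thesis by blast
  qed
  then obtain \<sigma> where "\<forall>c. \<forall>A\<in>Ob. \<forall>a\<in>lcar A. sl A (lscale A c a) = lscale (P A) (\<sigma> c) (sl A a)"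
    by (rule choice[OF allI, THEN exE])
  then show ?thesis by (intro that) simp
qed

lemma sm_scale:
  obtains \<tau> where "\<And>A v c. A \<in> Ob \<Longrightarrow> v \<in> mcar A \<Longrightarrow> sm A (mscale A c v) = mscale (P A) (\<tau> c) (sm A v)"
proof -
  obtain y where y: "y \<in> Y0" using infinite_imp_nonempty[OF inf(2)] by auto
  let ?C = "free_rep {} {y} :: ('k, 'x, 'y) free_alg" and ?y = "mgen ({} :: 'x set) {y} y :: ('k,
      'x, 'y) mterm set"
  have C: "?C \<in> Ob" using y by (intro objsI) auto
  interpret C: lie_rep ?C by (rule lie_rep_free)
  have yC: "?y \<in> mcar ?C" by (simp add: mgen_closed)
  obtain \<theta> where \<theta>: "\<theta> \<in> rep_hom (P ?C) ?C"
    "\<And>A \<phi> \<psi> t. A \<in> Ob \<Longrightarrow> \<phi> \<in> rep_hom ?C A \<Longrightarrow> \<psi> \<in> rep_hom ?C (P A) \<Longrightarrow>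
      \<forall>x\<in>{}. fst \<psi> (lgen {} {y} x) = sl A (fst \<phi> (lgen {} {y} x)) \<Longrightarrow>
      \<forall>z\<in>{y}. snd \<psi> (mgen ({} :: 'x set) {y} z) = sm A (snd \<phi> (mgen ({} :: 'x set) {y} z)) \<Longrightarrow>
      t \<in> mcar ?C \<Longrightarrow> sm A (snd \<phi> t) = snd \<psi> (snd \<theta> (sm ?C t))"
    by (rule transport[of "{}" "{y}", OF finite.emptyI empty_subsetI], simp, simp add: y, rule that,
        assumption+)
  have "\<exists>d. \<forall>A\<in>Ob. \<forall>a\<in>mcar A. sm A (mscale A c a) = mscale (P A) d (sm A a)" for c
  proof -
    have "snd \<theta> (sm ?C (mscale ?C c ?y)) \<in> mcar ?C"
      using hom_mclosed[OF \<theta>(1)] sm_closed[OF C] yC C.md.scale_closed by simp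
    then obtain d where d: "snd \<theta> (sm ?C (mscale ?C c ?y)) = mscale ?C d ?y"
      by (rule free_one_mgen)
    have "sm A (mscale A c a) = mscale (P A) d (sm A a)" if A: "A \<in> Ob" and a: "a \<in> mcar A" for A a
    proof -
      have "a \<in> (\<lambda>\<phi>. snd \<phi> ?y) ` rep_hom ?C A"
        by (simp only: bij_betw_imp_surj_on[OF free_one_m_bij[OF objs_lie_rep[OF A]]] a)
      then obtain \<phi> where \<phi>: "\<phi> \<in> rep_hom ?C A" "snd \<phi> ?y = a" by auto
      have "sm A a \<in> (\<lambda>\<phi>. snd \<phi> ?y) ` rep_hom ?C (P A)"
        by (simp only: bij_betw_imp_surj_on[OF free_one_m_bij[OF objs_lie_rep[OF P_closed[OF A]]]]
            sm_closed[OF A a])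
      then obtain \<psi> where \<psi>: "\<psi> \<in> rep_hom ?C (P A)" "snd \<psi> ?y = sm A a" by auto
      show ?thesis
        using \<theta>(2)[OF A \<phi>(1) \<psi>(1), of "mscale ?C c ?y"] yC
        by (simp add: \<phi>(2) \<psi>(2) C.md.scale_closed hom_mscale[OF \<phi>(1)] hom_mscale[OF \<psi>(1)] d)
    qed
    then show ?thesis by blast
  qed
  then obtain \<tau> where "\<forall>c. \<forall>A\<in>Ob. \<forall>a\<in>mcar A. sm A (mscale A c a) = mscale (P A) (\<tau> c) (sm A a)"
    by (rule choice[OF allI, THEN exE])
  then show ?thesis by (intro that) simp
qed

end

section \<open>Addition, bracket and action under the point bijections\<close>

locale semi_points = natural_points X0 Y0 P q sl sm
  for X0 :: "'x set" and Y0 :: "'y set"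
    and P :: "('k::field_char_0, 'x, 'y) free_alg \<Rightarrow> ('k, 'x, 'y) free_alg" and q sl sm +
  fixes \<sigma> \<tau> :: "'k \<Rightarrow> 'k"
  assumes sl_scale: "A \<in> Ob \<Longrightarrow> a \<in> lcar A \<Longrightarrow> sl A (lscale A c a) = lscale (P A) (\<sigma> c) (sl A a)"
    and sm_scale: "A \<in> Ob \<Longrightarrow> v \<in> mcar A \<Longrightarrow> sm A (mscale A c v) = mscale (P A) (\<tau> c) (sm A v)"
begin

text \<open>The value \<sigma> 0 is still unknown, so 0 is multiplied to the preimage of zero:
  whatever \<sigma> 0 is, its multiple of zero is zero.\<close>

lemma sl_zero:
  assumes A: "A \<in> Ob" shows "sl A (lzero A) = lzero (P A)"
proof -
  interpret A: lie_rep A by (rule objs_lie_rep[OF A])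
  interpret PA: lie_rep "P A" by (rule objs_lie_rep[OF P_closed[OF A]])
  obtain a where "a \<in> lcar A" "sl A a = lzero (P A)"
    by (rule sl_surj[OF A PA.lie.zero_closed])
  then show ?thesis
    using sl_scale[OF A, of a 0] by (simp add: A.lie.scale_zero_left PA.lie.scale_zero_right)
qed

lemma sm_zero:
  assumes A: "A \<in> Ob" shows "sm A (mzero A) = mzero (P A)"
proof -
  interpret A: lie_rep A by (rule objs_lie_rep[OF A])
  interpret PA: lie_rep "P A" by (rule objs_lie_rep[OF P_closed[OF A]])
  obtain a where "a \<in> mcar A" "sm A a = mzero (P A)"
    by (rule sm_surj[OF A PA.md.zero_closed])
  then show ?thesis
    using sm_scale[OF A, of a 0] by (simp add: A.md.scale_zero_left PA.md.scale_zero_right)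
qed

lemma ex_sl_nonzero:
  obtains C g where "C \<in> Ob" "g \<in> lcar C" "sl C g \<noteq> lzero (P C)" "\<And>a. a \<in> lcar C \<Longrightarrow> \<exists>c. a = lscale C
      c g"
proof -
  obtain x where x: "x \<in> X0" using infinite_imp_nonempty[OF inf(1)] by auto
  let ?C = "free_rep {x} {} :: ('k, 'x, 'y) free_alg" and ?x = "lgen {x} ({} :: 'y set) x :: ('k,
      'x) lterm set"
  have C: "?C \<in> Ob" using x by (intro objsI) auto
  interpret C: lie_rep ?C by (rule lie_rep_free)
  have xC: "?x \<in> lcar ?C" by (simp add: lgen_closed)
  have "?x \<noteq> lzero ?C" by (rule lgen_nonzero) simp
  then have "sl ?C ?x \<noteq> lzero (P ?C)"
    using sl_inj[OF C _ xC C.lie.zero_closed] sl_zero[OF C] by auto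
  moreover have "\<exists>c. a = lscale ?C c ?x" if "a \<in> lcar ?C" for a
    by (rule free_one_lgen[OF that]) (rule exI)
  ultimately show ?thesis by (intro that[OF C xC]) simp_all
qed

lemma ex_sm_nonzero:
  obtains C g where "C \<in> Ob" "g \<in> mcar C" "sm C g \<noteq> mzero (P C)"
proof -
  obtain y where y: "y \<in> Y0" using infinite_imp_nonempty[OF inf(2)] by auto
  let ?C = "free_rep {} {y} :: ('k, 'x, 'y) free_alg" and ?y = "mgen ({} :: 'x set) {y} y :: ('k,
      'x, 'y) mterm set"
  have C: "?C \<in> Ob" using y by (intro objsI) auto
  interpret C: lie_rep ?C by (rule lie_rep_free)
  have yC: "?y \<in> mcar ?C" by (simp add: mgen_closed)
  have "?y \<noteq> mzero ?C" by (rule mgen_nonzero) simp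
  then have "sm ?C ?y \<noteq> mzero (P ?C)"
    using sm_inj[OF C _ yC C.md.zero_closed] sm_zero[OF C] by auto
  then show ?thesis by (rule that[OF C yC])
qed

lemma sigma_mult: "\<sigma> (c * d) = \<sigma> c * \<sigma> d" and sigma_one: "\<sigma> 1 = 1"
  and sigma_inj: "\<sigma> c = \<sigma> d \<Longrightarrow> c = d" and sigma_surj: "\<exists>c. \<sigma> c = d"
proof -
  obtain C g where C: "C \<in> Ob" and g: "g \<in> lcar C" "sl C g \<noteq> lzero (P C)"
    "\<And>a. a \<in> lcar C \<Longrightarrow> \<exists>c. a = lscale C c g" by (rule ex_sl_nonzero) (rule that)
  interpret C: lie_rep C by (rule objs_lie_rep[OF C])
  interpret PC: lie_rep "P C" by (rule objs_lie_rep[OF P_closed[OF C]])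
  note sg = sl_closed[OF C g(1)]
  note cancel = PC.lie.scale_right_cancel[OF sg g(2)]
  have "lscale (P C) (\<sigma> (c * d)) (sl C g) = lscale (P C) (\<sigma> c * \<sigma> d) (sl C g)"
    using sl_scale[OF C, of "lscale C d g" c] sl_scale[OF C g(1), of d] sl_scale[OF C g(1), of "c *
        d"]
    by (simp add: g sg C.lie.scale_closed C.lie.scale_scale PC.lie.scale_scale)
  then show "\<sigma> (c * d) = \<sigma> c * \<sigma> d" by (rule cancel)
  have "lscale (P C) (\<sigma> 1) (sl C g) = lscale (P C) 1 (sl C g)"
    using sl_scale[OF C g(1), of 1] by (simp add: g(1) sg C.lie.scale_one PC.lie.scale_one)
  then show "\<sigma> 1 = 1" by (rule cancel)
  show "c = d" if "\<sigma> c = \<sigma> d"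
  proof (rule C.lie.scale_right_cancel[OF g(1)])
    show "g \<noteq> lzero C" using g(2) sl_zero[OF C] by auto
    show "lscale C c g = lscale C d g"
      by (rule sl_inj[OF C]) (simp_all add: sl_scale[OF C g(1)] that C.lie.scale_closed g(1))
  qed
  \<comment> \<open>Surjectivity relies on the Lie sort of \<open>C\<close> being a line: the point
    carried to the d-fold image of \<open>g\<close> must be a multiple of \<open>g\<close>.\<close>
  obtain a where a: "a \<in> lcar C" "sl C a = lscale (P C) d (sl C g)"
    by (rule sl_surj[OF C PC.lie.scale_closed[OF sg]])
  obtain c where "a = lscale C c g" using g(3)[OF a(1)] by (elim exE)
  with a(2) have "lscale (P C) (\<sigma> c) (sl C g) = lscale (P C) d (sl C g)"
    by (simp add: sl_scale[OF C g(1)])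
  from cancel[OF this] show "\<exists>c. \<sigma> c = d" by (rule exI)
qed

lemma transport_two_l:
  assumes X: "x \<in> X0" "y \<in> X0" "x \<noteq> y" and C_def: "C = free_rep {x, y} ({} :: 'y set)"
    and g_def: "g = lgen {x, y} ({} :: 'y set) x" and h_def: "h = lgen {x, y} ({} :: 'y set) y"
    and t: "t \<in> lcar C"
  obtains w where "w \<in> lcar C"
    "\<And>A \<phi> \<psi>. A \<in> Ob \<Longrightarrow> \<phi> \<in> rep_hom C A \<Longrightarrow> \<psi> \<in> rep_hom C (P A) \<Longrightarrow>
      fst \<psi> g = sl A (fst \<phi> g) \<Longrightarrow> fst \<psi> h = sl A (fst \<phi> h) \<Longrightarrow> sl A (fst \<phi> t) = fst \<psi> w"
proof -
  have C: "C \<in> Ob" unfolding C_def using X by (intro objsI) auto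
  obtain \<theta> where \<theta>: "\<theta> \<in> rep_hom (P C) C"
    "\<And>A \<phi> \<psi> t. A \<in> Ob \<Longrightarrow> \<phi> \<in> rep_hom C A \<Longrightarrow> \<psi> \<in> rep_hom C (P A) \<Longrightarrow>
      \<forall>z\<in>{x, y}. fst \<psi> (lgen {x, y} ({} :: 'y set) z) = sl A (fst \<phi> (lgen {x, y} ({} :: 'y set) z))
          \<Longrightarrow>
      \<forall>z\<in>{}. snd \<psi> (mgen {x, y} {} z) = sm A (snd \<phi> (mgen {x, y} {} z)) \<Longrightarrow>
      t \<in> lcar C \<Longrightarrow> sl A (fst \<phi> t) = fst \<psi> (fst \<theta> (sl C t))"
    by (rule transport[of "{x, y}" "{}", OF _ _ finite.emptyI empty_subsetI, folded C_def], simp,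
        simp add: X, rule that, assumption+)
  show ?thesis
  proof (rule that)
    show "fst \<theta> (sl C t) \<in> lcar C"
      by (rule hom_lclosed[OF \<theta>(1) sl_closed[OF C t]])
    fix A \<phi> \<psi>
    assume "A \<in> Ob" "\<phi> \<in> rep_hom C A" "\<psi> \<in> rep_hom C (P A)" "fst \<psi> g = sl A (fst \<phi> g)" "fst \<psi> h = sl
        A (fst \<phi> h)"
    then show "sl A (fst \<phi> t) = fst \<psi> (fst \<theta> (sl C t))"
      by (intro \<theta>(2)) (simp_all add: t g_def h_def)
  qed
qed

text \<open>Scaling both summands scales the sum, so the element \<open>w\<close> describing the
  transported sum has degree 1 and is a combination of \<open>g\<close> and \<open>h\<close>. Adding
  zero on either side shows that both coefficients are 1.\<close>

lemma sl_add:
  assumes A: "A \<in> Ob" and ab: "a \<in> lcar A" "b \<in> lcar A"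
  shows "sl A (ladd A a b) = ladd (P A) (sl A a) (sl A b)"
proof -
  obtain x y where X: "x \<in> X0" "y \<in> X0" "x \<noteq> y" by (rule infinite_two[OF inf(1)])
  define C where "C = (free_rep {x, y} {} :: ('k, 'x, 'y) free_alg)"
  define g where "g = (lgen {x, y} ({} :: 'y set) x :: ('k, 'x) lterm set)"
  define h where "h = (lgen {x, y} ({} :: 'y set) y :: ('k, 'x) lterm set)"
  interpret T: free_two_lgen x y C g h
    using X(3) by unfold_locales (simp_all add: C_def g_def h_def)
  note gh = T.ab
  have C: "C \<in> Ob" unfolding C_def using X by (intro objsI) auto
  obtain w where w: "w \<in> lcar C" and W: "\<And>A \<phi> \<psi>. A \<in> Ob \<Longrightarrow> \<phi> \<in> rep_hom C A \<Longrightarrow> \<psi> \<in> rep_hom C (P A) \<Longrightarrow>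
      fst \<psi> g = sl A (fst \<phi> g) \<Longrightarrow> fst \<psi> h = sl A (fst \<phi> h) \<Longrightarrow> sl A (fst \<phi> (ladd C g h)) = fst \<psi> w"
    by (rule transport_two_l[OF X C_def g_def h_def T.F.lie.add_closed[OF gh]], rule that,
        assumption+)
  have sl_w: "sl A (ladd A a b) = fst \<psi> w"
    if p: "A \<in> Ob" "a \<in> lcar A" "b \<in> lcar A" "\<psi> \<in> rep_hom C (P A)" "fst \<psi> g = sl A a" "fst \<psi> h = sl
        A b" for A a b \<psi>
  proof -
    obtain \<phi> where \<phi>: "\<phi> \<in> rep_hom C A" "fst \<phi> g = a" "fst \<phi> h = b"
      unfolding C_def g_def h_def by (rule free_hom_two_l[OF objs_lie_rep[OF p(1)] p(2,3) X(3)])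
    show ?thesis
      using W[OF p(1) \<phi>(1) p(4)] p by (simp add: \<phi> hom_ladd[OF \<phi>(1)] gh)
  qed
  \<comment> \<open>The images of \<open>u\<close> and \<open>v\<close> are the free generators, so
    the image of their sum is \<open>w\<close> itself, and laws of addition in \<open>D\<close>
    become statements about \<open>w\<close>.\<close>
  obtain D where D: "D \<in> Ob" "P D = C" by (rule P_surj[OF C])
  interpret D: lie_rep D by (rule objs_lie_rep[OF D(1)])
  obtain u where u: "u \<in> lcar D" "sl D u = g" by (rule sl_surj[OF D(1), of g]) (simp add: D(2) gh)
  obtain v where v: "v \<in> lcar D" "sl D v = h" by (rule sl_surj[OF D(1), of h]) (simp add: D(2) gh)
  \<comment> \<open>That \<sigma> fixes 2 follows only from the additivity being proved; a preimage
    of 2 takes its place.\<close>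
  obtain e where e: "\<sigma> e = 2" using sigma_surj by auto
  have gh2: "lscale C 2 g \<in> lcar C" "lscale C 2 h \<in> lcar C"
    by (simp_all add: T.F.lie.scale_closed gh)
  obtain \<delta> where \<delta>: "\<delta> \<in> rep_hom C C" "fst \<delta> g = lscale C 2 g" "fst \<delta> h = lscale C 2 h"
    unfolding C_def g_def h_def
    by (rule free_hom_two_l[OF T.F.lie_rep_axioms[unfolded C_def] gh2(1)[unfolded C_def g_def h_def]
        gh2(2)[unfolded C_def g_def h_def] X(3)])
  have 1: "sl D (ladd D u v) = w"
    using sl_w[OF D(1) u(1) v(1), of "hid C"] hid_hom[OF T.F.closed] by (simp add: D(2) u v
        hid_apply gh w)
  have 2: "sl D (ladd D (lscale D e u) (lscale D e v)) = fst \<delta> w"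
    by (rule sl_w) (simp_all add: D u v \<delta> D.lie.scale_closed sl_scale[OF D(1)] e)
  have "sl D (ladd D (lscale D e u) (lscale D e v)) = lscale C 2 w"
    using sl_scale[OF D(1) D.lie.add_closed[OF u(1) v(1)], of e] 1
    by (simp add: D.lie.scale_add u v e D(2))
  with 2 have "fst \<delta> w = lscale C 2 w" by simp
  then obtain c d where cd: "w = ladd C (lscale C c g) (lscale C d h)"
    by (rule T.linear_element[OF \<delta> w])
  have lin: "sl A (ladd A a b) = ladd (P A) (lscale (P A) c (sl A a)) (lscale (P A) d (sl A b))"
    if A: "A \<in> Ob" "a \<in> lcar A" "b \<in> lcar A" for A a b
  proof -
    obtain \<psi> where \<psi>: "\<psi> \<in> rep_hom C (P A)" "fst \<psi> g = sl A a" "fst \<psi> h = sl A b"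
      unfolding C_def g_def h_def
      by (rule free_hom_two_l[OF objs_lie_rep[OF P_closed[OF A(1)]] sl_closed[OF A(1,2)]
          sl_closed[OF A(1,3)] X(3)])
    show ?thesis
      using sl_w[OF A \<psi>] by (simp add: cd hom_ladd[OF \<psi>(1)] hom_lscale[OF \<psi>(1)] gh
          T.F.lie.scale_closed \<psi>)
  qed
  obtain B f where B: "B \<in> Ob" and f: "f \<in> lcar B" "sl B f \<noteq> lzero (P B)" by (rule ex_sl_nonzero)
      (rule that)
  interpret B: lie_rep B by (rule objs_lie_rep[OF B])
  interpret PB: lie_rep "P B" by (rule objs_lie_rep[OF P_closed[OF B]])
  note sf = sl_closed[OF B f(1)]
  have "lscale (P B) c (sl B f) = lscale (P B) 1 (sl B f)"
    using lin[OF B f(1) B.lie.zero_closed] f sf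
    by (simp add: sl_zero[OF B] B.lie.add_zero PB.lie.scale_zero_right PB.lie.add_zero
        PB.lie.scale_closed PB.lie.scale_one)
  then have "c = 1" by (rule PB.lie.scale_right_cancel[OF sf f(2)])
  have "lscale (P B) d (sl B f) = lscale (P B) 1 (sl B f)"
    using lin[OF B B.lie.zero_closed f(1)] f sf
    by (simp add: sl_zero[OF B] B.lie.zero_add PB.lie.scale_zero_right PB.lie.zero_add
        PB.lie.scale_closed PB.lie.scale_one)
  then have "d = 1" by (rule PB.lie.scale_right_cancel[OF sf f(2)])
  interpret PA: lie_rep "P A" by (rule objs_lie_rep[OF P_closed[OF A]])
  show ?thesis
    using lin[OF A ab] sl_closed[OF A] ab by (simp add: \<open>c = 1\<close> \<open>d = 1\<close> PA.lie.scale_one)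
qed

lemma sigma_add: "\<sigma> (c + d) = \<sigma> c + \<sigma> d"
proof -
  obtain C g where C: "C \<in> Ob" and g: "g \<in> lcar C" "sl C g \<noteq> lzero (P C)" by (rule ex_sl_nonzero)
      (rule that)
  interpret C: lie_rep C by (rule objs_lie_rep[OF C])
  interpret PC: lie_rep "P C" by (rule objs_lie_rep[OF P_closed[OF C]])
  have "lscale (P C) (\<sigma> (c + d)) (sl C g) = lscale (P C) (\<sigma> c + \<sigma> d) (sl C g)"
    by (simp add: sl_scale[OF C g(1), symmetric] C.lie.add_scale PC.lie.add_scale g(1) sl_closed[OF
        C]
        sl_add[OF C] C.lie.scale_closed)
  then show ?thesis
    by (rule PC.lie.scale_right_cancel[OF sl_closed[OF C g(1)] g(2)])
qed

lemma sigma_two: "\<sigma> 2 = 2"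
  using sigma_add[of 1 1] by (simp add: sigma_one)

text \<open>Doubling either argument alone doubles the bracket, so the transported element has
  degree 1 in each generator. The factor \<alpha> stays undetermined because it changes when
  \<open>sl\<close> is rescaled.\<close>

lemma sl_br:
  obtains \<alpha> where "\<And>A a b. A \<in> Ob \<Longrightarrow> a \<in> lcar A \<Longrightarrow> b \<in> lcar A \<Longrightarrow>
    sl A (lbr A a b) = lscale (P A) \<alpha> (lbr (P A) (sl A a) (sl A b))"
proof -
  obtain x y where X: "x \<in> X0" "y \<in> X0" "x \<noteq> y" by (rule infinite_two[OF inf(1)])
  define C where "C = (free_rep {x, y} {} :: ('k, 'x, 'y) free_alg)"
  define g where "g = (lgen {x, y} ({} :: 'y set) x :: ('k, 'x) lterm set)"
  define h where "h = (lgen {x, y} ({} :: 'y set) y :: ('k, 'x) lterm set)"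
  interpret T: free_two_lgen x y C g h
    using X(3) by unfold_locales (simp_all add: C_def g_def h_def)
  note gh = T.ab
  have C: "C \<in> Ob" unfolding C_def using X by (intro objsI) auto
  obtain w where w: "w \<in> lcar C" and W: "\<And>A \<phi> \<psi>. A \<in> Ob \<Longrightarrow> \<phi> \<in> rep_hom C A \<Longrightarrow> \<psi> \<in> rep_hom C (P A) \<Longrightarrow>
      fst \<psi> g = sl A (fst \<phi> g) \<Longrightarrow> fst \<psi> h = sl A (fst \<phi> h) \<Longrightarrow> sl A (fst \<phi> (lbr C g h)) = fst \<psi> w"
    by (rule transport_two_l[OF X C_def g_def h_def T.F.lie.br_closed[OF gh]], rule that,
        assumption+)
  have sl_w: "sl A (lbr A a b) = fst \<psi> w"
    if p: "A \<in> Ob" "a \<in> lcar A" "b \<in> lcar A" "\<psi> \<in> rep_hom C (P A)" "fst \<psi> g = sl A a" "fst \<psi> h = sl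
        A b" for A a b \<psi>
  proof -
    obtain \<phi> where \<phi>: "\<phi> \<in> rep_hom C A" "fst \<phi> g = a" "fst \<phi> h = b"
      unfolding C_def g_def h_def by (rule free_hom_two_l[OF objs_lie_rep[OF p(1)] p(2,3) X(3)])
    show ?thesis
      using W[OF p(1) \<phi>(1) p(4)] p by (simp add: \<phi> hom_lbr[OF \<phi>(1)] gh)
  qed
  obtain D where D: "D \<in> Ob" "P D = C" by (rule P_surj[OF C])
  interpret D: lie_rep D by (rule objs_lie_rep[OF D(1)])
  obtain u where u: "u \<in> lcar D" "sl D u = g" by (rule sl_surj[OF D(1), of g]) (simp add: D(2) gh)
  obtain v where v: "v \<in> lcar D" "sl D v = h" by (rule sl_surj[OF D(1), of h]) (simp add: D(2) gh)
  have gh2: "lscale C 2 g \<in> lcar C" "lscale C 2 h \<in> lcar C"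
    by (simp_all add: T.F.lie.scale_closed gh)
  obtain \<delta> where \<delta>: "\<delta> \<in> rep_hom C C" "fst \<delta> g = lscale C 2 g" "fst \<delta> h = h"
    unfolding C_def g_def h_def
    by (rule free_hom_two_l[OF T.F.lie_rep_axioms[unfolded C_def] gh2(1)[unfolded C_def g_def h_def]
        gh(2)[unfolded C_def g_def h_def] X(3)])
  obtain \<epsilon> where \<epsilon>: "\<epsilon> \<in> rep_hom C C" "fst \<epsilon> g = g" "fst \<epsilon> h = lscale C 2 h"
    unfolding C_def g_def h_def
    by (rule free_hom_two_l[OF T.F.lie_rep_axioms[unfolded C_def] gh(1)[unfolded C_def g_def h_def]
        gh2(2)[unfolded C_def g_def h_def] X(3)])
  have 1: "sl D (lbr D u v) = w"
    using sl_w[OF D(1) u(1) v(1), of "hid C"] hid_hom[OF T.F.closed] by (simp add: D(2) u v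
        hid_apply gh w)
  have 2: "sl D (lscale D 2 (lbr D u v)) = lscale C 2 w"
    using sl_scale[OF D(1) D.lie.br_closed[OF u(1) v(1)], of 2] 1 by (simp add: sigma_two D(2))
  have "sl D (lbr D (lscale D 2 u) v) = fst \<delta> w"
    by (rule sl_w) (simp_all add: D u v \<delta> D.lie.scale_closed sl_scale[OF D(1)] sigma_two)
  with 2 have \<delta>w: "fst \<delta> w = lscale C 2 w" by (simp add: D.lie.br_scale_left u v)
  have "sl D (lbr D u (lscale D 2 v)) = fst \<epsilon> w"
    by (rule sl_w) (simp_all add: D u v \<epsilon> D.lie.scale_closed sl_scale[OF D(1)] sigma_two)
  with 2 have \<epsilon>w: "fst \<epsilon> w = lscale C 2 w" by (simp add: D.lie.br_scale_right u v)
  obtain c where c: "w = lscale C c (lbr C g h)"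
    by (rule T.bilinear_element[OF \<delta> \<epsilon> w \<delta>w \<epsilon>w])
  show ?thesis
  proof (rule that)
    fix A a b assume A: "A \<in> Ob" "a \<in> lcar A" "b \<in> lcar A"
    obtain \<psi> where \<psi>: "\<psi> \<in> rep_hom C (P A)" "fst \<psi> g = sl A a" "fst \<psi> h = sl A b"
      unfolding C_def g_def h_def
      by (rule free_hom_two_l[OF objs_lie_rep[OF P_closed[OF A(1)]] sl_closed[OF A(1,2)]
          sl_closed[OF A(1,3)] X(3)])
    show "sl A (lbr A a b) = lscale (P A) c (lbr (P A) (sl A a) (sl A b))"
      using sl_w[OF A \<psi>] by (simp add: c hom_lbr[OF \<psi>(1)] hom_lscale[OF \<psi>(1)] gh T.F.lie.br_closed
          \<psi>)
  qed
qed

text \<open>No weights are involved: without Lie generators the transported element is a linear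
  combination of the two generators from the start.\<close>

lemma sm_add:
  assumes A: "A \<in> Ob" and ab: "a \<in> mcar A" "b \<in> mcar A"
  shows "sm A (madd A a b) = madd (P A) (sm A a) (sm A b)"
proof -
  obtain x y where Y: "x \<in> Y0" "y \<in> Y0" "x \<noteq> y" by (rule infinite_two[OF inf(2)])
  define C where "C = (free_rep {} {x, y} :: ('k, 'x, 'y) free_alg)"
  define g where "g = (mgen ({} :: 'x set) {x, y} x :: ('k, 'x, 'y) mterm set)"
  define h where "h = (mgen ({} :: 'x set) {x, y} y :: ('k, 'x, 'y) mterm set)"
  have C: "C \<in> Ob" unfolding C_def using Y by (intro objsI) auto
  interpret C: lie_rep C by (rule objs_lie_rep[OF C])
  have gh: "g \<in> mcar C" "h \<in> mcar C" by (simp_all add: g_def h_def C_def mgen_closed)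
  obtain \<theta> where \<theta>: "\<theta> \<in> rep_hom (P C) C"
    "\<And>A \<phi> \<psi> t. A \<in> Ob \<Longrightarrow> \<phi> \<in> rep_hom C A \<Longrightarrow> \<psi> \<in> rep_hom C (P A) \<Longrightarrow>
      \<forall>z\<in>{}. fst \<psi> (lgen {} {x, y} z) = sl A (fst \<phi> (lgen {} {x, y} z)) \<Longrightarrow>
      \<forall>z\<in>{x, y}. snd \<psi> (mgen ({} :: 'x set) {x, y} z) = sm A (snd \<phi> (mgen ({} :: 'x set) {x, y} z))
          \<Longrightarrow>
      t \<in> mcar C \<Longrightarrow> sm A (snd \<phi> t) = snd \<psi> (snd \<theta> (sm C t))"
    by (rule transport[of "{}" "{x, y}", OF finite.emptyI empty_subsetI, folded C_def], simp, simp
        add: Y, rule that, assumption+)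
  define w where "w = snd \<theta> (sm C (madd C g h))"
  have w: "w \<in> mcar C"
    unfolding w_def by (intro hom_mclosed[OF \<theta>(1)] sm_closed[OF C] C.md.add_closed gh)
  then have "w \<in> C.md.span {g, h}"
    using free_no_lgen_mspan[of w "{x, y}"] by (simp add: C_def g_def h_def)
  then obtain c d where cd: "w = madd C (mscale C c g) (mscale C d h)"
    by (rule C.md.span_pair[OF _ gh])
  have lin: "sm A (madd A a b) = madd (P A) (mscale (P A) c (sm A a)) (mscale (P A) d (sm A b))"
    if A: "A \<in> Ob" "a \<in> mcar A" "b \<in> mcar A" for A a b
  proof -
    obtain \<phi> where \<phi>: "\<phi> \<in> rep_hom C A" "snd \<phi> g = a" "snd \<phi> h = b"
      unfolding C_def g_def h_def by (rule free_hom_two_m[OF objs_lie_rep[OF A(1)] A(2,3) Y(3)])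
    obtain \<psi> where \<psi>: "\<psi> \<in> rep_hom C (P A)" "snd \<psi> g = sm A a" "snd \<psi> h = sm A b"
      unfolding C_def g_def h_def
      by (rule free_hom_two_m[OF objs_lie_rep[OF P_closed[OF A(1)]] sm_closed[OF A(1,2)]
          sm_closed[OF A(1,3)] Y(3)])
    have "sm A (snd \<phi> (madd C g h)) = snd \<psi> w"
      unfolding w_def
      by (rule \<theta>(2)[OF A(1) \<phi>(1) \<psi>(1)])
        (use \<phi>(2,3) \<psi>(2,3) gh in \<open>simp_all add: C.md.add_closed flip: g_def h_def\<close>)
    then show ?thesis
      by (simp add: cd hom_madd[OF \<phi>(1)] hom_madd[OF \<psi>(1)] hom_mscale[OF \<psi>(1)] gh C.md.scale_closed
          \<phi> \<psi>)
  qed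
  obtain B f where B: "B \<in> Ob" and f: "f \<in> mcar B" "sm B f \<noteq> mzero (P B)" by (rule ex_sm_nonzero)
      (rule that)
  interpret B: lie_rep B by (rule objs_lie_rep[OF B])
  interpret PB: lie_rep "P B" by (rule objs_lie_rep[OF P_closed[OF B]])
  note sf = sm_closed[OF B f(1)]
  have "mscale (P B) c (sm B f) = mscale (P B) 1 (sm B f)"
    using lin[OF B f(1) B.md.zero_closed] f sf
    by (simp add: sm_zero[OF B] B.md.add_zero PB.md.scale_zero_right PB.md.add_zero
        PB.md.scale_closed PB.md.scale_one)
  then have "c = 1" by (rule PB.md.scale_right_cancel[OF sf f(2)])
  have "mscale (P B) d (sm B f) = mscale (P B) 1 (sm B f)"
    using lin[OF B B.md.zero_closed f(1)] f sf
    by (simp add: sm_zero[OF B] B.md.zero_add PB.md.scale_zero_right PB.md.zero_add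
        PB.md.scale_closed PB.md.scale_one)
  then have "d = 1" by (rule PB.md.scale_right_cancel[OF sf f(2)])
  interpret PA: lie_rep "P A" by (rule objs_lie_rep[OF P_closed[OF A]])
  show ?thesis
    using lin[OF A ab] sm_closed[OF A] ab by (simp add: \<open>c = 1\<close> \<open>d = 1\<close> PA.md.scale_one)
qed

text \<open>This one value of \<tau> suffices for \<open>sm_act\<close>; the equality of \<tau> and
  \<sigma> is then derived from the action in \<open>scalars\<close>.\<close>

lemma tau_two: "\<tau> 2 = 2"
proof -
  obtain C g where C: "C \<in> Ob" and g: "g \<in> mcar C" "sm C g \<noteq> mzero (P C)" by (rule ex_sm_nonzero)
      (rule that)
  interpret C: lie_rep C by (rule objs_lie_rep[OF C])
  interpret PC: lie_rep "P C" by (rule objs_lie_rep[OF P_closed[OF C]])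
  note sg = sm_closed[OF C g(1)]
  have two: "mscale C 2 g = madd C g g" "mscale (P C) 2 (sm C g) = madd (P C) (sm C g) (sm C g)"
    using C.md.add_scale[OF g(1), of 1 1] PC.md.add_scale[OF sg, of 1 1]
    by (simp_all add: C.md.scale_one[OF g(1)] PC.md.scale_one[OF sg])
  have "mscale (P C) (\<tau> 2) (sm C g) = mscale (P C) 2 (sm C g)"
    using sm_scale[OF C g(1), of 2] sm_add[OF C g(1) g(1)] by (simp add: two)
  then show ?thesis
    by (rule PC.md.scale_right_cancel[OF sg g(2)])
qed

text \<open>With one module generator every element is a polynomial in the Lie generator applied to
  it, so doubling the Lie argument alone isolates the action of degree 1.\<close>

lemma sm_act:
  obtains \<beta> where "\<And>A a v. A \<in> Ob \<Longrightarrow> a \<in> lcar A \<Longrightarrow> v \<in> mcar A \<Longrightarrow>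
    sm A (act A a v) = mscale (P A) \<beta> (act (P A) (sl A a) (sm A v))"
proof -
  obtain x where x: "x \<in> X0" using infinite_imp_nonempty[OF inf(1)] by auto
  obtain y where y: "y \<in> Y0" using infinite_imp_nonempty[OF inf(2)] by auto
  define C where "C = (free_rep {x} {y} :: ('k, 'x, 'y) free_alg)"
  define g where "g = (lgen {x} {y} x :: ('k, 'x) lterm set)"
  define h where "h = (mgen {x} {y} y :: ('k, 'x, 'y) mterm set)"
  have C: "C \<in> Ob" unfolding C_def using x y by (intro objsI) auto
  interpret C: lie_rep C by (rule objs_lie_rep[OF C])
  have gh: "g \<in> lcar C" "h \<in> mcar C" by (simp_all add: g_def h_def C_def lgen_closed mgen_closed)
  obtain \<theta> where \<theta>: "\<theta> \<in> rep_hom (P C) C"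
    "\<And>A \<phi> \<psi> t. A \<in> Ob \<Longrightarrow> \<phi> \<in> rep_hom C A \<Longrightarrow> \<psi> \<in> rep_hom C (P A) \<Longrightarrow>
      \<forall>z\<in>{x}. fst \<psi> (lgen {x} {y} z) = sl A (fst \<phi> (lgen {x} {y} z)) \<Longrightarrow>
      \<forall>z\<in>{y}. snd \<psi> (mgen {x} {y} z) = sm A (snd \<phi> (mgen {x} {y} z)) \<Longrightarrow>
      t \<in> mcar C \<Longrightarrow> sm A (snd \<phi> t) = snd \<psi> (snd \<theta> (sm C t))"
    by (rule transport[of "{x}" "{y}", folded C_def], simp, simp add: x, simp, simp add: y, rule
        that, assumption+)
  define w where "w = snd \<theta> (sm C (act C g h))"
  have w: "w \<in> mcar C"
    unfolding w_def by (intro hom_mclosed[OF \<theta>(1)] sm_closed[OF C] C.act_closed gh)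
  have sm_w: "sm A (act A a v) = snd \<psi> w"
    if A: "A \<in> Ob" "a \<in> lcar A" "v \<in> mcar A" and \<psi>: "\<psi> \<in> rep_hom C (P A)" "fst \<psi> g = sl A a" "snd \<psi>
        h = sm A v"
    for A a v \<psi>
  proof -
    obtain \<phi> where \<phi>: "\<phi> \<in> rep_hom C A" "fst \<phi> g = a" "snd \<phi> h = v"
      unfolding C_def g_def h_def by (rule free_hom_lm[OF objs_lie_rep[OF A(1)] A(2,3)])
    have "sm A (snd \<phi> (act C g h)) = snd \<psi> w"
      unfolding w_def
      by (rule \<theta>(2)[OF A(1) \<phi>(1) \<psi>(1)])
        (use \<phi>(2,3) \<psi>(2,3) gh in \<open>simp_all add: C.act_closed flip: g_def h_def\<close>)
    then show ?thesis
      by (simp add: hom_act[OF \<phi>(1)] gh \<phi>)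
  qed
  obtain D where D: "D \<in> Ob" "P D = C" by (rule P_surj[OF C])
  interpret D: lie_rep D by (rule objs_lie_rep[OF D(1)])
  obtain u where u: "u \<in> lcar D" "sl D u = g" by (rule sl_surj[OF D(1), of g]) (simp add: D(2) gh)
  obtain v where v: "v \<in> mcar D" "sm D v = h" by (rule sm_surj[OF D(1), of h]) (simp add: D(2) gh)
  have g2: "lscale C 2 g \<in> lcar C" by (rule C.lie.scale_closed[OF gh(1)])
  obtain \<delta> where \<delta>: "\<delta> \<in> rep_hom C C" "fst \<delta> g = lscale C 2 g" "snd \<delta> h = h"
    unfolding C_def g_def h_def
    by (rule free_hom_lm[OF C.lie_rep_axioms[unfolded C_def] g2[unfolded C_def g_def h_def]
        gh(2)[unfolded C_def g_def h_def]])
  have 1: "sm D (act D u v) = w"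
    using sm_w[OF D(1) u(1) v(1), of "hid C"] hid_hom[OF C.closed] by (simp add: D(2) u v hid_apply
        gh w)
  have "sm D (act D (lscale D 2 u) v) = snd \<delta> w"
    by (rule sm_w) (simp_all add: D u v \<delta> D.lie.scale_closed sl_scale[OF D(1)] sigma_two)
  moreover have "sm D (mscale D 2 (act D u v)) = mscale C 2 w"
    using sm_scale[OF D(1) D.act_closed[OF u(1) v(1)], of 2] 1 by (simp add: tau_two D(2))
  ultimately have \<delta>w: "snd \<delta> w = mscale C 2 w" by (simp add: D.act_scale_left u v)
  obtain c where c: "w = mscale C c (act C g h)"
    by (rule free_one_one_linear[OF \<delta>(1)[unfolded C_def] \<delta>(2)[unfolded C_def g_def] \<delta>(3)[unfolded
        h_def]
          w[unfolded C_def] \<delta>w[unfolded C_def]])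
      (simp add: C_def g_def h_def)
  show ?thesis
  proof (rule that)
    fix A a v assume A: "A \<in> Ob" "a \<in> lcar A" "v \<in> mcar A"
    obtain \<psi> where \<psi>: "\<psi> \<in> rep_hom C (P A)" "fst \<psi> g = sl A a" "snd \<psi> h = sm A v"
      unfolding C_def g_def h_def
      by (rule free_hom_lm[OF objs_lie_rep[OF P_closed[OF A(1)]] sl_closed[OF A(1,2)] sm_closed[OF
          A(1,3)]])
    show "sm A (act A a v) = mscale (P A) c (act (P A) (sl A a) (sm A v))"
      using sm_w[OF A \<psi>] by (simp add: c hom_act[OF \<psi>(1)] hom_mscale[OF \<psi>(1)] gh C.act_closed \<psi>)
  qed
qed

end

section \<open>Semilinear isomorphisms\<close>

text \<open>A \<open>\<sigma>\<close>-semilinear homomorphism to \<open>G\<close> is a homomorphism to the following algebra.\<close>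

definition twist :: "('k \<Rightarrow> 'k) \<Rightarrow> ('k, 'a, 'b) rep_alg \<Rightarrow> ('k, 'a, 'b) rep_alg" where
  "twist \<sigma> G = G \<lparr> lscale := (\<lambda>c. lscale G (\<sigma> c)), mscale := (\<lambda>c. mscale G (\<sigma> c)) \<rparr>"

lemma twist_simps [simp]:
  "lcar (twist \<sigma> G) = lcar G" "lzero (twist \<sigma> G) = lzero G" "lneg (twist \<sigma> G) = lneg G"
  "ladd (twist \<sigma> G) = ladd G" "lscale (twist \<sigma> G) c = lscale G (\<sigma> c)" "lbr (twist \<sigma> G) = lbr G"
  "mcar (twist \<sigma> G) = mcar G" "mzero (twist \<sigma> G) = mzero G" "mneg (twist \<sigma> G) = mneg G"
  "madd (twist \<sigma> G) = madd G" "mscale (twist \<sigma> G) c = mscale G (\<sigma> c)" "act (twist \<sigma> G) = act G"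
  by (simp_all add: twist_def)

lemma twist_twist: "twist \<sigma> (twist \<tau> G) = twist (\<tau> \<circ> \<sigma>) G"
  by (simp add: twist_def)

lemma twist_id: "twist (\<lambda>c. c) G = G"
  by (simp add: twist_def)

lemma rep_hom_twist: "\<phi> \<in> rep_hom H G \<Longrightarrow> \<phi> \<in> rep_hom (twist \<sigma> H) (twist \<sigma> G)"
  by (simp add: rep_hom_def split_beta)

abbreviation "Aut_k \<equiv> carrier (field_aut_group :: ('k::field \<Rightarrow> 'k) monoid)"

lemma Aut_k_iff:
  "\<sigma> \<in> Aut_k \<longleftrightarrow> bij \<sigma> \<and> (\<forall>a b. \<sigma> (a + b) = \<sigma> a + \<sigma> b) \<and> (\<forall>a b. \<sigma> (a * b) = \<sigma> a * \<sigma> b) \<and> \<sigma> 1 = 1"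
  by (simp add: field_aut_group_def Bij_def)

lemma lie_rep_twist:
  assumes "lie_rep G" "\<sigma> \<in> Aut_k"
  shows "lie_rep (twist \<sigma> G)"
proof -
  interpret G: lie_rep G by fact
  note c = G.lie.zero_closed G.lie.neg_closed G.lie.add_closed G.lie.scale_closed
      G.lie.br_closed G.md.zero_closed G.md.neg_closed G.md.add_closed G.md.scale_closed
          G.act_closed
  show ?thesis
    using assms(2) unfolding Aut_k_iff
    by unfold_locales (simp_all only: twist_simps c G.lie.add_zero G.lie.add_neg
        G.lie.scale_add G.lie.add_scale G.lie.scale_scale G.lie.scale_one G.lie.br_add_left
        G.lie.br_add_right G.lie.br_scale_left G.lie.br_scale_right G.lie.br_self G.lie.jacobi
        G.md.add_zero G.md.add_neg G.md.scale_add G.md.add_scale G.md.scale_scale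
        G.md.scale_one G.act_add_left G.act_add_right G.act_scale_left G.act_scale_right G.act_br,
      (rule G.lie.add_assoc G.md.add_assoc G.lie.add_commute G.md.add_commute; assumption)+)
qed

lemma (in lin_space) bij_scale:
  assumes "c \<noteq> 0"
  shows "bij_betw (scale c) V V"
proof (rule bij_betw_byWitness[of V "scale (inverse c)"])
  show "\<forall>x\<in>V. scale (inverse c) (scale c x) = x" "\<forall>x\<in>V. scale c (scale (inverse c) x) = x"
    using assms by (simp_all add: scale_scale scale_one)
qed (auto simp: scale_closed)

text \<open>A natural family of bijective \<sigma>-semilinear maps from each \<open>A\<close> to
  \<open>P A\<close>. For \<sigma> the identity it amounts to the isomorphism of functors in
  \<open>inner_auts\<close>, with bijectivity in place of an inverse morphism.\<close>

definition semi_iso ::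
  "'x set \<Rightarrow> 'y set \<Rightarrow> ('k::field \<Rightarrow> 'k) \<Rightarrow> (('k, 'x, 'y) free_alg \<Rightarrow> ('k, 'x, 'y) free_alg) \<Rightarrow>
    (('k, 'x, 'y) free_alg \<Rightarrow>
      ('k, 'x, 'y) hom_pair \<Rightarrow>
      ('k, 'x, 'y) free_alg \<Rightarrow>
      ('k, 'x, 'y) hom_pair) \<Rightarrow>
    (('k, 'x, 'y) free_alg \<Rightarrow>
      ('k, 'x, 'y) hom_pair) \<Rightarrow> bool"
  where "semi_iso X0 Y0 \<sigma> P q s \<longleftrightarrow>
    (\<forall>A\<in>objs X0 Y0. s A \<in> rep_hom A (twist \<sigma> (P A)) \<and>
      bij_betw (fst (s A)) (lcar A) (lcar (P A)) \<and> bij_betw (snd (s A)) (mcar A) (mcar (P A))) \<and>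
    (\<forall>A\<in>objs X0 Y0. \<forall>B\<in>objs X0 Y0. \<forall>\<phi>\<in>rep_hom A B.
      (\<forall>a\<in>lcar A. fst (q A \<phi> B) (fst (s A) a) = fst (s B) (fst \<phi> a)) \<and>
      (\<forall>v\<in>mcar A. snd (q A \<phi> B) (snd (s A) v) = snd (s B) (snd \<phi> v)))"

lemma
  assumes "semi_iso X0 Y0 \<sigma> P q s" and "A \<in> objs X0 Y0"
  shows semi_iso_hom: "s A \<in> rep_hom A (twist \<sigma> (P A))"
    and semi_iso_bij: "bij_betw (fst (s A)) (lcar A) (lcar (P A))" "bij_betw (snd (s A)) (mcar A)
        (mcar (P A))"
    and semi_iso_nat: "B \<in> objs X0 Y0 \<Longrightarrow> \<phi> \<in> rep_hom A B \<Longrightarrow> a \<in> lcar A \<Longrightarrow>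
        fst (q A \<phi> B) (fst (s A) a) = fst (s B) (fst \<phi> a)"
      "B \<in> objs X0 Y0 \<Longrightarrow> \<phi> \<in> rep_hom A B \<Longrightarrow> v \<in> mcar A \<Longrightarrow>
        snd (q A \<phi> B) (snd (s A) v) = snd (s B) (snd \<phi> v)"
  using assms unfolding semi_iso_def by simp_all

context semi_points
begin

lemma sigma_zero: "\<sigma> 0 = 0"
  using sigma_add[of 0 0] by simp

lemma sigma_minus_one: "\<sigma> (- 1) = - 1"
proof -
  have "1 + \<sigma> (- 1) = 0"
    using sigma_add[of 1 "- 1"] by (simp add: sigma_zero sigma_one)
  then show ?thesis
    by (rule minus_unique[symmetric])
qed

lemma sigma_Aut: "\<sigma> \<in> Aut_k"
proof -
  have "\<exists>c. d = \<sigma> c" for d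
    using sigma_surj[of d] by (elim exE) (rule exI, erule sym)
  then have "bij \<sigma>"
    by (intro bijI injI) (auto simp: surj_def intro: sigma_inj)
  then show ?thesis
    by (simp add: Aut_k_iff sigma_add sigma_mult sigma_one)
qed

text \<open>The scalars by which the bracket and the action are distorted are compared on
  \<open>[x, x'] \<circ> y = x \<circ> (x' \<circ> y) - x' \<circ> (x \<circ> y)\<close>.\<close>

lemma scalars:
  assumes br: "\<And>A a b. A \<in> Ob \<Longrightarrow> a \<in> lcar A \<Longrightarrow> b \<in> lcar A \<Longrightarrow>
      sl A (lbr A a b) = lscale (P A) \<alpha> (lbr (P A) (sl A a) (sl A b))"
    and act: "\<And>A a v. A \<in> Ob \<Longrightarrow> a \<in> lcar A \<Longrightarrow> v \<in> mcar A \<Longrightarrow>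
      sm A (act A a v) = mscale (P A) \<beta> (act (P A) (sl A a) (sm A v))"
  shows "\<alpha> \<noteq> 0" "\<alpha> = \<beta>" "\<tau> = \<sigma>"
proof -
  obtain x x' where X: "x \<in> X0" "x' \<in> X0" "x \<noteq> x'" by (rule infinite_two[OF inf(1)])
  obtain y where y: "y \<in> Y0" using infinite_imp_nonempty[OF inf(2)] by auto
  define A where "A = (free_rep {x, x'} {y} :: ('k, 'x, 'y) free_alg)"
  define a where "a = (lgen {x, x'} {y} x :: ('k, 'x) lterm set)"
  define b where "b = (lgen {x, x'} {y} x' :: ('k, 'x) lterm set)"
  define v where "v = (mgen {x, x'} {y} y :: ('k, 'x, 'y) mterm set)"
  have A: "A \<in> Ob" unfolding A_def using X y by (intro objsI) auto
  interpret A: lie_rep A by (rule objs_lie_rep[OF A])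
  interpret PA: lie_rep "P A" by (rule objs_lie_rep[OF P_closed[OF A]])
  have abv: "a \<in> lcar A" "b \<in> lcar A" "v \<in> mcar A"
    by (simp_all add: a_def b_def v_def A_def lgen_closed mgen_closed)
  note s = sl_closed[OF A abv(1)] sl_closed[OF A abv(2)] sm_closed[OF A abv(3)]
  let ?ab = "lbr A a b"
  have ab: "?ab \<in> lcar A" by (simp add: abv A.lie.br_closed)
  have z: "act A ?ab v \<in> mcar A" by (simp add: ab abv A.act_closed)
  have "act A ?ab v \<noteq> mzero A"
    unfolding A_def a_def b_def v_def using X by (intro act_lbr_gen_nonzero) auto
  then have sz: "sm A (act A ?ab v) \<noteq> mzero (P A)"
    using sm_inj[OF A _ z A.md.zero_closed] sm_zero[OF A] by auto
  have szc: "sm A (act A ?ab v) \<in> mcar (P A)" by (rule sm_closed[OF A z])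
  \<comment> \<open>The scalar c may stand at the Lie argument of the action or at the result. In
    the first position it is carried over by \<sigma>, in the second by \<tau>.\<close>
  have "\<sigma> c = \<tau> c" for c
  proof (rule PA.md.scale_right_cancel[OF szc sz])
    have "mscale (P A) (\<tau> c) (sm A (act A ?ab v)) = sm A (act A (lscale A c ?ab) v)"
      by (simp add: sm_scale[OF A z, symmetric] A.act_scale_left ab abv)
    also have "\<dots> = mscale (P A) \<beta> (act (P A) (lscale (P A) (\<sigma> c) (sl A ?ab)) (sm A v))"
      by (simp add: act[OF A] sl_scale[OF A ab] ab abv A.lie.scale_closed)
    also have "\<dots> = mscale (P A) (\<sigma> c) (sm A (act A ?ab v))"
      by (simp add: act[OF A ab abv(3)] PA.act_scale_left sl_closed[OF A ab] s PA.md.scale_scale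
          PA.act_closed mult.commute)
    finally show "mscale (P A) (\<sigma> c) (sm A (act A ?ab v)) = mscale (P A) (\<tau> c) (sm A (act A ?ab v))"
        by (rule sym)
  qed
  then show \<tau>: "\<tau> = \<sigma>" by auto
  let ?Z = "act (P A) (lbr (P A) (sl A a) (sl A b)) (sm A v)"
  have Z: "?Z \<in> mcar (P A)" by (simp add: s PA.act_closed PA.lie.br_closed)
  \<comment> \<open>On this side of the identity the bracket contributes \<alpha> and the action
    \<beta>. On the other side there are two successive actions, hence
    \<open>\<beta> * \<beta>\<close>.\<close>
  have 1: "sm A (act A ?ab v) = mscale (P A) (\<beta> * \<alpha>) ?Z"
    by (simp add: act[OF A ab abv(3)] br[OF A abv(1,2)] PA.act_scale_left s PA.lie.br_closed
        PA.md.scale_scale PA.act_closed)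
  let ?u = "act (P A) (sl A a) (act (P A) (sl A b) (sm A v))"
    and ?w = "act (P A) (sl A b) (act (P A) (sl A a) (sm A v))"
  have uw: "?u \<in> mcar (P A)" "?w \<in> mcar (P A)" by (simp_all add: s PA.act_closed)
  have two: "sm A (act A a' (act A b' v)) = mscale (P A) (\<beta> * \<beta>) (act (P A) (sl A a') (act (P A) (sl
      A b') (sm A v)))"
    if "a' \<in> lcar A" "b' \<in> lcar A" for a' b'
    using that by (simp add: act[OF A] abv A.act_closed sl_closed[OF A] s PA.act_scale_right
        PA.act_closed PA.md.scale_scale)
  have "sm A (act A ?ab v) = sm A (madd A (act A a (act A b v)) (mscale A (- 1) (act A b (act A a
      v))))"
    by (simp add: A.act_br abv A.md.neg_eq_scale A.act_closed)
  also have "\<dots> = madd (P A) (mscale (P A) (\<beta> * \<beta>) ?u) (mscale (P A) (- 1) (mscale (P A) (\<beta> * \<beta>)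
      ?w))"
    by (simp add: sm_add[OF A] sm_scale[OF A] two abv A.act_closed A.md.scale_closed \<tau>
        sigma_minus_one)
  also have "\<dots> = mscale (P A) (\<beta> * \<beta>) (madd (P A) ?u (mscale (P A) (- 1) ?w))"
    by (simp add: PA.md.scale_add uw PA.md.scale_closed PA.md.scale_scale)
  also have "\<dots> = mscale (P A) (\<beta> * \<beta>) ?Z"
    using uw by (simp add: PA.act_br s PA.md.neg_eq_scale)
  finally have 2: "sm A (act A ?ab v) = mscale (P A) (\<beta> * \<beta>) ?Z" .
  have "?Z \<noteq> mzero (P A)" "\<beta> * \<alpha> \<noteq> 0"
    using sz unfolding 1 PA.md.scale_eq_zero[OF Z] de_Morgan_disj by (rule conjunct2, rule
        conjunct1)
  moreover have "\<beta> * \<alpha> = \<beta> * \<beta>"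
    by (rule PA.md.scale_right_cancel[OF Z calculation(1) trans[OF 1[symmetric] 2]])
  ultimately show "\<alpha> \<noteq> 0" "\<alpha> = \<beta>" by simp_all
qed

lemma ex_semi_iso_sigma: "\<exists>s. semi_iso X0 Y0 \<sigma> P q s"
proof -
  obtain \<alpha> where br: "\<And>A a b. A \<in> Ob \<Longrightarrow> a \<in> lcar A \<Longrightarrow> b \<in> lcar A \<Longrightarrow>
    sl A (lbr A a b) = lscale (P A) \<alpha> (lbr (P A) (sl A a) (sl A b))" by (rule sl_br) (rule that)
  obtain \<beta> where act: "\<And>A a v. A \<in> Ob \<Longrightarrow> a \<in> lcar A \<Longrightarrow> v \<in> mcar A \<Longrightarrow>
    sm A (act A a v) = mscale (P A) \<beta> (act (P A) (sl A a) (sm A v))" by (rule sm_act) (rule that)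
  have sc: "\<alpha> \<noteq> 0" "\<beta> = \<alpha>" "\<tau> = \<sigma>"
    using scalars[of \<alpha> \<beta>] br act by simp_all
  \<comment> \<open>The factor \<alpha> absorbs both distortions: \<alpha> sl [a, b] is the bracket
    of \<alpha> sl a and \<alpha> sl b, and since \<beta> = \<alpha>, the image of a \<circ> v is
    (\<alpha> sl a) \<circ> sm v.\<close>
  define s where "s A = (\<lambda>a\<in>lcar A. lscale (P A) \<alpha> (sl A a), \<lambda>v\<in>mcar A. sm A v)" for A
  have s: "fst (s A) a = lscale (P A) \<alpha> (sl A a)" "snd (s A) v = sm A v"
    if "a \<in> lcar A" "v \<in> mcar A" for A a v
    using that by (simp_all add: s_def)
  have "s A \<in> rep_hom A (twist \<sigma> (P A))" if A: "A \<in> Ob" for A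
  proof -
    interpret A: lie_rep A by (rule objs_lie_rep[OF A])
    interpret PA: lie_rep "P A" by (rule objs_lie_rep[OF P_closed[OF A]])
    note cl = A.lie.add_closed A.lie.scale_closed A.lie.br_closed A.md.add_closed A.md.scale_closed
        A.act_closed
      sl_closed[OF A] sm_closed[OF A] PA.lie.scale_closed PA.lie.br_closed PA.act_closed
    show ?thesis
      unfolding s_def
      by (rule rep_homI[OF A.lie_rep_axioms lie_rep_twist[OF PA.lie_rep_axioms sigma_Aut]])
        (simp_all add: cl sl_add[OF A] sl_scale[OF A] br[OF A] sm_add[OF A] sm_scale[OF A] act[OF A]
            sc
          PA.lie.scale_add PA.lie.scale_scale PA.lie.br_scale_left PA.lie.br_scale_right
          PA.act_scale_left mult.commute)
  qed
  moreover have "bij_betw (fst (s A)) (lcar A) (lcar (P A))" "bij_betw (snd (s A)) (mcar A) (mcar (P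
      A))"
    if A: "A \<in> Ob" for A
  proof -
    interpret PA: lie_rep "P A" by (rule objs_lie_rep[OF P_closed[OF A]])
    show "bij_betw (fst (s A)) (lcar A) (lcar (P A))"
      using bij_betw_trans[OF sl_bij[OF A] PA.lie.bij_scale[OF sc(1)]]
      by (rule bij_betw_cong[THEN iffD1, rotated]) (simp add: s_def)
    show "bij_betw (snd (s A)) (mcar A) (mcar (P A))"
      using sm_bij[OF A] by (rule bij_betw_cong[THEN iffD1, rotated]) (simp add: s_def)
  qed
  moreover have "fst (q A \<phi> B) (fst (s A) a) = fst (s B) (fst \<phi> a)"
    if "A \<in> Ob" "B \<in> Ob" "\<phi> \<in> rep_hom A B" "a \<in> lcar A" for A B \<phi> a
    using that hom_lscale[OF q_closed[OF that(1-3)] sl_closed[OF that(1,4)]]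
    by (simp add: s_def hom_lclosed[OF that(3)] sl_nat[OF that(1-4)])
  moreover have "snd (q A \<phi> B) (snd (s A) v) = snd (s B) (snd \<phi> v)"
    if "A \<in> Ob" "B \<in> Ob" "\<phi> \<in> rep_hom A B" "v \<in> mcar A" for A B \<phi> v
    using that by (simp add: s_def hom_mclosed[OF that(3)] sm_nat[OF that(1-4)])
  ultimately have "semi_iso X0 Y0 \<sigma> P q s"
    unfolding semi_iso_def by simp
  then show ?thesis by (rule exI[of _ s])
qed

end

context free_functor
begin

lemma ex_semi_iso: "\<exists>\<sigma>\<in>Aut_k. \<exists>s. semi_iso X0 Y0 \<sigma> P q s"
proof -
  obtain sl where sl: "\<And>A. A \<in> Ob \<Longrightarrow> bij_betw (sl A) (lcar A) (lcar (P A))"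
    "\<And>A B \<phi> a. A \<in> Ob \<Longrightarrow> B \<in> Ob \<Longrightarrow> \<phi> \<in> rep_hom A B \<Longrightarrow> a \<in> lcar A \<Longrightarrow>
      sl B (fst \<phi> a) = fst (q A \<phi> B) (sl A a)"
    by (rule natural_bij_l) (rule that, assumption+)
  obtain sm where sm: "\<And>A. A \<in> Ob \<Longrightarrow> bij_betw (sm A) (mcar A) (mcar (P A))"
    "\<And>A B \<phi> a. A \<in> Ob \<Longrightarrow> B \<in> Ob \<Longrightarrow> \<phi> \<in> rep_hom A B \<Longrightarrow> a \<in> mcar A \<Longrightarrow>
      sm B (snd \<phi> a) = snd (q A \<phi> B) (sm A a)"
    by (rule natural_bij_m) (rule that, assumption+)
  interpret natural_points X0 Y0 P q sl sm
    by unfold_locales (fact sl sm)+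
  obtain \<sigma> where \<sigma>: "\<And>A a c. A \<in> Ob \<Longrightarrow> a \<in> lcar A \<Longrightarrow> sl A (lscale A c a) = lscale (P A) (\<sigma> c) (sl A
      a)"
    by (rule sl_scale) (rule that)
  obtain \<tau> where \<tau>: "\<And>A v c. A \<in> Ob \<Longrightarrow> v \<in> mcar A \<Longrightarrow> sm A (mscale A c v) = mscale (P A) (\<tau> c) (sm A
      v)"
    by (rule sm_scale) (rule that)
  interpret semi_points X0 Y0 P q sl sm \<sigma> \<tau>
    by unfold_locales (fact \<sigma> \<tau>)+
  show ?thesis
    by (rule bexI[of "\<lambda>\<sigma>. \<exists>s. semi_iso X0 Y0 \<sigma> P q s" \<sigma>, OF ex_semi_iso_sigma sigma_Aut])
qed

text \<open>The scalar \<open>\<sigma> c\<close> is determined by the image of the endomorphism \<open>x \<mapsto> c x\<close> of the free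
  algebra with one Lie generator.\<close>

lemma semi_iso_unique:
  assumes s: "semi_iso X0 Y0 \<sigma> P q s" and s': "semi_iso X0 Y0 \<tau> P q s'"
  shows "\<sigma> = \<tau>"
proof
  fix c
  obtain x where x: "x \<in> X0" using infinite_imp_nonempty[OF inf(1)] by auto
  define A where "A = (free_rep {x} {} :: ('k, 'x, 'y) free_alg)"
  define g where "g = (lgen {x} ({} :: 'y set) x :: ('k, 'x) lterm set)"
  have A: "A \<in> Ob" unfolding A_def using x by (intro objsI) auto
  interpret A: lie_rep A by (rule objs_lie_rep[OF A])
  interpret PA: lie_rep "P A" by (rule objs_lie_rep[OF P_closed[OF A]])
  have g: "g \<in> lcar A" by (simp add: g_def A_def lgen_closed)
  have cg: "lscale A c g \<in> lcar A" by (rule A.lie.scale_closed[OF g])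
  have "lscale A c g \<in> (\<lambda>\<phi>. fst \<phi> g) ` rep_hom A A"
    unfolding A_def g_def bij_betw_imp_surj_on[OF free_one_l_bij[OF lie_rep_free]]
    by (rule cg[unfolded A_def g_def])
  then obtain \<epsilon> where \<epsilon>: "\<epsilon> \<in> rep_hom A A" "fst \<epsilon> g = lscale A c g" by auto
  \<comment> \<open>On the line through \<open>g\<close> the endomorphism \<epsilon> is
    multiplication by c at every point. Its image can thus be computed also at the point that
    \<open>s'\<close> sends to \<open>?u\<close>, where it must multiply by \<tau> c.\<close>
  have \<epsilon>a: "fst \<epsilon> a = lscale A c a" if aA: "a \<in> lcar A" for a
  proof -
    obtain d where "a = lscale A d g"
      using aA unfolding A_def g_def by (rule free_one_lgen)
    then show ?thesis
      by (simp add: hom_lscale[OF \<epsilon>(1)] g \<epsilon>(2) A.lie.scale_scale mult.commute)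
  qed
  let ?u = "fst (s A) g"
  have u: "?u \<in> lcar (P A)" using hom_lclosed[OF semi_iso_hom[OF s A] g] by simp
  have "g \<noteq> lzero A" unfolding A_def g_def by (rule lgen_nonzero) simp
  then have u0: "?u \<noteq> lzero (P A)"
    using inj_onD[OF bij_betw_imp_inj_on[OF semi_iso_bij(1)[OF s A]] _ g A.lie.zero_closed]
      hom_lzero[OF semi_iso_hom[OF s A]] by auto
  have "?u \<in> fst (s' A) ` lcar A"
    using u bij_betw_imp_surj_on[OF semi_iso_bij(1)[OF s' A]] by simp
  then obtain a where a: "a \<in> lcar A" "?u = fst (s' A) a" by auto
  have "lscale (P A) (\<sigma> c) ?u = fst (q A \<epsilon> A) ?u"
    using semi_iso_nat(1)[OF s A A \<epsilon>(1) g] by (simp add: \<epsilon>(2) hom_lscale[OF semi_iso_hom[OF s A]] g)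
  also have "\<dots> = lscale (P A) (\<tau> c) ?u"
    using semi_iso_nat(1)[OF s' A A \<epsilon>(1) a(1)]
    by (simp add: a(2) \<epsilon>a[OF a(1)] hom_lscale[OF semi_iso_hom[OF s' A]] a(1))
  finally have "lscale (P A) (\<sigma> c) ?u = lscale (P A) (\<tau> c) ?u" .
  then show "\<sigma> c = \<tau> c"
    by (rule PA.lie.scale_right_cancel[OF u u0])
qed

end

text \<open>A homomorphism to \<open>twist \<sigma> A\<close> that fixes the generators applies
  \<sigma> to all coefficients. Composing it with the corresponding map for \<tau> cancels the
  twists, and a linear endomorphism fixing the generators is the identity.\<close>

lemma free_semilinear_automorphism:
  fixes X :: "'x set" and Y :: "'y set" and \<sigma> :: "'k::field \<Rightarrow> 'k"
  defines "A \<equiv> free_rep X Y :: ('k, 'x, 'y) free_alg"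
  assumes \<sigma>: "\<sigma> \<in> Aut_k" "\<tau> \<in> Aut_k" "\<tau> \<circ> \<sigma> = (\<lambda>c. c)" "\<sigma> \<circ> \<tau> = (\<lambda>c. c)"
  obtains s t where "s \<in> rep_hom A (twist \<sigma> A)" "t \<in> rep_hom A (twist \<tau> A)"
    "hcomp A t s = hid A" "hcomp A s t = hid A"
proof -
  interpret A: lie_rep A unfolding A_def by (rule lie_rep_free)
  have ex: "\<exists>s\<in>rep_hom A (twist \<rho> A). (\<forall>x\<in>X. fst s (lgen X Y x) = lgen X Y x) \<and> (\<forall>y\<in>Y. snd s (mgen X
      Y y) = mgen X Y y)"
    if "\<rho> \<in> Aut_k" for \<rho>
  proof (rule free_rep_hom[OF lie_rep_twist[OF A.lie_rep_axioms that], of X "lgen X Y" Y "mgen X Y",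
      folded A_def])
    fix \<phi> assume "\<phi> \<in> rep_hom A (twist \<rho> A)" "\<And>x. x \<in> X \<Longrightarrow> fst \<phi> (lgen X Y x) = lgen X Y x"
      "\<And>y. y \<in> Y \<Longrightarrow> snd \<phi> (mgen X Y y) = mgen X Y y"
    then show ?thesis by (intro bexI[of _ \<phi>]) simp_all
  qed (simp_all add: A_def lgen_closed mgen_closed)
  obtain s where s: "s \<in> rep_hom A (twist \<sigma> A)" "\<forall>x\<in>X. fst s (lgen X Y x) = lgen X Y x"
    "\<forall>y\<in>Y. snd s (mgen X Y y) = mgen X Y y"
    using ex[OF \<sigma>(1)] by (elim bexE conjE) (rule that, assumption+)
  obtain t where t: "t \<in> rep_hom A (twist \<tau> A)" "\<forall>x\<in>X. fst t (lgen X Y x) = lgen X Y x"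
    "\<forall>y\<in>Y. snd t (mgen X Y y) = mgen X Y y"
    using ex[OF \<sigma>(2)] by (elim bexE conjE) (rule that, assumption+)
  have l: "x \<in> X \<Longrightarrow> lgen X Y x \<in> lcar A" and m: "y \<in> Y \<Longrightarrow> mgen X Y y \<in> mcar A" for x y
    by (simp_all add: A_def lgen_closed mgen_closed)
  have "hcomp A t s \<in> rep_hom A A"
    using hcomp_hom[OF A.closed s(1) rep_hom_twist[OF t(1), of \<sigma>]] by (simp add: twist_twist \<sigma>(3)
        twist_id)
  from free_rep_hom_unique[OF this[unfolded A_def] hid_hom[OF A.closed, unfolded A_def], folded
      A_def]
  have 1: "hcomp A t s = hid A"
    using s t by (simp add: hcomp_apply hid_apply l m)
  have "hcomp A s t \<in> rep_hom A A"
    using hcomp_hom[OF A.closed t(1) rep_hom_twist[OF s(1), of \<tau>]] by (simp add: twist_twist \<sigma>(4)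
        twist_id)
  from free_rep_hom_unique[OF this[unfolded A_def] hid_hom[OF A.closed, unfolded A_def], folded
      A_def]
  have 2: "hcomp A s t = hid A"
    using s t by (simp add: hcomp_apply hid_apply l m)
  show ?thesis
    by (rule that[OF s(1) t(1) 1 2])
qed

section \<open>Bijective homomorphisms and isomorphisms\<close>

lemma bij_hom_inverse:
  assumes "lie_rep H" "lie_rep G" and \<phi>: "\<phi> \<in> rep_hom H G"
    and l: "bij_betw (fst \<phi>) (lcar H) (lcar G)" and m: "bij_betw (snd \<phi>) (mcar H) (mcar G)"
  obtains \<psi> where "\<psi> \<in> rep_hom G H" "hcomp H \<psi> \<phi> = hid H" "hcomp G \<phi> \<psi> = hid G"
proof -
  interpret H: lie_rep H by fact
  interpret G: lie_rep G by fact
  define f where "f = (\<lambda>x\<in>lcar G. inv_into (lcar H) (fst \<phi>) x)"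
  define g where "g = (\<lambda>v\<in>mcar G. inv_into (mcar H) (snd \<phi>) v)"
  have fc: "f x \<in> lcar H" "fst \<phi> (f x) = x" if "x \<in> lcar G" for x
    using that bij_betwE[OF bij_betw_inv_into[OF l]] bij_betw_inv_into_right[OF l] by (simp_all add:
        f_def)
  have gc: "g v \<in> mcar H" "snd \<phi> (g v) = v" if "v \<in> mcar G" for v
    using that bij_betwE[OF bij_betw_inv_into[OF m]] bij_betw_inv_into_right[OF m] by (simp_all add:
        g_def)
  have f: "f (fst \<phi> x) = x" if "x \<in> lcar H" for x
    using that bij_betw_inv_into_left[OF l] hom_lclosed[OF \<phi>] by (simp add: f_def)
  have g: "g (snd \<phi> v) = v" if "v \<in> mcar H" for v
    using that bij_betw_inv_into_left[OF m] hom_mclosed[OF \<phi>] by (simp add: g_def)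
  have feq: "f y = x" if "x \<in> lcar H" "fst \<phi> x = y" for x y
    using f that by auto
  have geq: "g y = x" if "x \<in> mcar H" "snd \<phi> x = y" for x y
    using g that by auto
  have fg: "f \<in> lcar G \<rightarrow>\<^sub>E lcar H" "g \<in> mcar G \<rightarrow>\<^sub>E mcar H"
    using fc gc by (auto simp: PiE_iff f_def g_def)
  have "(f, g) \<in> rep_hom G H"
  proof (rule rep_homI[OF assms(2,1) fg])
    show "f (ladd G x y) = ladd H (f x) (f y)" if "x \<in> lcar G" "y \<in> lcar G" for x y
      by (rule feq) (simp_all add: that fc hom_simps[OF \<phi>] H.lie.add_closed)
    show "f (lscale G c x) = lscale H c (f x)" if "x \<in> lcar G" for x c
      by (rule feq) (simp_all add: that fc hom_simps[OF \<phi>] H.lie.scale_closed)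
    show "f (lbr G x y) = lbr H (f x) (f y)" if "x \<in> lcar G" "y \<in> lcar G" for x y
      by (rule feq) (simp_all add: that fc hom_simps[OF \<phi>] H.lie.br_closed)
    show "g (madd G x y) = madd H (g x) (g y)" if "x \<in> mcar G" "y \<in> mcar G" for x y
      by (rule geq) (simp_all add: that gc hom_simps[OF \<phi>] H.md.add_closed)
    show "g (mscale G c x) = mscale H c (g x)" if "x \<in> mcar G" for x c
      by (rule geq) (simp_all add: that gc hom_simps[OF \<phi>] H.md.scale_closed)
    show "g (act G x v) = act H (f x) (g v)" if "x \<in> lcar G" "v \<in> mcar G" for x v
      by (rule geq) (simp_all add: that fc gc hom_simps[OF \<phi>] H.act_closed)
  qed
  moreover have "hcomp H (f, g) \<phi> = hid H"
    by (simp add: hcomp_def hid_def compose_def f g cong: restrict_cong)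
  moreover have "hcomp G \<phi> (f, g) = hid G"
    by (simp add: hcomp_def hid_def compose_def fc gc cong: restrict_cong)
  ultimately show ?thesis by (rule that)
qed

lemma inverse_hom_bij:
  assumes \<phi>: "\<phi> \<in> rep_hom H G" and \<psi>: "\<psi> \<in> rep_hom G H"
    and "hcomp H \<psi> \<phi> = hid H" "hcomp G \<phi> \<psi> = hid G"
  shows "bij_betw (fst \<phi>) (lcar H) (lcar G)" "bij_betw (snd \<phi>) (mcar H) (mcar G)"
proof -
  have l: "fst \<psi> (fst \<phi> x) = x" if "x \<in> lcar H" for x
    using hcomp_apply(1)[OF that, of \<psi> \<phi>] unfolding assms(3) by (simp add: hid_apply that)
  have l': "fst \<phi> (fst \<psi> x) = x" if "x \<in> lcar G" for x
    using hcomp_apply(1)[OF that, of \<phi> \<psi>] unfolding assms(4) by (simp add: hid_apply that)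
  have m: "snd \<psi> (snd \<phi> x) = x" if "x \<in> mcar H" for x
    using hcomp_apply(2)[OF that, of \<psi> \<phi>] unfolding assms(3) by (simp add: hid_apply that)
  have m': "snd \<phi> (snd \<psi> x) = x" if "x \<in> mcar G" for x
    using hcomp_apply(2)[OF that, of \<phi> \<psi>] unfolding assms(4) by (simp add: hid_apply that)
  show "bij_betw (fst \<phi>) (lcar H) (lcar G)"
    by (rule bij_betw_byWitness[of _ "fst \<psi>"]) (auto simp: l l' hom_lclosed[OF \<phi>] hom_lclosed[OF \<psi>])
  show "bij_betw (snd \<phi>) (mcar H) (mcar G)"
    by (rule bij_betw_byWitness[of _ "snd \<psi>"]) (auto simp: m m' hom_mclosed[OF \<phi>] hom_mclosed[OF \<psi>])
qed

section \<open>The group of automorphisms\<close>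

lemma theta0_simps:
  "Obj (theta0 K X0 Y0) = objs X0 Y0"
  "(H, \<phi>, G) \<in> Mor (theta0 K X0 Y0) \<longleftrightarrow> H \<in> objs X0 Y0 \<and> G \<in> objs X0 Y0 \<and> \<phi> \<in> rep_hom H G"
  "Dom (theta0 K X0 Y0) (H, \<phi>, G) = H"
  "Cod (theta0 K X0 Y0) (H, \<phi>, G) = G"
  "Ident (theta0 K X0 Y0) H = (H, hid H, H)"
  "Cmp (theta0 K X0 Y0) (H', \<psi>, G') (H, \<phi>, G) = (H, hcomp H \<psi> \<phi>, G')"
  by (simp_all add: theta0_def Let_def objs_def hid_def hcomp_def split_beta)

lemma Bij_inverse:
  assumes "P \<in> Bij S"
  defines "P' \<equiv> \<lambda>x\<in>S. inv_into S P x"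
  shows "P' \<in> Bij S" "\<And>x. x \<in> S \<Longrightarrow> P x \<in> S" "\<And>x. x \<in> S \<Longrightarrow> P' x \<in> S"
    "\<And>x. x \<in> S \<Longrightarrow> P (P' x) = x" "\<And>x. x \<in> S \<Longrightarrow> P' (P x) = x"
proof -
  have b: "bij_betw P S S" using assms(1) by (simp add: Bij_def)
  show "P' \<in> Bij S" unfolding P'_def by (rule restrict_inv_into_Bij[OF assms(1)])
  show P: "P x \<in> S" if "x \<in> S" for x using bij_betwE[OF b] that by simp
  show "P' x \<in> S" if "x \<in> S" for x
    using bij_betwE[OF bij_betw_inv_into[OF b]] that by (simp add: P'_def)
  show "P (P' x) = x" if "x \<in> S" for x
    using bij_betw_inv_into_right[OF b that] that by (simp add: P'_def)
  show "P' (P x) = x" if "x \<in> S" for x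
    using bij_betw_inv_into_left[OF b that] P[OF that] by (simp add: P'_def)
qed

lemma cat_autsD:
  assumes "(P, Q) \<in> cat_auts C"
  shows "P \<in> Bij (Obj C)" "Q \<in> Bij (Mor C)"
    "\<And>f. f \<in> Mor C \<Longrightarrow> Dom C (Q f) = P (Dom C f)" "\<And>f. f \<in> Mor C \<Longrightarrow> Cod C (Q f) = P (Cod C f)"
    "\<And>A. A \<in> Obj C \<Longrightarrow> Q (Ident C A) = Ident C (P A)"
    "\<And>f g. f \<in> Mor C \<Longrightarrow> g \<in> Mor C \<Longrightarrow> Cod C f = Dom C g \<Longrightarrow> Q (Cmp C g f) = Cmp C (Q g) (Q f)"
  using assms by (simp_all add: cat_auts_def)

lemma cat_autsI:
  assumes "P \<in> Bij (Obj C)" "Q \<in> Bij (Mor C)"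
    "\<And>f. f \<in> Mor C \<Longrightarrow> Dom C (Q f) = P (Dom C f)" "\<And>f. f \<in> Mor C \<Longrightarrow> Cod C (Q f) = P (Cod C f)"
    "\<And>A. A \<in> Obj C \<Longrightarrow> Q (Ident C A) = Ident C (P A)"
    "\<And>f g. f \<in> Mor C \<Longrightarrow> g \<in> Mor C \<Longrightarrow> Cod C f = Dom C g \<Longrightarrow> Q (Cmp C g f) = Cmp C (Q g) (Q f)"
  shows "(P, Q) \<in> cat_auts C"
  using assms by (simp add: cat_auts_def)

lemma carrier_BijGroup: "carrier (BijGroup S) = Bij S"
  and one_BijGroup: "\<one>\<^bsub>BijGroup S\<^esub> = (\<lambda>x\<in>S. x)"
  and mult_BijGroup: "f \<in> Bij S \<Longrightarrow> g \<in> Bij S \<Longrightarrow> f \<otimes>\<^bsub>BijGroup S\<^esub> g = compose S f g"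
  by (simp_all add: BijGroup_def)

text \<open>A \<open>category\<close> is a bare record, so the hypotheses supply the closure
  properties. They put identities and composites into the sets on which the bijections can be
  cancelled, which is what functoriality of the inverse needs.\<close>

lemma subgroup_cat_auts:
  assumes dom: "\<And>f. f \<in> Mor C \<Longrightarrow> Dom C f \<in> Obj C" and cod: "\<And>f. f \<in> Mor C \<Longrightarrow> Cod C f \<in> Obj C"
    and ident: "\<And>A. A \<in> Obj C \<Longrightarrow> Ident C A \<in> Mor C"
    and cmp: "\<And>f g. f \<in> Mor C \<Longrightarrow> g \<in> Mor C \<Longrightarrow> Cod C f = Dom C g \<Longrightarrow> Cmp C g f \<in> Mor C"
  shows "subgroup (cat_auts C) (BijGroup (Obj C) \<times>\<times> BijGroup (Mor C))"
proof -
  let ?D = "BijGroup (Obj C) \<times>\<times> BijGroup (Mor C)"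
  interpret D: group ?D
    by (intro DirProd_group group_BijGroup)
  show ?thesis
  proof (rule D.subgroupI)
    show "cat_auts C \<subseteq> carrier ?D"
      by (auto simp: cat_auts_def carrier_BijGroup)
    have "(\<lambda>x\<in>Obj C. x, \<lambda>f\<in>Mor C. f) \<in> cat_auts C"
      by (rule cat_autsI) (simp_all add: id_Bij dom cod ident cmp)
    then show "cat_auts C \<noteq> {}" by blast
  next
    fix \<Upsilon> assume "\<Upsilon> \<in> cat_auts C"
    then obtain P Q where PQ: "\<Upsilon> = (P, Q)" "(P, Q) \<in> cat_auts C" by (cases \<Upsilon>) simp
    note a = cat_autsD[OF PQ(2)]
    define P' where "P' = (\<lambda>x\<in>Obj C. inv_into (Obj C) P x)"
    define Q' where "Q' = (\<lambda>x\<in>Mor C. inv_into (Mor C) Q x)"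
    note p = Bij_inverse[OF a(1), folded P'_def] and q = Bij_inverse[OF a(2), folded Q'_def]
    have "inv\<^bsub>?D\<^esub> \<Upsilon> = (P', Q')"
      using a(1,2) by (simp add: PQ(1) inv_DirProd group_BijGroup carrier_BijGroup inv_BijGroup
          P'_def Q'_def)
    moreover have "(P', Q') \<in> cat_auts C"
    proof (rule cat_autsI)
      show d: "Dom C (Q' f) = P' (Dom C f)" if "f \<in> Mor C" for f
        using a(3)[OF q(3)[OF that]] p(5)[OF dom[OF q(3)[OF that]]] q(4)[OF that] by simp
      show c: "Cod C (Q' f) = P' (Cod C f)" if "f \<in> Mor C" for f
        using a(4)[OF q(3)[OF that]] p(5)[OF cod[OF q(3)[OF that]]] q(4)[OF that] by simp
      show "Q' (Ident C A) = Ident C (P' A)" if "A \<in> Obj C" for A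
        using a(5)[OF p(3)[OF that]] q(5)[OF ident[OF p(3)[OF that]]] p(4)[OF that] by simp
      show "Q' (Cmp C g f) = Cmp C (Q' g) (Q' f)" if fg: "f \<in> Mor C" "g \<in> Mor C" "Cod C f = Dom C g"
          for f g
      proof -
        have cd: "Cod C (Q' f) = Dom C (Q' g)" using c[OF fg(1)] d[OF fg(2)] fg(3) by simp
        have "Q (Cmp C (Q' g) (Q' f)) = Cmp C g f"
          using a(6)[OF q(3)[OF fg(1)] q(3)[OF fg(2)] cd] q(4)[OF fg(1)] q(4)[OF fg(2)] by simp
        then show ?thesis
          using q(5)[OF cmp[OF q(3)[OF fg(1)] q(3)[OF fg(2)] cd]] by simp
      qed
    qed (fact p(1) q(1))+
    ultimately show "inv\<^bsub>?D\<^esub> \<Upsilon> \<in> cat_auts C" by simp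
  next
    fix \<Upsilon> \<Upsilon>' assume "\<Upsilon> \<in> cat_auts C" "\<Upsilon>' \<in> cat_auts C"
    then obtain P Q P' Q' where PQ: "\<Upsilon> = (P, Q)" "(P, Q) \<in> cat_auts C" "\<Upsilon>' = (P', Q')" "(P', Q') \<in>
        cat_auts C"
      by (cases \<Upsilon>, cases \<Upsilon>') simp
    note a = cat_autsD[OF PQ(2)] and a' = cat_autsD[OF PQ(4)]
    note p = Bij_inverse(2)[OF a'(1)] and q = Bij_inverse(2)[OF a'(2)]
    have "(compose (Obj C) P P', compose (Mor C) Q Q') \<in> cat_auts C"
      by (rule cat_autsI)
        (simp_all add: compose_Bij a(1,2) a'(1,2) compose_eq dom cod ident cmp p q a(3-6) a'(3-6))
    then show "\<Upsilon> \<otimes>\<^bsub>?D\<^esub> \<Upsilon>' \<in> cat_auts C"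
      using a(1,2) a'(1,2) by (simp add: PQ(1,3) mult_BijGroup)
  qed
qed

lemma subgroup_field_auts:
  "subgroup {\<sigma> \<in> Bij UNIV. (\<forall>a b. \<sigma> (a + b) = \<sigma> a + \<sigma> b) \<and> (\<forall>a b. \<sigma> (a * b) = \<sigma> a * \<sigma> b) \<and> \<sigma> 1 = 1}
    (BijGroup (UNIV :: 'k::field set))"
proof -
  interpret B: group "BijGroup (UNIV :: 'k set)" by (rule group_BijGroup)
  let ?A = "{\<sigma> \<in> Bij (UNIV :: 'k set). (\<forall>a b. \<sigma> (a + b) = \<sigma> a + \<sigma> b) \<and> (\<forall>a b. \<sigma> (a * b) = \<sigma> a * \<sigma> b)
      \<and> \<sigma> 1 = 1}"
  show ?thesis
  proof (rule B.subgroupI)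
    show "?A \<subseteq> carrier (BijGroup UNIV)" by (auto simp: carrier_BijGroup)
    have "(\<lambda>x\<in>UNIV. x) \<in> ?A" using id_Bij[of "UNIV :: 'k set"] by simp
    then show "?A \<noteq> {}" by blast
  next
    fix \<sigma> assume \<sigma>: "\<sigma> \<in> ?A"
    define \<tau> where "\<tau> = (\<lambda>x\<in>UNIV. inv_into UNIV \<sigma> x)"
    have \<sigma>B: "\<sigma> \<in> Bij UNIV" using \<sigma> by simp
    note t = Bij_inverse[OF \<sigma>B, folded \<tau>_def]
    have \<tau>I: "\<tau> y = x" if "\<sigma> x = y" for x y using t(5)[of x] that by simp
    have st: "\<sigma> (\<tau> x) = x" for x by (rule t(4)) simp
    have "\<tau> (a + b) = \<tau> a + \<tau> b" "\<tau> (a * b) = \<tau> a * \<tau> b" "\<tau> 1 = 1" for a b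
      using \<sigma> by (auto intro!: \<tau>I simp: st)
    then have "\<tau> \<in> ?A" using t(1) by simp
    then show "inv\<^bsub>BijGroup UNIV\<^esub> \<sigma> \<in> ?A"
      using \<sigma>B by (simp add: inv_BijGroup \<tau>_def)
  next
    fix \<sigma> \<tau> assume "\<sigma> \<in> ?A" "\<tau> \<in> ?A"
    then show "\<sigma> \<otimes>\<^bsub>BijGroup UNIV\<^esub> \<tau> \<in> ?A"
      by (simp add: mult_BijGroup compose_Bij compose_eq)
  qed
qed

lemma group_field_aut: "group (field_aut_group :: ('k::field \<Rightarrow> 'k) monoid)"
  unfolding field_aut_group_def
  by (rule subgroup.subgroup_is_group[OF subgroup_field_auts group_BijGroup])

lemma field_aut_mult:
  assumes "\<sigma> \<in> Aut_k" "\<tau> \<in> Aut_k"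
  shows "\<sigma> \<otimes>\<^bsub>field_aut_group\<^esub> \<tau> = \<sigma> \<circ> \<tau>"
proof -
  have "\<sigma> \<in> Bij UNIV" "\<tau> \<in> Bij UNIV"
    using assms by (simp_all add: field_aut_group_def)
  then show ?thesis
    by (simp add: field_aut_group_def mult_BijGroup compose_def comp_def restrict_def)
qed

lemma field_aut_one: "\<one>\<^bsub>field_aut_group\<^esub> = (\<lambda>c. c)"
  by (simp add: field_aut_group_def one_BijGroup restrict_def)

lemma Aut_k_inverse:
  assumes "\<sigma> \<in> Aut_k"
  obtains \<tau> where "\<tau> \<in> Aut_k" "\<tau> \<circ> \<sigma> = (\<lambda>c. c)" "\<sigma> \<circ> \<tau> = (\<lambda>c. c)"
proof -
  interpret group "field_aut_group :: ('a \<Rightarrow> 'a) monoid" by (rule group_field_aut)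
  let ?\<tau> = "inv\<^bsub>field_aut_group\<^esub> \<sigma>"
  have \<tau>: "?\<tau> \<in> Aut_k" by (rule inv_closed[OF assms])
  show ?thesis
    by (rule that[OF \<tau>])
      (use l_inv[OF assms] r_inv[OF assms] in \<open>simp_all add: field_aut_mult assms \<tau> field_aut_one\<close>)
qed

section \<open>The homomorphism from the automorphism group of the category to the automorphism
  group of the field\<close>

type_synonym ('k, 'x, 'y) free_aut =
  "(('k, 'x, 'y) free_alg \<Rightarrow> ('k, 'x, 'y) free_alg) \<times> (('k, 'x, 'y) free_mor \<Rightarrow> ('k, 'x, 'y)
      free_mor)"

text \<open>The map on hom-sets that plays the role of \<open>q\<close> in
  \<open>free_functor\<close>. The outer components of the image morphism carry no further
  information, as the object map determines them.\<close>

definition hom_map where "hom_map \<Upsilon> A \<phi> B = fst (snd (snd \<Upsilon> (A, \<phi>, B)))"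

locale theta0_aut =
  fixes X0 :: "'x set" and Y0 :: "'y set" and T :: "(('k::field_char_0, 'x, 'y) free_alg, ('k, 'x,
      'y) free_mor) category"
  defines "T \<equiv> theta0 TYPE('k) X0 Y0"
  assumes inf: "infinite X0" "infinite Y0"
begin

abbreviation "Ob \<equiv> (objs X0 Y0 :: ('k, 'x, 'y) free_alg set)"

lemmas T_simps = theta0_simps[where K = "TYPE('k)" and ?X0.0 = X0 and ?Y0.0 = Y0, folded T_def]

lemma MorE:
  assumes "f \<in> Mor T"
  obtains A \<phi> B where "f = (A, \<phi>, B)" "A \<in> Ob" "B \<in> Ob" "\<phi> \<in> rep_hom A B"
  by (cases f) (use assms T_simps(2) that in auto)

lemma T_closed:
  shows "f \<in> Mor T \<Longrightarrow> Dom T f \<in> Obj T" "f \<in> Mor T \<Longrightarrow> Cod T f \<in> Obj T"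
    and "A \<in> Obj T \<Longrightarrow> Ident T A \<in> Mor T"
    and "f \<in> Mor T \<Longrightarrow> g \<in> Mor T \<Longrightarrow> Cod T f = Dom T g \<Longrightarrow> Cmp T g f \<in> Mor T"
proof -
  show "f \<in> Mor T \<Longrightarrow> Dom T f \<in> Obj T" "f \<in> Mor T \<Longrightarrow> Cod T f \<in> Obj T"
    by (elim MorE, simp add: T_simps)+
  show "A \<in> Obj T \<Longrightarrow> Ident T A \<in> Mor T"
    by (simp add: T_simps hid_hom objs_closed)
  show "f \<in> Mor T \<Longrightarrow> g \<in> Mor T \<Longrightarrow> Cod T f = Dom T g \<Longrightarrow> Cmp T g f \<in> Mor T"
    by (elim MorE) (simp add: T_simps hcomp_hom objs_closed)
qed

lemma group_T: "group (cat_aut_group T)"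
  unfolding cat_aut_group_def
  by (rule subgroup.subgroup_is_group[OF subgroup_cat_auts DirProd_group])
    (simp_all add: T_closed group_BijGroup)

lemma carrier_T: "carrier (cat_aut_group T) = cat_auts T"
  by (simp add: cat_aut_group_def)

lemma hom_map:
  assumes "\<Upsilon> \<in> cat_auts T" "A \<in> Ob" "B \<in> Ob" "\<phi> \<in> rep_hom A B"
  shows "snd \<Upsilon> (A, \<phi>, B) = (fst \<Upsilon> A, hom_map \<Upsilon> A \<phi> B, fst \<Upsilon> B)"
    and "fst \<Upsilon> A \<in> Ob" "hom_map \<Upsilon> A \<phi> B \<in> rep_hom (fst \<Upsilon> A) (fst \<Upsilon> B)"
proof -
  obtain P Q where PQ: "\<Upsilon> = (P, Q)" "(P, Q) \<in> cat_auts T" using assms(1) by (cases \<Upsilon>) simp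
  note a = cat_autsD[OF PQ(2)]
  have f: "(A, \<phi>, B) \<in> Mor T" using assms by (simp add: T_simps)
  obtain A' \<phi>' B' where Q: "Q (A, \<phi>, B) = (A', \<phi>', B')" "\<phi>' \<in> rep_hom A' B'" "A' \<in> Ob"
    by (rule MorE[OF Bij_inverse(2)[OF a(2) f]])
  have "A' = P A" "B' = P B"
    using a(3)[OF f] a(4)[OF f] by (simp_all add: Q(1) T_simps)
  then show "snd \<Upsilon> (A, \<phi>, B) = (fst \<Upsilon> A, hom_map \<Upsilon> A \<phi> B, fst \<Upsilon> B)" "fst \<Upsilon> A \<in> Ob"
    "hom_map \<Upsilon> A \<phi> B \<in> rep_hom (fst \<Upsilon> A) (fst \<Upsilon> B)"
    using Q by (simp_all add: PQ(1) hom_map_def)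
qed

lemma free_functor:
  assumes \<Upsilon>: "\<Upsilon> \<in> cat_auts T"
  shows "free_functor X0 Y0 (fst \<Upsilon>) (hom_map \<Upsilon>)"
proof -
  obtain P Q where PQ: "\<Upsilon> = (P, Q)" "(P, Q) \<in> cat_auts T" using assms(1) by (cases \<Upsilon>) simp
  note a = cat_autsD[OF PQ(2)]
  note h = hom_map[OF \<Upsilon>, unfolded PQ(1) fst_conv snd_conv]
  have P: "bij_betw P Ob Ob" and Q: "bij_betw Q (Mor T) (Mor T)"
    using a(1,2) by (simp_all add: Bij_def T_simps)
  have "free_functor X0 Y0 P (hom_map (P, Q))"
  proof
    show "infinite X0" "infinite Y0" by (fact inf)+
    show "bij_betw P Ob Ob" by (rule P)
    show "hom_map (P, Q) A (hid A) A = hid (P A)" if "A \<in> Ob" for A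
      using a(5)[of A] that by (simp add: T_simps hom_map_def)
    show "hom_map (P, Q) A (hcomp A \<psi> \<phi>) C = hcomp (P A) (hom_map (P, Q) B \<psi> C) (hom_map (P, Q) A \<phi>
        B)"
      if "A \<in> Ob" "B \<in> Ob" "C \<in> Ob" "\<phi> \<in> rep_hom A B" "\<psi> \<in> rep_hom B C" for A B C \<phi> \<psi>
    proof -
      have "Q (Cmp T (B, \<psi>, C) (A, \<phi>, B)) = Cmp T (Q (B, \<psi>, C)) (Q (A, \<phi>, B))"
        by (rule a(6)) (simp_all add: T_simps that)
      then show ?thesis
        using that by (simp add: T_simps h hcomp_hom objs_closed)
    qed
    show "bij_betw (\<lambda>\<phi>. hom_map (P, Q) A \<phi> B) (rep_hom A B) (rep_hom (P A) (P B))"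
      if AB: "A \<in> Ob" "B \<in> Ob" for A B
    proof (rule bij_betwI')
      show "hom_map (P, Q) A \<phi> B = hom_map (P, Q) A \<psi> B \<longleftrightarrow> \<phi> = \<psi>"
        if \<phi>\<psi>: "\<phi> \<in> rep_hom A B" "\<psi> \<in> rep_hom A B" for \<phi> \<psi>
      proof
        assume "hom_map (P, Q) A \<phi> B = hom_map (P, Q) A \<psi> B"
        then have "Q (A, \<phi>, B) = Q (A, \<psi>, B)" using h[OF AB] \<phi>\<psi> by simp
        then have "(A, \<phi>, B) = (A, \<psi>, B)"
          by (rule inj_onD[OF bij_betw_imp_inj_on[OF Q]]) (simp_all add: T_simps AB \<phi>\<psi>)
        then show "\<phi> = \<psi>" by simp
      qed simp
      show "hom_map (P, Q) A \<phi> B \<in> rep_hom (P A) (P B)" if "\<phi> \<in> rep_hom A B" for \<phi>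
        using h(3)[OF AB that] .
      fix \<psi> assume \<psi>: "\<psi> \<in> rep_hom (P A) (P B)"
      have "(P A, \<psi>, P B) \<in> Mor T"
        using \<psi> AB bij_betwE[OF P] by (simp add: T_simps)
      then have "(P A, \<psi>, P B) \<in> Q ` Mor T"
        using bij_betw_imp_surj_on[OF Q] by simp
      then obtain f where f: "f \<in> Mor T" "Q f = (P A, \<psi>, P B)" by auto
      obtain A' \<phi> B' where A': "f = (A', \<phi>, B')" "A' \<in> Ob" "B' \<in> Ob" "\<phi> \<in> rep_hom A' B'" by (rule
          MorE[OF f(1)])
      \<comment> \<open>A preimage of a morphism from \<open>P A\<close> to \<open>P B\<close> might
        run between other objects; injectivity of \<open>P\<close> identifies them with
        \<open>A\<close> and \<open>B\<close>.\<close>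
      have eq: "(P A', hom_map (P, Q) A' \<phi> B', P B') = (P A, \<psi>, P B)"
        using h(1)[OF A'(2-4)] f(2) A'(1) by simp
      then have "A' = A" "B' = B"
        using inj_onD[OF bij_betw_imp_inj_on[OF P]] A'(2,3) AB by simp_all
      then show "\<exists>\<phi>\<in>rep_hom A B. \<psi> = hom_map (P, Q) A \<phi> B"
        using eq A'(4) by (intro bexI[of _ \<phi>]) simp_all
    qed
  qed
  then show ?thesis by (simp add: PQ(1))
qed

definition semi :: "('k \<Rightarrow> 'k) \<Rightarrow> ('k, 'x, 'y) free_aut \<Rightarrow> bool" where
  "semi \<sigma> \<Upsilon> \<longleftrightarrow> (\<exists>s. semi_iso X0 Y0 \<sigma> (fst \<Upsilon>) (hom_map \<Upsilon>) s)"

lemma ex_semi: "\<Upsilon> \<in> cat_auts T \<Longrightarrow> \<exists>\<sigma>\<in>Aut_k. semi \<sigma> \<Upsilon>"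
  unfolding semi_def by (rule free_functor.ex_semi_iso[OF free_functor])

lemma semi_unique: "\<Upsilon> \<in> cat_auts T \<Longrightarrow> semi \<sigma> \<Upsilon> \<Longrightarrow> semi \<tau> \<Upsilon> \<Longrightarrow> \<sigma> = \<tau>"
  unfolding semi_def by (elim exE) (rule free_functor.semi_iso_unique[OF free_functor])

lemma mult_T:
  assumes "\<Upsilon> \<in> cat_auts T" "\<Upsilon>' \<in> cat_auts T"
  shows "\<Upsilon>' \<otimes>\<^bsub>cat_aut_group T\<^esub> \<Upsilon> = (compose (Obj T) (fst \<Upsilon>') (fst \<Upsilon>), compose (Mor T) (snd \<Upsilon>') (snd
      \<Upsilon>))"
  using assms by (auto simp: cat_aut_group_def cat_auts_def mult_BijGroup)

text \<open>The natural families compose, the one for \<Upsilon>' being taken at the object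
  \<Upsilon> A. A scalar passes \<sigma> first and \<tau> second, in agreement with the order of the
  product.\<close>

lemma semi_mult:
  assumes \<Upsilon>: "\<Upsilon> \<in> cat_auts T" "\<Upsilon>' \<in> cat_auts T" and semi: "semi \<sigma> \<Upsilon>" "semi \<tau> \<Upsilon>'"
  shows "semi (\<tau> \<circ> \<sigma>) (\<Upsilon>' \<otimes>\<^bsub>cat_aut_group T\<^esub> \<Upsilon>)"
proof -
  obtain s where s: "semi_iso X0 Y0 \<sigma> (fst \<Upsilon>) (hom_map \<Upsilon>) s" using semi(1) by (auto simp: semi_def)
  obtain t where t: "semi_iso X0 Y0 \<tau> (fst \<Upsilon>') (hom_map \<Upsilon>') t" using semi(2) by (auto simp:
      semi_def)
  let ?U = "\<Upsilon>' \<otimes>\<^bsub>cat_aut_group T\<^esub> \<Upsilon>"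
  have P: "fst ?U A = fst \<Upsilon>' (fst \<Upsilon> A)" if "A \<in> Ob" for A
    using that by (simp add: mult_T[OF \<Upsilon>] compose_eq T_simps)
  have q: "hom_map ?U A \<phi> B = hom_map \<Upsilon>' (fst \<Upsilon> A) (hom_map \<Upsilon> A \<phi> B) (fst \<Upsilon> B)"
    if "A \<in> Ob" "B \<in> Ob" "\<phi> \<in> rep_hom A B" for A B \<phi>
  proof -
    have "snd ?U (A, \<phi>, B) = snd \<Upsilon>' (snd \<Upsilon> (A, \<phi>, B))"
      using that by (simp add: mult_T[OF \<Upsilon>] compose_eq T_simps)
    also have "\<dots> = snd \<Upsilon>' (fst \<Upsilon> A, hom_map \<Upsilon> A \<phi> B, fst \<Upsilon> B)"
      by (simp only: hom_map(1)[OF \<Upsilon>(1) that])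
    finally show ?thesis
      by (simp only: hom_map_def[of ?U] hom_map_def[of \<Upsilon>'])
  qed
  have PA: "fst \<Upsilon> A \<in> Ob" if "A \<in> Ob" for A
    using hom_map(2)[OF \<Upsilon>(1) that that hid_hom[OF objs_closed[OF that]]] .
  define u where "u A = hcomp A (t (fst \<Upsilon> A)) (s A)" for A
  have "u A \<in> rep_hom A (twist (\<tau> \<circ> \<sigma>) (fst ?U A))" if A: "A \<in> Ob" for A
    using hcomp_hom[OF objs_closed[OF A] semi_iso_hom[OF s A] rep_hom_twist[OF semi_iso_hom[OF t
        PA[OF A]], of \<sigma>]]
    by (simp add: u_def P[OF A] twist_twist)
  moreover have "bij_betw (fst (u A)) (lcar A) (lcar (fst ?U A))" if A: "A \<in> Ob" for A
    using bij_betw_trans[OF semi_iso_bij(1)[OF s A] semi_iso_bij(1)[OF t PA[OF A]]] unfolding P[OF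
        A]
    by (rule bij_betw_cong[THEN iffD1, rotated]) (simp add: u_def hcomp_apply)
  moreover have "bij_betw (snd (u A)) (mcar A) (mcar (fst ?U A))" if A: "A \<in> Ob" for A
    using bij_betw_trans[OF semi_iso_bij(2)[OF s A] semi_iso_bij(2)[OF t PA[OF A]]] unfolding P[OF
        A]
    by (rule bij_betw_cong[THEN iffD1, rotated]) (simp add: u_def hcomp_apply)
  moreover have "fst (hom_map ?U A \<phi> B) (fst (u A) a) = fst (u B) (fst \<phi> a)"
    if AB: "A \<in> Ob" "B \<in> Ob" and \<phi>: "\<phi> \<in> rep_hom A B" and a: "a \<in> lcar A" for A B \<phi> a
    using semi_iso_nat(1)[OF t PA[OF AB(1)] PA[OF AB(2)] hom_map(3)[OF \<Upsilon>(1) AB \<phi>]]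
      semi_iso_nat(1)[OF s AB \<phi> a] hom_lclosed[OF semi_iso_hom[OF s AB(1)] a] hom_lclosed[OF \<phi> a] a
    by (simp add: q[OF AB \<phi>] u_def hcomp_apply)
  moreover have "snd (hom_map ?U A \<phi> B) (snd (u A) a) = snd (u B) (snd \<phi> a)"
    if AB: "A \<in> Ob" "B \<in> Ob" and \<phi>: "\<phi> \<in> rep_hom A B" and a: "a \<in> mcar A" for A B \<phi> a
    using semi_iso_nat(2)[OF t PA[OF AB(1)] PA[OF AB(2)] hom_map(3)[OF \<Upsilon>(1) AB \<phi>]]
      semi_iso_nat(2)[OF s AB \<phi> a] hom_mclosed[OF semi_iso_hom[OF s AB(1)] a] hom_mclosed[OF \<phi> a] a
    by (simp add: q[OF AB \<phi>] u_def hcomp_apply)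
  ultimately have "semi_iso X0 Y0 (\<tau> \<circ> \<sigma>) (fst ?U) (hom_map ?U) u"
    unfolding semi_iso_def by simp
  then show ?thesis
    unfolding semi_def by (rule exI[of _ u])
qed

text \<open>For the identity of the field twisting does nothing, so the family consists of bijective
  homomorphisms. These are isomorphisms, because the inverse of a bijective homomorphism is a
  homomorphism, and naturality means the same on both sides.\<close>

lemma semi_id_iff_inner:
  assumes \<Upsilon>: "\<Upsilon> \<in> cat_auts T"
  shows "semi (\<lambda>c. c) \<Upsilon> \<longleftrightarrow> \<Upsilon> \<in> inner_auts T"
proof
  have PA: "fst \<Upsilon> A \<in> Ob" if "A \<in> Ob" for A
    using hom_map(2)[OF \<Upsilon> that that hid_hom[OF objs_closed[OF that]]] .
  {
    assume "semi (\<lambda>c. c) \<Upsilon>"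
    then obtain s where s: "semi_iso X0 Y0 (\<lambda>c. c) (fst \<Upsilon>) (hom_map \<Upsilon>) s" by (auto simp: semi_def)
    have sA: "s A \<in> rep_hom A (fst \<Upsilon> A)" if "A \<in> Ob" for A
      using semi_iso_hom[OF s that] by (simp add: twist_id)
    let ?s = "\<lambda>A. (A, s A, fst \<Upsilon> A)"
    have "iso_mor T (?s A) \<and> Dom T (?s A) = A \<and> Cod T (?s A) = fst \<Upsilon> A" if A: "A \<in> Ob" for A
    proof -
      obtain \<psi> where \<psi>: "\<psi> \<in> rep_hom (fst \<Upsilon> A) A" "hcomp A \<psi> (s A) = hid A" "hcomp (fst \<Upsilon> A) (s A) \<psi>
          = hid (fst \<Upsilon> A)"
        by (rule bij_hom_inverse[OF objs_lie_rep[OF A] objs_lie_rep[OF PA[OF A]] sA[OF A]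
            semi_iso_bij[OF s A]])
      then show ?thesis
        unfolding iso_mor_def
        by (intro conjI bexI[of _ "(fst \<Upsilon> A, \<psi>, A)"]) (simp_all add: T_simps A PA sA)
    qed
    moreover have "Cmp T (snd \<Upsilon> f) (?s (Dom T f)) = Cmp T (?s (Cod T f)) f" if f: "f \<in> Mor T" for f
    proof -
      obtain A \<phi> B where AB: "f = (A, \<phi>, B)" "A \<in> Ob" "B \<in> Ob" "\<phi> \<in> rep_hom A B" by (rule MorE[OF
          f])
      have "hcomp A (hom_map \<Upsilon> A \<phi> B) (s A) = hcomp A (s B) \<phi>"
        by (rule hom_eqI[OF hcomp_hom[OF objs_closed[OF AB(2)] sA[OF AB(2)] hom_map(3)[OF \<Upsilon>
            AB(2-4)]]
              hcomp_hom[OF objs_closed[OF AB(2)] AB(4) sA[OF AB(3)]]])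
          (simp_all add: hcomp_apply semi_iso_nat[OF s AB(2-4)])
      then show ?thesis
        by (simp add: AB(1) T_simps hom_map(1)[OF \<Upsilon> AB(2-4)])
    qed
    ultimately show "\<Upsilon> \<in> inner_auts T"
      unfolding inner_auts_def using \<Upsilon>
      by (cases \<Upsilon>) (auto simp: T_simps(1) intro!: exI[of _ ?s])
  next
    assume "\<Upsilon> \<in> inner_auts T"
    then obtain s where "\<forall>A\<in>Ob. iso_mor T (s A) \<and> Dom T (s A) = A \<and> Cod T (s A) = fst \<Upsilon> A"
      and nat: "\<forall>f\<in>Mor T. Cmp T (snd \<Upsilon> f) (s (Dom T f)) = Cmp T (s (Cod T f)) f"
      by (auto simp: inner_auts_def T_simps(1))
    then have s: "iso_mor T (s A)" "Dom T (s A) = A" "Cod T (s A) = fst \<Upsilon> A" if "A \<in> Ob" for A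
      using that by simp_all
    define u where "u A = fst (snd (s A))" for A
    have sA: "s A = (A, u A, fst \<Upsilon> A)" if "A \<in> Ob" for A
      using s[OF that] by (cases "s A") (simp add: T_simps u_def)
    have u: "u A \<in> rep_hom A (fst \<Upsilon> A)" "bij_betw (fst (u A)) (lcar A) (lcar (fst \<Upsilon> A))"
      "bij_betw (snd (u A)) (mcar A) (mcar (fst \<Upsilon> A))" if A: "A \<in> Ob" for A
    proof -
      obtain g where g: "g \<in> Mor T" "Dom T g = fst \<Upsilon> A" "Cod T g = A"
        "Cmp T g (s A) = Ident T A" "Cmp T (s A) g = Ident T (fst \<Upsilon> A)" "s A \<in> Mor T"
        using s(1)[OF A] unfolding iso_mor_def s(2,3)[OF A] by auto
      show 1: "u A \<in> rep_hom A (fst \<Upsilon> A)"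
        using g(6) by (simp add: sA[OF A] T_simps)
      obtain B \<psi> C where gt: "g = (B, \<psi>, C)" "\<psi> \<in> rep_hom B C" by (rule MorE[OF g(1)])
      have BC: "B = fst \<Upsilon> A" "C = A" using g(2,3) by (simp_all add: gt T_simps)
      have "hcomp A \<psi> (u A) = hid A" "hcomp (fst \<Upsilon> A) (u A) \<psi> = hid (fst \<Upsilon> A)"
        using g(4,5) by (simp_all add: gt BC sA[OF A] T_simps)
      from inverse_hom_bij[OF 1 gt(2)[unfolded BC] this]
      show "bij_betw (fst (u A)) (lcar A) (lcar (fst \<Upsilon> A))" "bij_betw (snd (u A)) (mcar A) (mcar
          (fst \<Upsilon> A))" .
    qed
    have n: "hcomp A (hom_map \<Upsilon> A \<phi> B) (u A) = hcomp A (u B) \<phi>"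
      if "A \<in> Ob" "B \<in> Ob" "\<phi> \<in> rep_hom A B" for A B \<phi>
      using bspec[OF nat, of "(A, \<phi>, B)"] that by (simp add: T_simps sA hom_map(1)[OF \<Upsilon> that])
    have "fst (hom_map \<Upsilon> A \<phi> B) (fst (u A) a) = fst (u B) (fst \<phi> a)"
      if "A \<in> Ob" "B \<in> Ob" "\<phi> \<in> rep_hom A B" "a \<in> lcar A" for A B \<phi> a
      using hcomp_apply(1)[OF that(4), of "hom_map \<Upsilon> A \<phi> B" "u A"] hcomp_apply(1)[OF that(4), of "u
          B" \<phi>]
      unfolding n[OF that(1-3)] by simp
    moreover have "snd (hom_map \<Upsilon> A \<phi> B) (snd (u A) a) = snd (u B) (snd \<phi> a)"
      if "A \<in> Ob" "B \<in> Ob" "\<phi> \<in> rep_hom A B" "a \<in> mcar A" for A B \<phi> a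
      using hcomp_apply(2)[OF that(4), of "hom_map \<Upsilon> A \<phi> B" "u A"] hcomp_apply(2)[OF that(4), of "u
          B" \<phi>]
      unfolding n[OF that(1-3)] by simp
    ultimately have "semi_iso X0 Y0 (\<lambda>c. c) (fst \<Upsilon>) (hom_map \<Upsilon>) u"
      unfolding semi_iso_def by (simp add: u twist_id)
    then show "semi (\<lambda>c. c) \<Upsilon>"
      unfolding semi_def by (rule exI[of _ u])
  }
qed

text \<open>The automorphism fixes all objects and conjugates morphisms by the coefficientwise maps.
  A conjugate is linear since the field automorphisms of its two outer factors are inverse to each
  other, and the coefficientwise maps form the required natural family.\<close>

lemma semi_surj:
  assumes \<sigma>: "\<sigma> \<in> Aut_k"
  shows "\<exists>\<Upsilon>\<in>cat_auts T. semi \<sigma> \<Upsilon>"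
proof -
  obtain \<tau> where \<tau>: "\<tau> \<in> Aut_k" "\<tau> \<circ> \<sigma> = (\<lambda>c. c)" "\<sigma> \<circ> \<tau> = (\<lambda>c. c)" by (rule Aut_k_inverse[OF \<sigma>])
  have "\<exists>s t. s \<in> rep_hom A (twist \<sigma> A) \<and> t \<in> rep_hom A (twist \<tau> A) \<and> hcomp A t s = hid A \<and> hcomp A
      s t = hid A"
    if A: "A \<in> Ob" for A
  proof -
    obtain X Y where XY: "A = free_rep X Y" by (rule objsE[OF A])
    show ?thesis
      unfolding XY by (rule free_semilinear_automorphism[OF \<sigma> \<tau>]) (intro exI conjI)
  qed
  then obtain s t where s: "\<And>A. A \<in> Ob \<Longrightarrow> s A \<in> rep_hom A (twist \<sigma> A)"
    and t: "\<And>A. A \<in> Ob \<Longrightarrow> t A \<in> rep_hom A (twist \<tau> A)"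
    and ts: "\<And>A. A \<in> Ob \<Longrightarrow> hcomp A (t A) (s A) = hid A" and st: "\<And>A. A \<in> Ob \<Longrightarrow> hcomp A (s A) (t A) =
        hid A"
    by metis
  have tsl: "fst (t A) (fst (s A) a) = a" and stl: "fst (s A) (fst (t A) a) = a" if "A \<in> Ob" "a \<in>
      lcar A" for A a
    using hcomp_apply(1)[OF that(2), of "t A" "s A"] hcomp_apply(1)[OF that(2), of "s A" "t A"]
    unfolding ts[OF that(1)] st[OF that(1)] by (simp_all add: hid_apply that)
  have tsm: "snd (t A) (snd (s A) a) = a" and stm: "snd (s A) (snd (t A) a) = a" if "A \<in> Ob" "a \<in>
      mcar A" for A a
    using hcomp_apply(2)[OF that(2), of "t A" "s A"] hcomp_apply(2)[OF that(2), of "s A" "t A"]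
    unfolding ts[OF that(1)] st[OF that(1)] by (simp_all add: hid_apply that)
  note sc = hom_lclosed[OF s, simplified] hom_mclosed[OF s, simplified]
  note tc = hom_lclosed[OF t, simplified] hom_mclosed[OF t, simplified]
  \<comment> \<open>\<open>q\<close> is the conjugation that defines the automorphism;
    \<open>r\<close>, the conjugation in the opposite direction, witnesses that it is bijective on
    morphisms.\<close>
  define q where "q A \<phi> B = hcomp A (s B) (hcomp A \<phi> (t A))" for A \<phi> B
  define r where "r A \<phi> B = hcomp A (t B) (hcomp A \<phi> (s A))" for A \<phi> B
  have q: "q A \<phi> B \<in> rep_hom A B" if AB: "A \<in> Ob" "B \<in> Ob" "\<phi> \<in> rep_hom A B" for A B \<phi>
    using hcomp_hom[OF objs_closed[OF AB(1)] hcomp_hom[OF objs_closed[OF AB(1)] t[OF AB(1)]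
        rep_hom_twist[OF AB(3)]]
        rep_hom_twist[OF s[OF AB(2)], of \<tau>]]
    by (simp add: q_def twist_twist \<tau> twist_id)
  have r: "r A \<phi> B \<in> rep_hom A B" if AB: "A \<in> Ob" "B \<in> Ob" "\<phi> \<in> rep_hom A B" for A B \<phi>
    using hcomp_hom[OF objs_closed[OF AB(1)] hcomp_hom[OF objs_closed[OF AB(1)] s[OF AB(1)]
        rep_hom_twist[OF AB(3)]]
        rep_hom_twist[OF t[OF AB(2)], of \<sigma>]]
    by (simp add: r_def twist_twist \<tau> twist_id)
  have rq: "r A (q A \<phi> B) B = \<phi>" and qr: "q A (r A \<phi> B) B = \<phi>" if AB: "A \<in> Ob" "B \<in> Ob" "\<phi> \<in> rep_hom
      A B" for A B \<phi>
  proof -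
    show "r A (q A \<phi> B) B = \<phi>"
      by (rule hom_eqI[OF r[OF AB(1,2) q[OF AB]] AB(3)])
        (simp_all add: r_def q_def hcomp_apply sc tc AB tsl tsm stl stm hom_lclosed[OF AB(3)]
            hom_mclosed[OF AB(3)])
    show "q A (r A \<phi> B) B = \<phi>"
      by (rule hom_eqI[OF q[OF AB(1,2) r[OF AB]] AB(3)])
        (simp_all add: r_def q_def hcomp_apply sc tc AB tsl tsm stl stm hom_lclosed[OF AB(3)]
            hom_mclosed[OF AB(3)])
  qed
  define P where "P = (\<lambda>A\<in>Obj T. A)"
  define Q where "Q = (\<lambda>f\<in>Mor T. (fst f, q (fst f) (fst (snd f)) (snd (snd f)), snd (snd f)))"
  have QE: "Q (A, \<phi>, B) = (A, q A \<phi> B, B)" if "A \<in> Ob" "B \<in> Ob" "\<phi> \<in> rep_hom A B" for A B \<phi>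
    using that by (simp add: Q_def T_simps)
  have PE: "P A = A" if "A \<in> Ob" for A
    using that by (simp add: P_def T_simps)
  have "bij_betw Q (Mor T) (Mor T)"
    by (rule bij_betw_byWitness[of _ "\<lambda>f. (fst f, r (fst f) (fst (snd f)) (snd (snd f)), snd (snd
        f))"])
      (auto elim!: MorE simp: QE q r rq qr T_simps)
  then have QB: "Q \<in> Bij (Mor T)"
    by (simp add: Bij_def Q_def)
  have qid: "q A (hid A) A = hid A" if A: "A \<in> Ob" for A
  proof -
    have h: "hid A \<in> rep_hom A A" by (rule hid_hom[OF objs_closed[OF A]])
    show ?thesis
      by (rule hom_eqI[OF q[OF A A h] h]) (simp_all add: q_def hcomp_apply hid_apply tc A stl stm)
  qed
  have qcomp: "q A (hcomp A \<psi> \<phi>) C = hcomp A (q B \<psi> C) (q A \<phi> B)"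
    if A: "A \<in> Ob" "B \<in> Ob" "C \<in> Ob" "\<phi> \<in> rep_hom A B" "\<psi> \<in> rep_hom B C" for A B C \<phi> \<psi>
    by (rule hom_eqI[OF q[OF A(1,3) hcomp_hom[OF objs_closed[OF A(1)] A(4,5)]]
          hcomp_hom[OF objs_closed[OF A(1)] q[OF A(1,2,4)] q[OF A(2,3,5)]]])
      (simp_all add: q_def hcomp_apply sc tc A tsl tsm hom_lclosed[OF A(4)] hom_mclosed[OF A(4)])
  have "(P, Q) \<in> cat_auts T"
  proof (rule cat_autsI)
    show "P \<in> Bij (Obj T)" unfolding P_def by (rule id_Bij)
    show "Q \<in> Bij (Mor T)" by (rule QB)
    show "Dom T (Q f) = P (Dom T f)" "Cod T (Q f) = P (Cod T f)" if "f \<in> Mor T" for f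
      using that by (auto elim!: MorE simp: QE PE T_simps)
    show "Q (Ident T A) = Ident T (P A)" if "A \<in> Obj T" for A
      using that by (simp add: T_simps QE PE qid hid_hom objs_closed)
    show "Q (Cmp T g f) = Cmp T (Q g) (Q f)" if fg: "f \<in> Mor T" "g \<in> Mor T" "Cod T f = Dom T g" for
        f g
    proof -
      obtain A \<phi> B where f: "f = (A, \<phi>, B)" "A \<in> Ob" "B \<in> Ob" "\<phi> \<in> rep_hom A B" by (rule MorE[OF
          fg(1)])
      obtain B' \<psi> C where g: "g = (B', \<psi>, C)" "B' \<in> Ob" "C \<in> Ob" "\<psi> \<in> rep_hom B' C" by (rule MorE[OF
          fg(2)])
      have B: "B' = B" using fg(3) by (simp add: f g T_simps)
      show ?thesis
        using f(2-4) g(2-4) by (simp add: f(1) g(1) B T_simps QE hcomp_hom objs_closed qcomp)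
    qed
  qed
  moreover have "semi_iso X0 Y0 \<sigma> P (hom_map (P, Q)) s"
  proof -
    have "bij_betw (fst (s A)) (lcar A) (lcar A)" "bij_betw (snd (s A)) (mcar A) (mcar A)" if A: "A
        \<in> Ob" for A
      by (rule bij_betw_byWitness[of _ "fst (t A)"], auto simp: tsl stl sc tc A)
        (rule bij_betw_byWitness[of _ "snd (t A)"], auto simp: tsm stm sc tc A)
    then show ?thesis
      unfolding semi_iso_def
      by (simp add: PE s hom_map_def QE q_def hcomp_apply sc tc tsl tsm)
  qed
  ultimately show ?thesis
    by (intro bexI[of _ "(P, Q)"]) (auto simp: semi_def)
qed

definition scalar_part :: "('k, 'x, 'y) free_aut \<Rightarrow> 'k \<Rightarrow> 'k" where
  "scalar_part \<Upsilon> = (THE \<sigma>. \<sigma> \<in> Aut_k \<and> semi \<sigma> \<Upsilon>)"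

lemma scalar_part:
  assumes "\<Upsilon> \<in> cat_auts T"
  shows "scalar_part \<Upsilon> \<in> Aut_k" "semi (scalar_part \<Upsilon>) \<Upsilon>"
proof -
  obtain \<sigma> where \<sigma>: "\<sigma> \<in> Aut_k" "semi \<sigma> \<Upsilon>" using ex_semi[OF assms] by (elim bexE)
  then have "scalar_part \<Upsilon> = \<sigma>"
    unfolding scalar_part_def by (intro the_equality conjI) (simp_all add: semi_unique[OF assms, of
        _ \<sigma>])
  with \<sigma> show "scalar_part \<Upsilon> \<in> Aut_k" "semi (scalar_part \<Upsilon>) \<Upsilon>" by simp_all
qed

lemma scalar_part_eqI: "\<Upsilon> \<in> cat_auts T \<Longrightarrow> semi \<sigma> \<Upsilon> \<Longrightarrow> scalar_part \<Upsilon> = \<sigma>"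
  by (rule semi_unique[OF _ scalar_part(2)])

lemma group_hom_scalar_part: "group_hom (cat_aut_group T) field_aut_group scalar_part"
proof -
  interpret G: group "cat_aut_group T" by (rule group_T)
  have "scalar_part \<in> hom (cat_aut_group T) field_aut_group"
  proof (rule homI)
    fix \<Upsilon> assume "\<Upsilon> \<in> carrier (cat_aut_group T)"
    then show "scalar_part \<Upsilon> \<in> Aut_k" by (simp add: carrier_T scalar_part)
  next
    fix \<Upsilon>' \<Upsilon> assume "\<Upsilon>' \<in> carrier (cat_aut_group T)" "\<Upsilon> \<in> carrier (cat_aut_group T)"
    then have *: "\<Upsilon>' \<in> cat_auts T" "\<Upsilon> \<in> cat_auts T" "\<Upsilon>' \<otimes>\<^bsub>cat_aut_group T\<^esub> \<Upsilon> \<in> cat_auts T"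
      using G.m_closed by (simp_all add: carrier_T)
    have "scalar_part (\<Upsilon>' \<otimes>\<^bsub>cat_aut_group T\<^esub> \<Upsilon>) = scalar_part \<Upsilon>' \<circ> scalar_part \<Upsilon>"
      by (rule scalar_part_eqI[OF *(3) semi_mult[OF *(2,1) scalar_part(2)[OF *(2)] scalar_part(2)[OF
          *(1)]]])
    then show "scalar_part (\<Upsilon>' \<otimes>\<^bsub>cat_aut_group T\<^esub> \<Upsilon>) = scalar_part \<Upsilon>' \<otimes>\<^bsub>field_aut_group\<^esub> scalar_part
        \<Upsilon>"
      by (simp add: field_aut_mult scalar_part *)
  qed
  then show ?thesis
    by (simp add: group_hom_def group_hom_axioms_def group_T group_field_aut)
qed

lemma kernel_scalar_part: "kernel (cat_aut_group T) field_aut_group scalar_part = inner_auts T"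
proof -
  have iff: "scalar_part \<Upsilon> = (\<lambda>c. c) \<longleftrightarrow> \<Upsilon> \<in> inner_auts T" if "\<Upsilon> \<in> cat_auts T" for \<Upsilon>
    unfolding semi_id_iff_inner[OF that, symmetric]
  proof
    assume "scalar_part \<Upsilon> = (\<lambda>c. c)"
    then show "semi (\<lambda>c. c) \<Upsilon>" using scalar_part(2)[OF that] by simp
  qed (rule scalar_part_eqI[OF that])
  have sub: "\<Upsilon> \<in> cat_auts T" if "\<Upsilon> \<in> inner_auts T" for \<Upsilon>
    using that by (auto simp: inner_auts_def)
  have "kernel (cat_aut_group T) field_aut_group scalar_part = {\<Upsilon> \<in> cat_auts T. scalar_part \<Upsilon> = (\<lambda>c.
      c)}"
    by (simp add: kernel_def carrier_T field_aut_one)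
  also have "\<dots> = inner_auts T"
  proof (intro subset_antisym subsetI)
    fix \<Upsilon> assume "\<Upsilon> \<in> {\<Upsilon> \<in> cat_auts T. scalar_part \<Upsilon> = (\<lambda>c. c)}"
    then show "\<Upsilon> \<in> inner_auts T" using iff[of \<Upsilon>] by simp
  qed (simp add: iff sub)
  finally show ?thesis .
qed

lemma scalar_part_surj: "scalar_part ` carrier (cat_aut_group T) = Aut_k"
proof
  show "scalar_part ` carrier (cat_aut_group T) \<subseteq> Aut_k"
    by (auto simp: carrier_T scalar_part)
  show "Aut_k \<subseteq> scalar_part ` carrier (cat_aut_group T)"
  proof
    fix \<sigma> :: "'k \<Rightarrow> 'k" assume "\<sigma> \<in> Aut_k"
    from semi_surj[OF this] obtain \<Upsilon> where "\<Upsilon> \<in> cat_auts T" "semi \<sigma> \<Upsilon>"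
      by (elim bexE)
    then show "\<sigma> \<in> scalar_part ` carrier (cat_aut_group T)"
      using scalar_part_eqI[of \<Upsilon> \<sigma>] by (intro image_eqI[of _ _ \<Upsilon>]) (simp_all add: carrier_T)
  qed
qed

end

theorem theorem5p4:
  fixes X0 :: "'x set" and Y0 :: "'y set"
  assumes "countable X0" and "infinite X0" and "countable Y0" and "infinite Y0"
  shows "inner_auts (theta0 TYPE('k::field_char_0) X0 Y0) \<lhd> cat_aut_group (theta0 TYPE('k) X0 Y0) \<and>
    cat_aut_group (theta0 TYPE('k) X0 Y0) Mod inner_auts (theta0 TYPE('k) X0 Y0)
      \<cong> (field_aut_group :: ('k \<Rightarrow> 'k) monoid)"
proof -
  interpret theta0_aut X0 Y0 "theta0 TYPE('k) X0 Y0"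
    using assms by unfold_locales simp_all
  \<comment> \<open>Normality holds because the inner automorphisms form the kernel, and the
    quotient is identified by the first isomorphism theorem.\<close>
  note h = group_hom_scalar_part
  show ?thesis
    using group_hom.normal_kernel[OF h] group_hom.FactGroup_iso[OF h scalar_part_surj]
    unfolding kernel_scalar_part by (rule conjI)
qed

end
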